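(* A graph-knot $\mathfrak{F}$ is non-realisable if and only if the homotopy class of looped graphs $\chi(\mathfrak{F})$ is non-realisable.
   Context: All graphs are finite and are considered up to isomorphism (preserving labels or loops). All matrices, determinants, ranks and coranks are over $\mathbb{Z}_2$; $E$ is the identity matrix; the determinant of the empty matrix is $1$. $N(v)$ is the set of vertices adjacent to $v$. **Labeled graphs.** A labeled graph is a simple graph in which every vertex $v$ carries a pair $(a,\alpha)$, with $a\in\{0,1\}$ the framing and $\alpha=\operatorname{sign} v\in\{+,-\}$ the sign of $v$ (identified with $\pm1$). Its adjacency matrix $A(G)=(a_{ij})$ over $\mathbb{Z}_2$ (vertices enumerated $v_1,\dots,v_n$) has $a_{ii}$ = framing of $v_i$ and, for $i\neq j$, $a_{ij}=1$ iff $v_i,v_j$ are adjacent. $\operatorname{LC}(G;v)$ is obtained from $G$ by toggling the adjacency of $a,b$ for all $a\ne b$ in $N(v)$. $\operatorname{piv}(G;u,v)$ ($u\neq v$) is obtained from $G$ by toggling the adjacency of all pairs $x,y\notin\{u,v\}$ such that $x\in N(u)$, $y\in N(v)$ and either $x\notin N(v)$ or $y\notin N(u)$. **Graph-moves.** - $\Omega_g1$: addition/removal of an isolated vertex labeled $(0,\alpha)$, $\alpha\in\{\pm\}$. - $\Omega_g2$: addition/removal of two non-adjacent vertices labeled $(0,\alpha),(0,-\alpha)$, or of two adjacent vertices labeled $(1,\alpha),(1,-\alpha)$, which have the same adjacencies with all other vertices. - $\Omega_g3$: let $u,v,w$ be three vertices all labeled $(0,-)$ such that $u$ is adjacent only to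 $v$ and $w$, and $v,w$ are not adjacent. Toggle the adjacency of $u$ with $v$, with $w$, and with each $t\in (N(v)\setminus N(w))\cup(N(w)\setminus N(v))$, $t\neq u$; no other adjacencies change; switch the signs of $v$ and $w$ to $+$. The inverse operation is also an $\Omega_g3$ move. - $\Omega_g4$: for adjacent vertices $u,v$ labeled $(0,\alpha)$, $(0,\beta)$, replace $G$ by $\operatorname{piv}(G;u,v)$ and change the sign of $u$ to $-\beta$ and the sign of $v$ to $-\alpha$. - $\Omega_g4'$: for a vertex $v$ labeled $(1,\alpha)$, replace $G$ by $\operatorname{LC}(G;v)$, change the sign of $v$, and change the framing of each $u\in N(v)$. A graph-link is an equivalence class of labeled simple graphs modulo these moves. The number $\operatorname{corank}(A(G)+E)$ depends only on the graph-link of $G$; a graph-knot is a graph-link whose representatives $G$ satisfy $\operatorname{corank}(A(G)+E)=0$. **Looped graphs.** A looped graph is a graph without multiple edges in which loops are allowed. Moves: - $\Omega1$: addition/removal of an isolated looped or unlooped vertex. - $\Omega2$: addition/removal of two vertices having the same adjacencies with the other vertices, one of which is looped and the other unlooped. - $\Omega3$: let $u,v,w$ be three vertices such that $v$ is looped, $w$ is unlooped, $v$ and $w$ are adjacent, $u$ is adjacent to neither $v$ nor $w$, and every vertex $x\notin\{u,v,w\}$ is adjacent to either $0$ or precisely two of $u,v,w$. Toggle all three non-loop adjacencies $uv,uw,vw$ (remove $vw$, add $uv$ and $uw$). The inverse operation is also an $\Omega3$ move. A homotopy class of looped graphs is an equivalence class of looped graphs modulo $\Omega1,\Omega2,\Omega3$.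 **The map $\chi$.** Let $G$ be a labeled graph on $v_1,\dots,v_n$ with $\operatorname{corank}(A(G)+E)=0$. Put $B_i(G)=A(G)+E+E_{ii}$, where $E_{ii}$ is the matrix whose only nonzero entry is a $1$ in position $(i,i)$, and $w_i=(-1)^{\operatorname{corank} B_i(G)}\operatorname{sign} v_i$ (the writhe number at $v_i$). Let $H$ be the simple graph on $v_1,\dots,v_n$ whose adjacency matrix coincides with $(A(G)+E)^{-1}$ off the diagonal, and let $L(G)$ be obtained from $H$ by adding a loop at each $v_i$ with $w_i=-1$. For a graph-knot $\mathfrak{F}$ with representative $G$, $\chi(\mathfrak{F})$ is the homotopy class of $L(G)$; this is well-defined. **Realisability.** A chord diagram is a circle together with finitely many chords with pairwise distinct endpoints on the circle; it is labeled if each chord carries a label $(a,\alpha)$, $a\in\{0,1\}$, $\alpha\in\{\pm\}$. Two chords are linked if their endpoints alternate on the circle. The intersection graph of a chord diagram has one vertex per chord (with the label of the chord in the labeled case), two vertices being adjacent iff the chords are linked. A simple (labeled) graph is realisable if it is the intersection graph of a (labeled) chord diagram; a looped graph is realisable if the simple graph obtained by forgetting its loops is the intersection graph of a chord diagram. A graph-link (a homotopy class of looped graphs) is called non-realisable if it has no realisable representative. *)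

theory Defs
  imports
    "HOL-Library.Z2"
    "Jordan_Normal_Form.DL_Rank"
    "Jordan_Normal_Form.Gauss_Jordan_Elimination"
    Complex_Main
begin

text \<open>
  A finite graph has vertex set \<^term>\<open>{..<n}\<close> for a natural number \<open>n\<close>. As graphs are considered
  up to isomorphism (isomorphism is built into the equivalence relations below), this is no
  restriction, and the vertices added by a move may be taken to be the last ones. The values of
  the fields at arguments outside \<^term>\<open>{..<n}\<close> are irrelevant.
\<close>

record graph =
  nv :: nat
  adj :: "nat \<Rightarrow> nat \<Rightarrow> bool"

record labeled_graph = graph +
  framing :: "nat \<Rightarrow> bit"
  vsign :: "nat \<Rightarrow> int"

record looped_graph = graph +
  loop :: "nat \<Rightarrow> bool"

text \<open>For looped graphs, \<^const>\<open>adj\<close> describes the non-loop edges only.\<close>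

definition simple_graph :: "'a graph_scheme \<Rightarrow> bool" where
  "simple_graph G \<longleftrightarrow>
     (\<forall>i<nv G. \<not> adj G i i) \<and> (\<forall>i<nv G. \<forall>j<nv G. adj G i j \<longrightarrow> adj G j i)"

definition is_labeled_graph :: "labeled_graph \<Rightarrow> bool" where
  "is_labeled_graph G \<longleftrightarrow> simple_graph G \<and> (\<forall>i<nv G. vsign G i \<in> {1, -1})"

definition is_looped_graph :: "looped_graph \<Rightarrow> bool" where
  "is_looped_graph L \<longleftrightarrow> simple_graph L"

definition nbhd :: "'a graph_scheme \<Rightarrow> nat \<Rightarrow> nat set" where
  "nbhd G v = {x. x < nv G \<and> adj G v x}"

definition toggle :: "nat set set \<Rightarrow> 'a graph_scheme \<Rightarrow> 'a graph_scheme" where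
  "toggle P G = G\<lparr>adj := (\<lambda>x y. adj G x y \<noteq> ({x, y} \<in> P))\<rparr>"


section \<open>Isomorphism\<close>

definition graph_iso_via :: "(nat \<Rightarrow> nat) \<Rightarrow> 'a graph_scheme \<Rightarrow> 'b graph_scheme \<Rightarrow> bool" where
  "graph_iso_via f G H \<longleftrightarrow> bij_betw f {..<nv G} {..<nv H} \<and>
     (\<forall>i<nv G. \<forall>j<nv G. adj H (f i) (f j) \<longleftrightarrow> adj G i j)"

definition graph_iso :: "'a graph_scheme \<Rightarrow> 'b graph_scheme \<Rightarrow> bool" where
  "graph_iso G H \<longleftrightarrow> (\<exists>f. graph_iso_via f G H)"

definition labeled_iso :: "labeled_graph \<Rightarrow> labeled_graph \<Rightarrow> bool" where
  "labeled_iso G H \<longleftrightarrow> (\<exists>f. graph_iso_via f G H \<and>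
     (\<forall>i<nv G. framing H (f i) = framing G i \<and> vsign H (f i) = vsign G i))"

definition looped_iso :: "looped_graph \<Rightarrow> looped_graph \<Rightarrow> bool" where
  "looped_iso L M \<longleftrightarrow> (\<exists>f. graph_iso_via f L M \<and>
     (\<forall>i<nv L. loop M (f i) \<longleftrightarrow> loop L i))"


section \<open>Graph-moves and graph-links\<close>

definition LC :: "nat \<Rightarrow> 'a graph_scheme \<Rightarrow> 'a graph_scheme" where
  "LC v G = toggle {{a, b} | a b. a \<in> nbhd G v \<and> b \<in> nbhd G v \<and> a \<noteq> b} G"

definition piv :: "nat \<Rightarrow> nat \<Rightarrow> 'a graph_scheme \<Rightarrow> 'a graph_scheme" where
  "piv u v G = toggle {{x, y} | x y. x \<notin> {u, v} \<and> y \<notin> {u, v} \<and>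
     x \<in> nbhd G u \<and> y \<in> nbhd G v \<and> (x \<notin> nbhd G v \<or> y \<notin> nbhd G u)} G"

text \<open>\<open>G\<close> is the labeled subgraph of \<open>G'\<close> induced on the vertices of \<open>G\<close>.\<close>

definition labeled_extends :: "labeled_graph \<Rightarrow> labeled_graph \<Rightarrow> bool" where
  "labeled_extends G G' \<longleftrightarrow> nv G \<le> nv G' \<and>
     (\<forall>i<nv G. framing G' i = framing G i \<and> vsign G' i = vsign G i \<and>
       (\<forall>j<nv G. adj G' i j \<longleftrightarrow> adj G i j))"

text \<open>
  Each move is given in one direction; inverses enter through the equivalence closure.
  The sign of the vertex added by the first move is an arbitrary element of \<open>{1, -1}\<close>,
  because both sides of a move are required to be labeled graphs.
\<close>

definition Omega_g1 :: "labeled_graph \<Rightarrow> labeled_graph \<Rightarrow> bool" where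
  "Omega_g1 G G' \<longleftrightarrow> labeled_extends G G' \<and> nv G' = nv G + 1 \<and>
     nbhd G' (nv G) = {} \<and> framing G' (nv G) = 0"

definition Omega_g2 :: "labeled_graph \<Rightarrow> labeled_graph \<Rightarrow> bool" where
  "Omega_g2 G G' \<longleftrightarrow> labeled_extends G G' \<and> nv G' = nv G + 2 \<and>
     (let u = nv G; v = nv G + 1 in
        (\<forall>x<nv G. adj G' u x \<longleftrightarrow> adj G' v x) \<and> vsign G' v = - vsign G' u \<and>
        (\<not> adj G' u v \<and> framing G' u = 0 \<and> framing G' v = 0 \<or>
         adj G' u v \<and> framing G' u = 1 \<and> framing G' v = 1))"

definition Omega_g3 :: "labeled_graph \<Rightarrow> labeled_graph \<Rightarrow> bool" where
  "Omega_g3 G G' \<longleftrightarrow> (\<exists>u v w. {u, v, w} \<subseteq> {..<nv G} \<and> distinct [u, v, w] \<and>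
     (\<forall>x\<in>{u, v, w}. framing G x = 0 \<and> vsign G x = -1) \<and>
     nbhd G u = {v, w} \<and> \<not> adj G v w \<and>
     G' = toggle {{u, t} | t. t \<in> {v, w} \<union>
                    ((nbhd G v - nbhd G w) \<union> (nbhd G w - nbhd G v) - {u})} G
            \<lparr>vsign := (vsign G)(v := 1, w := 1)\<rparr>)"

definition Omega_g4 :: "labeled_graph \<Rightarrow> labeled_graph \<Rightarrow> bool" where
  "Omega_g4 G G' \<longleftrightarrow> (\<exists>u<nv G. \<exists>v<nv G. u \<noteq> v \<and> adj G u v \<and>
     framing G u = 0 \<and> framing G v = 0 \<and>
     G' = piv u v G \<lparr>vsign := (vsign G)(u := - vsign G v, v := - vsign G u)\<rparr>)"

definition Omega_g4' :: "labeled_graph \<Rightarrow> labeled_graph \<Rightarrow> bool" where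
  "Omega_g4' G G' \<longleftrightarrow> (\<exists>v<nv G. framing G v = 1 \<and>
     G' = LC v G \<lparr>vsign := (vsign G)(v := - vsign G v),
                  framing := (\<lambda>x. if x \<in> nbhd G v then framing G x + 1 else framing G x)\<rparr>)"

definition graph_move :: "labeled_graph \<Rightarrow> labeled_graph \<Rightarrow> bool" where
  "graph_move G G' \<longleftrightarrow> is_labeled_graph G \<and> is_labeled_graph G' \<and>
     (labeled_iso G G' \<or> Omega_g1 G G' \<or> Omega_g2 G G' \<or> Omega_g3 G G' \<or>
      Omega_g4 G G' \<or> Omega_g4' G G')"

definition graph_link_rel :: "(labeled_graph \<times> labeled_graph) set" where
  "graph_link_rel = {(G, G'). is_labeled_graph G \<and> is_labeled_graph G' \<and> equivclp graph_move G G'}"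

definition graph_link :: "labeled_graph set \<Rightarrow> bool" where
  "graph_link F \<longleftrightarrow> F \<in> Collect is_labeled_graph // graph_link_rel"


section \<open>Adjacency matrices and graph-knots\<close>

definition adj_matrix :: "labeled_graph \<Rightarrow> bit mat" where
  "adj_matrix G = mat (nv G) (nv G)
     (\<lambda>(i, j). if i = j then framing G i else of_bool (adj G i j))"

definition corank :: "bit mat \<Rightarrow> nat" where
  "corank M = dim_row M - vec_space.rank (dim_row M) M"

definition graph_knot :: "labeled_graph set \<Rightarrow> bool" where
  "graph_knot F \<longleftrightarrow> graph_link F \<and> (\<forall>G\<in>F. corank (adj_matrix G + 1\<^sub>m (nv G)) = 0)"


section \<open>Looped graphs and their homotopy classes\<close>

definition looped_extends :: "looped_graph \<Rightarrow> looped_graph \<Rightarrow> bool" where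
  "looped_extends L L' \<longleftrightarrow> nv L \<le> nv L' \<and>
     (\<forall>i<nv L. (loop L' i \<longleftrightarrow> loop L i) \<and> (\<forall>j<nv L. adj L' i j \<longleftrightarrow> adj L i j))"

definition Omega1 :: "looped_graph \<Rightarrow> looped_graph \<Rightarrow> bool" where
  "Omega1 L L' \<longleftrightarrow> looped_extends L L' \<and> nv L' = nv L + 1 \<and> nbhd L' (nv L) = {}"

text \<open>The two vertices added by the second move may or may not be adjacent to each other.\<close>

definition Omega2 :: "looped_graph \<Rightarrow> looped_graph \<Rightarrow> bool" where
  "Omega2 L L' \<longleftrightarrow> looped_extends L L' \<and> nv L' = nv L + 2 \<and>
     (let u = nv L; v = nv L + 1 in
        (\<forall>x<nv L. adj L' u x \<longleftrightarrow> adj L' v x) \<and> loop L' u \<noteq> loop L' v)"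

definition Omega3 :: "looped_graph \<Rightarrow> looped_graph \<Rightarrow> bool" where
  "Omega3 L L' \<longleftrightarrow> (\<exists>u v w. {u, v, w} \<subseteq> {..<nv L} \<and> distinct [u, v, w] \<and>
     loop L v \<and> \<not> loop L w \<and> adj L v w \<and> \<not> adj L u v \<and> \<not> adj L u w \<and>
     (\<forall>x<nv L. x \<notin> {u, v, w} \<longrightarrow> card (nbhd L x \<inter> {u, v, w}) \<in> {0, 2}) \<and>
     L' = toggle {{u, v}, {u, w}, {v, w}} L)"

definition looped_move :: "looped_graph \<Rightarrow> looped_graph \<Rightarrow> bool" where
  "looped_move L L' \<longleftrightarrow> is_looped_graph L \<and> is_looped_graph L' \<and>
     (looped_iso L L' \<or> Omega1 L L' \<or> Omega2 L L' \<or> Omega3 L L')"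

definition homotopy_rel :: "(looped_graph \<times> looped_graph) set" where
  "homotopy_rel =
     {(L, L'). is_looped_graph L \<and> is_looped_graph L' \<and> equivclp looped_move L L'}"

definition homotopy_class :: "looped_graph \<Rightarrow> looped_graph set" where
  "homotopy_class L = homotopy_rel `` {L}"


section \<open>The map from graph-knots to homotopy classes\<close>

definition unit_diag :: "nat \<Rightarrow> nat \<Rightarrow> bit mat" where
  "unit_diag n i = mat n n (\<lambda>(a, b). of_bool (a = i \<and> b = i))"

definition B_matrix :: "labeled_graph \<Rightarrow> nat \<Rightarrow> bit mat" where
  "B_matrix G i = adj_matrix G + 1\<^sub>m (nv G) + unit_diag (nv G) i"

definition writhe :: "labeled_graph \<Rightarrow> nat \<Rightarrow> int" where
  "writhe G i = (-1) ^ corank (B_matrix G i) * vsign G i"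

text \<open>Only used when \<open>corank (adj_matrix G + 1\<^sub>m (nv G)) = 0\<close>, so that the inverse exists.\<close>

definition L_graph :: "labeled_graph \<Rightarrow> looped_graph" where
  "L_graph G = \<lparr>nv = nv G,
     adj = (\<lambda>i j. i \<noteq> j \<and> the (mat_inverse (adj_matrix G + 1\<^sub>m (nv G))) $$ (i, j) = 1),
     loop = (\<lambda>i. writhe G i = -1)\<rparr>"

text \<open>The homotopy class does not depend on the chosen representative of a graph-knot.\<close>

definition chi :: "labeled_graph set \<Rightarrow> looped_graph set" where
  "chi F = homotopy_class (L_graph (SOME G. G \<in> F))"


section \<open>Chord diagrams and realisability\<close>

text \<open>
  The points of the circle are parametrised by their angle in \<open>[0, 2\<pi>)\<close>. Chord number \<open>i\<close> is
  given by its two end points, in either order.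
\<close>

record chord_diagram =
  nchords :: nat
  chord :: "nat \<Rightarrow> real \<times> real"

record labeled_chord_diagram = chord_diagram +
  cframing :: "nat \<Rightarrow> bit"
  csign :: "nat \<Rightarrow> int"

definition endpoints :: "real \<times> real \<Rightarrow> real set" where
  "endpoints c = {fst c, snd c}"

definition is_chord_diagram :: "'a chord_diagram_scheme \<Rightarrow> bool" where
  "is_chord_diagram D \<longleftrightarrow>
     (\<forall>i<nchords D. fst (chord D i) \<noteq> snd (chord D i) \<and>
        endpoints (chord D i) \<subseteq> {0..<2 * pi}) \<and>
     (\<forall>i<nchords D. \<forall>j<nchords D. i \<noteq> j \<longrightarrow>
        endpoints (chord D i) \<inter> endpoints (chord D j) = {})"

definition is_labeled_chord_diagram :: "labeled_chord_diagram \<Rightarrow> bool" where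
  "is_labeled_chord_diagram D \<longleftrightarrow>
     is_chord_diagram D \<and> (\<forall>i<nchords D. csign D i \<in> {1, -1})"

text \<open>
  The end points of \<open>c\<close> and \<open>d\<close> alternate iff exactly one end point of \<open>d\<close> lies on the open arc
  of angles strictly between those of the end points of \<open>c\<close>.
\<close>

definition linked :: "real \<times> real \<Rightarrow> real \<times> real \<Rightarrow> bool" where
  "linked c d \<longleftrightarrow>
     card (endpoints d \<inter> {min (fst c) (snd c)<..<max (fst c) (snd c)}) = 1"

definition intersection_graph :: "'a chord_diagram_scheme \<Rightarrow> graph" where
  "intersection_graph D =
     \<lparr>nv = nchords D, adj = (\<lambda>i j. i \<noteq> j \<and> linked (chord D i) (chord D j))\<rparr>"

definition labeled_intersection_graph :: "labeled_chord_diagram \<Rightarrow> labeled_graph" where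
  "labeled_intersection_graph D =
     \<lparr>nv = nchords D, adj = (\<lambda>i j. i \<noteq> j \<and> linked (chord D i) (chord D j)),
      framing = cframing D, vsign = csign D\<rparr>"

definition labeled_realisable :: "labeled_graph \<Rightarrow> bool" where
  "labeled_realisable G \<longleftrightarrow>
     (\<exists>D. is_labeled_chord_diagram D \<and> labeled_iso (labeled_intersection_graph D) G)"

definition looped_realisable :: "looped_graph \<Rightarrow> bool" where
  "looped_realisable L \<longleftrightarrow>
     (\<exists>D :: chord_diagram. is_chord_diagram D \<and>
        graph_iso (intersection_graph D) (graph.truncate L))"

definition nonrealisable_graph_link :: "labeled_graph set \<Rightarrow> bool" where
  "nonrealisable_graph_link F \<longleftrightarrow> \<not> (\<exists>G\<in>F. labeled_realisable G)"

definition nonrealisable_homotopy_class :: "looped_graph set \<Rightarrow> bool" where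
  "nonrealisable_homotopy_class C \<longleftrightarrow> \<not> (\<exists>L\<in>C. looped_realisable L)"

end

theory Submission
  imports Defs
begin

text \<open>
  For a labeled graph \<open>G\<close> of corank zero put \<open>N = (A(G) + E)\<^sup>-\<^sup>1\<close>. Then \<open>G\<close> is equivalent to the data of
  \<open>L(G)\<close>, which records the off-diagonal part of \<open>N\<close> and the writhe numbers, together with the diagonal \<open>d\<close> of \<open>N\<close>.
  Every looped graph \<open>L\<close> arises in this way, since some choice of \<open>d\<close> makes \<open>N\<close> invertible. The moves \<open>\<Omega>\<^sub>g4\<close> and
  \<open>\<Omega>\<^sub>g4'\<close> leave \<open>L\<close> unchanged and connect any two choices of \<open>d\<close>. The moves \<open>\<Omega>\<^sub>g1\<close> and \<open>\<Omega>\<^sub>g2\<close> correspond to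
  \<open>\<Omega>1\<close> and \<open>\<Omega>2\<close> by block inversion. The move \<open>\<Omega>\<^sub>g3\<close> toggles a triangle in \<open>L\<close>, up to exchanging two vertices;
  the resulting variants of the third move reduce to \<open>\<Omega>3\<close> modulo \<open>\<Omega>2\<close>. Conversely \<open>\<Omega>3\<close> lifts to labeled graphs: after
  adding a suitable pair of vertices by \<open>\<Omega>2\<close>, \<open>d\<close> can be chosen such that \<open>\<Omega>\<^sub>g3\<close> applies. Hence \<open>\<chi>\<close> is
  well-defined and injective. Finally, \<open>A(G) + E\<close> and its inverse are related by principal pivots, which act on the
  off-diagonal parts by local complementations, and these preserve circle graphs (reflect the arc cut off by a chord). So
  \<open>G\<close> is realisable if and only if \<open>L(G)\<close> is.
\<close>

section \<open>Linear algebra over the field with two elements\<close>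

text \<open>Two obstacles shape the proof. The diagonal \<open>d\<close> is not visible in
  \<open>L\<close>, so a looped graph has a whole family of labeled graphs above it. The transport
  back to labeled graphs is therefore a relation, \<open>preimages_equiv\<close>, that speaks of all
  of them at once, and any convenient \<open>d\<close> may be picked wherever a move has to be
  lifted. The second obstacle is \<open>Omega_g3\<close>, which demands a fixed 3 by 3 block of A(G)
  + E. The inverse of this block is the Schur complement of N with respect to all other vertices.
  Its off-diagonal entries are all 1 before the move and all 0 after it. Its diagonal can be
  adjusted through \<open>d\<close> at the three vertices, but its off-diagonal entries are
  determined by the rest of the graph and of \<open>d\<close>. Since two of any three bits agree, it
  suffices to be able to change one chosen entry, and this is what the added pair of vertices
  does.\<close>

declare add_bit_eq_xor [simp del] mult_bit_eq_and [simp del] minus_bit_def [simp del] uminus_bit_def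
  [simp del]

text \<open>Matrices are plain functions, so that indices can be added, permuted and restricted
  freely. Only \<open>N M = E\<close> is recorded; for symmetric matrices
  \<open>inverse_on_swap\<close> yields the other product.\<close>

definition inverse_on :: "nat \<Rightarrow> (nat \<Rightarrow> nat \<Rightarrow> bit) \<Rightarrow> (nat \<Rightarrow> nat \<Rightarrow> bit) \<Rightarrow> bool" where
  "inverse_on n M N \<longleftrightarrow> (\<forall>i<n. \<forall>j<n. (\<Sum>k<n. N i k * M k j) = of_bool (i = j))"

definition symmetric_on :: "nat set \<Rightarrow> (nat \<Rightarrow> nat \<Rightarrow> bit) \<Rightarrow> bool" where
  "symmetric_on S M \<longleftrightarrow> (\<forall>i\<in>S. \<forall>j\<in>S. M i j = M j i)"

text \<open>The index set is arbitrary because the condition is also used on the complement of three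
  vertices and in an induction over vertex sets.\<close>

definition nonsingular_on :: "nat set \<Rightarrow> (nat \<Rightarrow> nat \<Rightarrow> bit) \<Rightarrow> bool" where
  "nonsingular_on S M \<longleftrightarrow> (\<forall>x. (\<forall>i\<in>S. (\<Sum>j\<in>S. M i j * x j) = 0) \<longrightarrow> (\<forall>i\<in>S. x i = 0))"

lemma nonsingular_onD:
  assumes "nonsingular_on S M" "\<And>i. i \<in> S \<Longrightarrow> (\<Sum>j\<in>S. M i j * x j) = 0" "i \<in> S"
  shows "x i = 0"
  using assms unfolding nonsingular_on_def by blast

lemma bit_add_eq_0_iff: "a + b = 0 \<longleftrightarrow> a = b" for a b :: bit
  by (cases a; cases b) auto

lemma sum_delta_mult [simp]:
  fixes f :: "nat \<Rightarrow> bit"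
  shows "i < n \<Longrightarrow> (\<Sum>k<n. of_bool (i = k) * f k) = f i"
    and "i < n \<Longrightarrow> (\<Sum>k<n. of_bool (k = i) * f k) = f i"
    and "i < n \<Longrightarrow> (\<Sum>k<n. f k * of_bool (i = k)) = f i"
    and "i < n \<Longrightarrow> (\<Sum>k<n. f k * of_bool (k = i)) = f i"
  by (simp_all add: of_bool_def if_distrib if_distribR sum.delta cong: if_cong)

text \<open>Vectors over Z_2 indexed by \<open>S\<close> form a finite set, and a trivial kernel
  makes the linear map on it injective, hence onto.\<close>

lemma nonsingular_on_surj:
  assumes "finite S" "nonsingular_on S M"
  shows "\<exists>x. \<forall>i\<in>S. (\<Sum>j\<in>S. M i j * x j) = b i"
proof -
  define X where "X = S \<rightarrow>\<^sub>E (UNIV :: bit set)"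
  define f where "f x = restrict (\<lambda>i. \<Sum>j\<in>S. M i j * x j) S" for x
  have UNIV_bit: "(UNIV :: bit set) = {0, 1}"
    using bit.exhaust by auto
  have "finite X" unfolding X_def UNIV_bit by (intro finite_PiE assms) simp
  moreover have "f ` X \<subseteq> X" unfolding f_def X_def by auto
  moreover have "inj_on f X"
  proof
    fix x y assume xy: "x \<in> X" "y \<in> X" "f x = f y"
    have "\<forall>i\<in>S. (\<Sum>j\<in>S. M i j * (x j + y j)) = 0"
    proof
      fix i assume "i \<in> S"
      with fun_cong[OF xy(3), of i] have "(\<Sum>j\<in>S. M i j * x j) = (\<Sum>j\<in>S. M i j * y j)"
        by (simp add: f_def)
      then show "(\<Sum>j\<in>S. M i j * (x j + y j)) = 0"
        by (simp add: distrib_left sum.distrib)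
    qed
    then have "\<forall>i\<in>S. x i + y i = 0"
      using assms(2)[unfolded nonsingular_on_def, rule_format, of "\<lambda>j. x j + y j"] by blast
    then show "x = y"
      using xy(1,2) unfolding X_def
      by (intro PiE_ext) (auto simp: bit_add_eq_0_iff)
  qed
  ultimately have "f ` X = X" by (simp add: endo_inj_surj)
  moreover have "restrict b S \<in> X" by (simp add: X_def)
  ultimately obtain x where "x \<in> X" "restrict b S = f x" by (metis imageE)
  have "(\<Sum>j\<in>S. M i j * x j) = b i" if "i \<in> S" for i
    using fun_cong[OF \<open>restrict b S = f x\<close>, of i] that by (simp add: f_def)
  then show ?thesis by blast
qed

lemma nonsingular_on_cong:
  assumes "\<And>i j. i \<in> S \<Longrightarrow> j \<in> S \<Longrightarrow> M i j = M' i j" "nonsingular_on S M"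
  shows "nonsingular_on S M'"
proof -
  have "(\<Sum>j\<in>S. M' i j * x j) = (\<Sum>j\<in>S. M i j * x j)" if "i \<in> S" for i x
    using assms(1) that by (intro sum.cong) auto
  with assms(2) show ?thesis unfolding nonsingular_on_def by metis
qed

definition with_diag :: "(nat \<Rightarrow> nat \<Rightarrow> bit) \<Rightarrow> (nat \<Rightarrow> bit) \<Rightarrow> nat \<Rightarrow> nat \<Rightarrow> bit" where
  "with_diag H d i j = (if i = j then d i else H i j)"

text \<open>Indices are added one at a time. With \<open>y\<close> solving the system for the new
  column, the Schur complement of the old block is
  \<open>d t + (\<Sum>j\<in>S. H t j * y j)\<close>, and the new diagonal entry is chosen to make it
  1.\<close>

lemma ex_nonsingular_on_diag:
  assumes "finite S" "symmetric_on S H"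
  shows "\<exists>d. nonsingular_on S (with_diag H d)"
  using assms
proof (induction S rule: finite_induct)
  case empty
  then show ?case by (simp add: nonsingular_on_def)
next
  case (insert t S)
  then obtain d where d: "nonsingular_on S (with_diag H d)" by (auto simp: symmetric_on_def)
  obtain y where y: "\<forall>i\<in>S. (\<Sum>j\<in>S. with_diag H d i j * y j) = H i t"
    using nonsingular_on_surj[OF insert.hyps(1) d, of "\<lambda>i. H i t"] by blast
  define d' where "d' = d(t := (\<Sum>j\<in>S. H t j * y j) + 1)"
  have d': "with_diag H d' i j = with_diag H d i j" if "i \<in> S" "j \<in> S" for i j
    using that insert.hyps by (auto simp: with_diag_def d'_def)
  have "nonsingular_on (insert t S) (with_diag H d')"
    unfolding nonsingular_on_def
  proof (intro allI impI)
    fix x assume x: "\<forall>i\<in>insert t S. (\<Sum>j\<in>insert t S. with_diag H d' i j * x j) = 0"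
    \<comment> \<open>Elimination of the unknown \<open>x t\<close>: the combined vector lies in the
      kernel of the old block.\<close>
    have "\<forall>i\<in>S. (\<Sum>j\<in>S. with_diag H d i j * (x j + y j * x t)) = 0"
    proof
      fix i assume i: "i \<in> S"
      then have "i \<noteq> t" using insert.hyps by auto
      with x i insert.hyps d' have "H i t * x t + (\<Sum>j\<in>S. with_diag H d i j * x j) = 0"
        by (auto simp: with_diag_def[of _ _ _ t] cong: sum.cong)
      moreover have "(\<Sum>j\<in>S. with_diag H d i j * (x j + y j * x t))
          = (\<Sum>j\<in>S. with_diag H d i j * x j) + (\<Sum>j\<in>S. with_diag H d i j * y j) * x t"
        by (simp add: algebra_simps sum.distrib sum_distrib_left)
      ultimately show "(\<Sum>j\<in>S. with_diag H d i j * (x j + y j * x t)) = 0"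
        using y i by (simp add: add.commute)
    qed
    then have eq: "\<forall>j\<in>S. x j + y j * x t = 0"
      using d[unfolded nonsingular_on_def, rule_format, of "\<lambda>j. x j + y j * x t"] by blast
    then have eq': "\<forall>j\<in>S. x j = y j * x t" by (simp add: bit_add_eq_0_iff)
    have "(\<Sum>j\<in>S. with_diag H d' t j * x j) = (\<Sum>j\<in>S. H t j * x j)"
      using insert.hyps by (intro sum.cong) (auto simp: with_diag_def)
    moreover have "(\<Sum>j\<in>insert t S. with_diag H d' t j * x j) = 0" using x by blast
    ultimately have "d' t * x t + (\<Sum>j\<in>S. H t j * x j) = 0"
      using insert.hyps by (simp add: with_diag_def)
    moreover have "(\<Sum>j\<in>S. H t j * x j) = (\<Sum>j\<in>S. H t j * y j) * x t"
      using eq' by (simp add: sum_distrib_right mult.assoc)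
    ultimately have "x t = 0" by (simp add: d'_def algebra_simps)
    with eq' show "\<forall>i\<in>insert t S. x i = 0" by auto
  qed
  then show ?case by blast
qed

lemma inverse_on_swap:
  assumes "inverse_on n M N" "symmetric_on {..<n} M" "symmetric_on {..<n} N"
  shows "inverse_on n N M"
  unfolding inverse_on_def
proof (intro allI impI)
  fix i j assume ij: "i < n" "j < n"
  have "(\<Sum>k<n. M i k * N k j) = (\<Sum>k<n. N j k * M k i)"
    using assms(2,3) ij by (intro sum.cong) (auto simp: symmetric_on_def)
  also have "\<dots> = of_bool (i = j)" using assms(1) ij by (auto simp: inverse_on_def)
  finally show "(\<Sum>k<n. M i k * N k j) = of_bool (i = j)" .
qed

lemma mult_assoc_sum:
  fixes A B C :: "nat \<Rightarrow> nat \<Rightarrow> bit"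
  shows "(\<Sum>k<n. A i k * (\<Sum>l<m. B k l * c l)) = (\<Sum>l<m. (\<Sum>k<n. A i k * B k l) * c l)"
proof -
  have "(\<Sum>k<n. A i k * (\<Sum>l<m. B k l * c l)) = (\<Sum>k<n. \<Sum>l<m. A i k * B k l * c l)"
    by (simp add: sum_distrib_left mult.assoc)
  also have "\<dots> = (\<Sum>l<m. \<Sum>k<n. A i k * B k l * c l)" by (rule sum.swap)
  finally show ?thesis by (simp add: sum_distrib_right)
qed

lemma inverse_on_apply:
  assumes "inverse_on n M N" "i < n"
  shows "(\<Sum>k<n. N i k * (\<Sum>l<n. M k l * c l)) = c i"
proof -
  have "(\<Sum>l<n. (\<Sum>k<n. N i k * M k l) * c l) = (\<Sum>l<n. of_bool (i = l) * c l)"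
    using assms by (intro sum.cong) (auto simp: inverse_on_def)
  with assms(2) show ?thesis by (simp add: mult_assoc_sum)
qed

lemma inverse_on_unique:
  assumes "inverse_on n M N" "inverse_on n N' M" "i < n" "j < n"
  shows "N' i j = N i j"
proof -
  have "N' i j = (\<Sum>k<n. N i k * (\<Sum>l<n. M k l * N' l j))"
    using inverse_on_apply[OF assms(1,3), of "\<lambda>l. N' l j"] by simp
  also have "\<dots> = (\<Sum>k<n. N i k * of_bool (k = j))"
    using assms by (intro sum.cong) (auto simp: inverse_on_def)
  also have "\<dots> = N i j" using assms by simp
  finally show ?thesis .
qed

lemma inverse_on_imp_nonsingular_on:
  assumes "inverse_on n M N" shows "nonsingular_on {..<n} M"
  unfolding nonsingular_on_def
proof (intro allI impI ballI)
  fix x i assume x: "\<forall>i\<in>{..<n}. (\<Sum>j\<in>{..<n}. M i j * x j) = 0" "i \<in> {..<n}"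
  then have "x i = (\<Sum>k<n. N i k * (\<Sum>l<n. M k l * x l))"
    using inverse_on_apply[OF assms, of i x] by simp
  also have "\<dots> = 0" using x by (intro sum.neutral) auto
  finally show "x i = 0" .
qed

text \<open>Solving for the columns one by one gives a right inverse. As \<open>M\<close> is
  symmetric, its transpose is a left inverse; both agree, so the inverse is symmetric.\<close>

lemma nonsingular_on_imp_inverse_on:
  assumes M: "nonsingular_on {..<n} M" "symmetric_on {..<n} M"
  shows "\<exists>N. symmetric_on {..<n} N \<and> inverse_on n M N \<and> inverse_on n N M"
proof -
  have "\<forall>j. \<exists>x. \<forall>i<n. (\<Sum>k<n. M i k * x k) = of_bool (i = j)"
  proof
    fix j
    show "\<exists>x. \<forall>i<n. (\<Sum>k<n. M i k * x k) = of_bool (i = j)"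
      using nonsingular_on_surj[OF finite_lessThan M(1), of "\<lambda>i. of_bool (i = j)"]
      by (simp only: Ball_def lessThan_iff)
  qed
  then obtain N' where N': "\<And>i j. i < n \<Longrightarrow> (\<Sum>k<n. M i k * N' j k) = of_bool (i = j)"
    using choice[of "\<lambda>j x. \<forall>i<n. (\<Sum>k<n. M i k * x k) = of_bool (i = j)"] by blast
  define N where "N i j = N' j i" for i j
  have NM: "inverse_on n N M" using N' by (auto simp: inverse_on_def N_def)
  have Nt: "inverse_on n M (\<lambda>i j. N j i)"
    unfolding inverse_on_def
  proof (intro allI impI)
    fix i j assume ij: "i < n" "j < n"
    have "(\<Sum>k<n. N k i * M k j) = (\<Sum>k<n. M j k * N k i)"
      using M(2) ij by (intro sum.cong) (auto simp: symmetric_on_def mult.commute)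
    then show "(\<Sum>k<n. N k i * M k j) = of_bool (i = j)" using NM ij by (auto simp: inverse_on_def)
  qed
  have "symmetric_on {..<n} N" unfolding symmetric_on_def
    using inverse_on_unique[OF Nt NM] by simp
  moreover from this have "inverse_on n M N" using inverse_on_swap[OF NM] M(2) by blast
  ultimately show ?thesis using NM by blast
qed

lemma inverse_on_cong:
  assumes "inverse_on n M N" "\<And>i j. i < n \<Longrightarrow> j < n \<Longrightarrow> M' i j = M i j"
    "\<And>i j. i < n \<Longrightarrow> j < n \<Longrightarrow> N' i j = N i j"
  shows "inverse_on n M' N'"
  using assms unfolding inverse_on_def by (auto cong: sum.cong_simp)

section \<open>The map on representatives\<close>

text \<open>The matrix \<open>A(G) + E\<close>.\<close>

definition shifted_adj :: "labeled_graph \<Rightarrow> nat \<Rightarrow> nat \<Rightarrow> bit" where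
  "shifted_adj G i j = (if i = j then framing G i + 1 else of_bool (adj G i j))"

definition diag_adj :: "looped_graph \<Rightarrow> (nat \<Rightarrow> bit) \<Rightarrow> nat \<Rightarrow> nat \<Rightarrow> bit" where
  "diag_adj L d = with_diag (\<lambda>i j. of_bool (adj L i j)) d"

text \<open>
  The diagonal \<open>d\<close> of \<open>(A(G) + E)\<^sup>-\<^sup>1\<close> is not part of \<open>L\<close>. The condition on the loops expresses
  \<open>w\<^sub>i = (-1)\<^sup>d\<^sup>i sign v\<^sub>i\<close>, because \<open>corank B\<^sub>i = d\<^sub>i\<close>.
\<close>

definition inverse_pair :: "labeled_graph \<Rightarrow> looped_graph \<Rightarrow> (nat \<Rightarrow> bit) \<Rightarrow> bool" where
  "inverse_pair G L d \<longleftrightarrow> is_labeled_graph G \<and> is_looped_graph L \<and> nv L = nv G \<and>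
     inverse_on (nv G) (shifted_adj G) (diag_adj L d) \<and>
     (\<forall>i<nv G. loop L i \<longleftrightarrow> vsign G i = (if d i = 1 then 1 else -1))"

lemma symmetric_on_shifted_adj: "is_labeled_graph G \<Longrightarrow> symmetric_on {..<nv G} (shifted_adj G)"
  by (auto simp: symmetric_on_def shifted_adj_def is_labeled_graph_def simple_graph_def)

lemma symmetric_on_diag_adj: "is_looped_graph L \<Longrightarrow> symmetric_on {..<nv L} (diag_adj L d)"
  by (auto simp: symmetric_on_def diag_adj_def with_diag_def is_looped_graph_def simple_graph_def)

lemma of_bool_eq_1_bit: "of_bool (x = 1) = x" for x :: bit
  by (cases x) auto

section \<open>Coranks and the writhe numbers\<close>

lemma det_nonsingular_on:
  fixes A :: "bit mat"
  assumes A: "A \<in> carrier_mat n n"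
  shows "det A \<noteq> 0 \<longleftrightarrow> nonsingular_on {..<n} (\<lambda>i j. A $$ (i, j))"
proof -
  have Av: "A *\<^sub>v v = vec n (\<lambda>i. \<Sum>j<n. A $$ (i, j) * v $ j)" if "v \<in> carrier_vec n" for v
    using A that by (intro eq_vecI) (auto simp: scalar_prod_def lessThan_atLeast0 intro!: sum.cong)
  show ?thesis
  proof
    assume det: "det A \<noteq> 0"
    show "nonsingular_on {..<n} (\<lambda>i j. A $$ (i, j))"
      unfolding nonsingular_on_def
    proof (intro allI impI)
      fix x assume x: "\<forall>i\<in>{..<n}. (\<Sum>j\<in>{..<n}. A $$ (i, j) * x j) = 0"
      have "A *\<^sub>v vec n x = 0\<^sub>v n"
        using x by (subst Av) (auto intro!: eq_vecI)
      then have "vec n x = 0\<^sub>v n"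
        using det det_0_iff_vec_prod_zero_field[OF A] vec_carrier by blast
      then show "\<forall>i\<in>{..<n}. x i = 0"
        by (metis index_vec index_zero_vec(1) lessThan_iff)
    qed
  next
    assume ns: "nonsingular_on {..<n} (\<lambda>i j. A $$ (i, j))"
    show "det A \<noteq> 0"
    proof
      assume "det A = 0"
      then obtain v where v: "v \<in> carrier_vec n" "v \<noteq> 0\<^sub>v n" "A *\<^sub>v v = 0\<^sub>v n"
        using det_0_iff_vec_prod_zero_field[OF A] by blast
      have "(\<Sum>j<n. A $$ (i, j) * v $ j) = 0" if "i < n" for i
        using arg_cong[OF v(3), of "\<lambda>w. w $ i"] that by (simp add: Av[OF v(1)])
      then have "\<forall>i\<in>{..<n}. v $ i = 0"
        by (intro ballI nonsingular_onD[OF ns, of "\<lambda>i. v $ i"]) auto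
      then have "v = 0\<^sub>v n" using v(1) by (intro eq_vecI) auto
      with v(2) show False by blast
    qed
  qed
qed

lemma corank_nonsingular_on:
  assumes A: "A \<in> carrier_mat n n"
  shows "corank A = 0 \<longleftrightarrow> nonsingular_on {..<n} (\<lambda>i j. A $$ (i, j))"
proof -
  have "corank A = 0 \<longleftrightarrow> vec_space.rank n A = n"
    using vec_space.rank_le_nc[OF A] A by (auto simp: corank_def)
  also have "\<dots> \<longleftrightarrow> det A \<noteq> 0" using vec_space.det_rank_iff[OF A] by simp
  finally show ?thesis using det_nonsingular_on[OF A] by simp
qed

text \<open>Adding E_ii multiplies the determinant by \<open>1 + N i i\<close>, and a matrix of rank
  one lowers the rank by at most one, so the corank is the bit \<open>N i i\<close>. This turns the
  writhe number into a condition on \<open>d\<close>.\<close>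

lemma corank_rank_one_update:
  assumes A: "A \<in> carrier_mat n n" and "i < n"
    and inv: "inverse_on n (\<lambda>i j. A $$ (i, j)) N" "inverse_on n N (\<lambda>i j. A $$ (i, j))"
  shows "corank (A + unit_diag n i) = (if N i i = 1 then 1 else 0)"
proof -
  let ?B = "A + unit_diag n i"
  have U: "unit_diag n i \<in> carrier_mat n n" by (simp add: unit_diag_def)
  have B: "?B \<in> carrier_mat n n" using A U by simp
  have rA: "vec_space.rank n A = n"
    using corank_nonsingular_on[OF A] inverse_on_imp_nonsingular_on[OF inv(1)] A vec_space.rank_le_nc[OF A]
    by (auto simp: corank_def)
  have "vec_space.rank n (unit_diag n i) \<le> 1"
    by (rule vec_space.rank_le_1_product_entries[OF U, of "\<lambda>a. of_bool (a = i)" "\<lambda>a. of_bool (a = i)"])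
      (auto simp: unit_diag_def)
  moreover have "?B + unit_diag n i = A"
    using A by (intro eq_matI) (auto simp: unit_diag_def)
  then have "n \<le> vec_space.rank n ?B + vec_space.rank n (unit_diag n i)"
    using vec_space.rank_subadditive[OF B U] rA by simp
  ultimately have le1: "corank ?B \<le> 1"
    using B unfolding corank_def by auto
  have Bx: "(\<Sum>j<n. ?B $$ (k, j) * x j) = (\<Sum>j<n. A $$ (k, j) * x j) + of_bool (k = i) * x i"
    if "k < n" for k x
  proof -
    have "(\<Sum>j<n. ?B $$ (k, j) * x j)
        = (\<Sum>j<n. A $$ (k, j) * x j + of_bool (k = i) * (of_bool (j = i) * x j))"
      using A that by (intro sum.cong) (auto simp: unit_diag_def algebra_simps)
    then show ?thesis using \<open>i < n\<close>
      by (simp add: sum.distrib sum_distrib_left[symmetric])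
  qed
  have "nonsingular_on {..<n} (\<lambda>i j. ?B $$ (i, j)) \<longleftrightarrow> N i i = 0"
  proof
    assume ns: "nonsingular_on {..<n} (\<lambda>i j. ?B $$ (i, j))"
    show "N i i = 0"
    proof (rule ccontr)
      assume "N i i \<noteq> 0"
      then have "N i i = 1" by simp
      \<comment> \<open>The kernel vector is column \<open>i\<close> of \<open>N\<close>:
        \<open>A\<close> maps it to the unit vector e_i, and so does E_ii.\<close>
      then have "(\<Sum>j<n. ?B $$ (k, j) * N j i) = 0" if "k < n" for k
        using inv(2) that \<open>i < n\<close> by (simp add: Bx inverse_on_def)
      then have "N i i = 0"
        using \<open>i < n\<close> by (intro nonsingular_onD[OF ns, of "\<lambda>j. N j i" i]) auto
      with \<open>N i i \<noteq> 0\<close> show False by blast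
    qed
  next
    assume Nii: "N i i = 0"
    show "nonsingular_on {..<n} (\<lambda>i j. ?B $$ (i, j))"
      unfolding nonsingular_on_def
    proof (intro allI impI)
      fix x assume "\<forall>k\<in>{..<n}. (\<Sum>j\<in>{..<n}. ?B $$ (k, j) * x j) = 0"
      then have Ax: "(\<Sum>j<n. A $$ (k, j) * x j) = of_bool (k = i) * x i" if "k < n" for k
        using that Bx[OF that, of x] by (simp add: bit_add_eq_0_iff)
      have x: "x k = N k i * x i" if "k < n" for k
      proof -
        have "x k = (\<Sum>l<n. N k l * (\<Sum>j<n. A $$ (l, j) * x j))"
          using inverse_on_apply[OF inv(1) that, of x] by simp
        also have "\<dots> = (\<Sum>l<n. N k l * (of_bool (l = i) * x i))"
          using Ax by (intro sum.cong) auto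
        also have "\<dots> = N k i * x i" using \<open>i < n\<close>
          by (simp add: mult.assoc[symmetric] sum_distrib_right[symmetric])
        finally show ?thesis .
      qed
      have "x i = 0" using x[OF \<open>i < n\<close>] Nii by simp
      with x show "\<forall>k\<in>{..<n}. x k = 0" by simp
    qed
  qed
  then show ?thesis using corank_nonsingular_on[OF B] le1 by auto
qed

text \<open>Links the matrices of the definitions to \<open>inverse_pair\<close>. Corank zero makes
  \<open>mat_inverse\<close> return a value; its symmetry, required for a simple graph, follows from
  the uniqueness of the inverse.\<close>

lemma inverse_pair_L_graph:
  assumes G: "is_labeled_graph G" and "corank (adj_matrix G + 1\<^sub>m (nv G)) = 0"
  shows "\<exists>d. inverse_pair G (L_graph G) d"
proof -
  define n where "n = nv G"
  define A where "A = adj_matrix G + 1\<^sub>m n"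
  have A: "A \<in> carrier_mat n n" by (simp add: A_def adj_matrix_def n_def)
  have shifted_adj: "A $$ (i, j) = shifted_adj G i j" if "i < n" "j < n" for i j
    using that by (auto simp: A_def adj_matrix_def shifted_adj_def n_def)
  have "det A \<noteq> 0" using assms(2) corank_nonsingular_on[OF A] det_nonsingular_on[OF A]
    by (simp add: A_def n_def)
  then obtain B where "mat_inverse A = Some B"
    using mat_inverse(1)[OF A] det_non_zero_imp_unit[OF A] by (meson not_None_eq)
  note B = mat_inverse(2)[OF A this] this
  define N where "N i j = B $$ (i, j)" for i j
  have mv: "inverse_on n (\<lambda>i j. X $$ (i, j)) (\<lambda>i j. Y $$ (i, j))"
    if "Y * X = 1\<^sub>m n" "X \<in> carrier_mat n n" "Y \<in> carrier_mat n n" for X Y :: "bit mat"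
    unfolding inverse_on_def
  proof (intro allI impI)
    fix i j assume ij: "i < n" "j < n"
    have "(\<Sum>k<n. Y $$ (i, k) * X $$ (k, j)) = (Y * X) $$ (i, j)"
      using that(2,3) ij by (auto simp: scalar_prod_def lessThan_atLeast0 intro!: sum.cong)
    also have "\<dots> = of_bool (i = j)" using that(1) ij by simp
    finally show "(\<Sum>k<n. Y $$ (i, k) * X $$ (k, j)) = of_bool (i = j)" .
  qed
  have AN: "inverse_on n (\<lambda>i j. A $$ (i, j)) N" and NA: "inverse_on n N (\<lambda>i j. A $$ (i, j))"
    unfolding N_def using mv B A by blast+
  have GN: "inverse_on n (shifted_adj G) N" by (rule inverse_on_cong[OF AN]) (auto simp: shifted_adj)
  have NG: "inverse_on n N (shifted_adj G)" by (rule inverse_on_cong[OF NA]) (auto simp: shifted_adj)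
  have "symmetric_on {..<n} (shifted_adj G)" using symmetric_on_shifted_adj[OF G] by (simp add: n_def)
  then obtain N' where N': "symmetric_on {..<n} N'" "inverse_on n (shifted_adj G) N'"
    using nonsingular_on_imp_inverse_on[OF inverse_on_imp_nonsingular_on[OF GN]] by blast
  have Nsym: "N i j = N j i" if "i < n" "j < n" for i j
  proof -
    have "inverse_on n N' (shifted_adj G)" using inverse_on_swap[OF N'(2) \<open>symmetric_on {..<n}
      (shifted_adj G)\<close> N'(1)] .
    then show ?thesis using inverse_on_unique[OF GN] N'(1) that by (metis lessThan_iff symmetric_on_def)
  qed
  define d where "d i = N i i" for i
  have nvL: "nv (L_graph G) = n" by (simp add: L_graph_def n_def)
  have adjL: "adj (L_graph G) i j \<longleftrightarrow> i \<noteq> j \<and> N i j = 1" for i j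
    by (simp add: L_graph_def B(2)[unfolded A_def n_def] N_def)
  have "diag_adj (L_graph G) d i j = N i j" for i j
    by (auto simp: diag_adj_def with_diag_def d_def adjL of_bool_eq_1_bit)
  then have 1: "inverse_on n (shifted_adj G) (diag_adj (L_graph G) d)" using inverse_on_cong[OF GN] by blast
  have 2: "is_looped_graph (L_graph G)"
    using Nsym by (simp add: is_looped_graph_def simple_graph_def adjL nvL)
  have 3: "loop (L_graph G) i \<longleftrightarrow> vsign G i = (if d i = 1 then 1 else -1)" if "i < n" for i
  proof -
    have "corank (B_matrix G i) = (if N i i = 1 then 1 else 0)"
      using corank_rank_one_update[OF A that AN NA] by (simp add: B_matrix_def A_def n_def)
    moreover have "vsign G i \<in> {1, -1}" using G that by (auto simp: is_labeled_graph_def n_def)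
    ultimately show ?thesis by (auto simp: L_graph_def writhe_def d_def)
  qed
  show ?thesis
    using G 1 2 3 nvL unfolding inverse_pair_def n_def by blast
qed

section \<open>Moves of labeled graphs and their inverse matrices\<close>

lemma bit_neq_iff: "a \<noteq> b \<longleftrightarrow> b = a + 1" for a b :: bit
  by (cases a; cases b) auto

lemma adj_eq_shifted_adj: "i \<noteq> j \<Longrightarrow> adj G i j \<longleftrightarrow> shifted_adj G i j = 1"
  by (simp add: shifted_adj_def)

lemma framing_eq_shifted_adj: "framing G i = shifted_adj G i i + 1"
  by (simp add: shifted_adj_def)

lemma is_labeled_graphI:
  assumes "\<And>i. i < nv G \<Longrightarrow> \<not> adj G i i"
    and "\<And>i j. i < nv G \<Longrightarrow> j < nv G \<Longrightarrow> adj G i j \<Longrightarrow> adj G j i"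
    and "\<And>i. i < nv G \<Longrightarrow> vsign G i \<in> {1, -1}"
  shows "is_labeled_graph G"
  using assms by (simp add: is_labeled_graph_def simple_graph_def)

lemma is_looped_graphI:
  assumes "\<And>i. i < nv L \<Longrightarrow> \<not> adj L i i"
    and "\<And>i j. i < nv L \<Longrightarrow> j < nv L \<Longrightarrow> adj L i j \<Longrightarrow> adj L j i"
  shows "is_looped_graph L"
  using assms by (simp add: is_looped_graph_def simple_graph_def)

lemma is_labeled_graphD:
  assumes "is_labeled_graph G" "i < nv G"
  shows "\<not> adj G i i" "j < nv G \<Longrightarrow> adj G i j \<longleftrightarrow> adj G j i" "vsign G i = 1 \<or> vsign G i = -1"
  using assms by (auto simp: is_labeled_graph_def simple_graph_def)

lemma is_looped_graphD:
  assumes "is_looped_graph L" "i < nv L"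
  shows "\<not> adj L i i" "j < nv L \<Longrightarrow> adj L i j \<longleftrightarrow> adj L j i"
  using assms by (auto simp: is_looped_graph_def simple_graph_def)

lemma inverse_pairD:
  assumes "inverse_pair G L d"
  shows "is_labeled_graph G" "is_looped_graph L" "nv L = nv G"
    "inverse_on (nv G) (shifted_adj G) (diag_adj L d)"
    "inverse_on (nv G) (diag_adj L d) (shifted_adj G)"
    "i < nv G \<Longrightarrow> loop L i \<longleftrightarrow> vsign G i = (if d i = 1 then 1 else -1)"
proof -
  show *: "is_labeled_graph G" "is_looped_graph L" "nv L = nv G"
    "inverse_on (nv G) (shifted_adj G) (diag_adj L d)"
    "i < nv G \<Longrightarrow> loop L i \<longleftrightarrow> vsign G i = (if d i = 1 then 1 else -1)"
    using assms by (auto simp: inverse_pair_def)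
  show "inverse_on (nv G) (diag_adj L d) (shifted_adj G)"
    using inverse_on_swap[OF *(4) symmetric_on_shifted_adj[OF *(1)]] symmetric_on_diag_adj[OF *(2),
      of d] *(3) by simp
qed

text \<open>Looped graphs may differ outside the vertex range, so the uniqueness of the inverse
  matrix yields an isomorphism, by the identity map, instead of an equation.\<close>

lemma inverse_pair_unique:
  assumes "inverse_pair G L d" "inverse_pair G L' d'"
  shows "looped_iso L L'" "i < nv G \<Longrightarrow> d' i = d i"
proof -
  note 1 = inverse_pairD[OF assms(1)] and 2 = inverse_pairD[OF assms(2)]
  have diag_adj: "diag_adj L' d' i j = diag_adj L d i j" if "i < nv G" "j < nv G" for i j
    using inverse_on_unique[OF 1(4) 2(5) that] .
  show d: "d' i = d i" if "i < nv G" for i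
    using diag_adj[OF that that] by (simp add: diag_adj_def with_diag_def)
  have "adj L' i j = adj L i j" if "i < nv G" "j < nv G" for i j
    using diag_adj[OF that] is_looped_graphD(1)[OF 1(2)] is_looped_graphD(1)[OF 2(2)] 1(3) 2(3) that
    by (auto simp: diag_adj_def with_diag_def split: if_splits)
  then have "graph_iso_via id L L'"
    using 1(3) 2(3) by (simp add: graph_iso_via_def)
  moreover have "\<forall>i<nv L. loop L' (id i) \<longleftrightarrow> loop L i"
    using 1(3,6) 2(6) d by simp
  ultimately show "looped_iso L L'" unfolding looped_iso_def by blast
qed

lemma inverse_pair_cong:
  assumes "inverse_pair G L d" "is_labeled_graph G'" "is_looped_graph L'" "nv G' = nv G" "nv L' = nv G"
    and "\<And>i j. i < nv G \<Longrightarrow> j < nv G \<Longrightarrow> shifted_adj G' i j = shifted_adj G i j"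
    and "\<And>i j. i < nv G \<Longrightarrow> j < nv G \<Longrightarrow> diag_adj L' d' i j = diag_adj L d i j"
    and "\<And>i. i < nv G \<Longrightarrow> loop L' i \<longleftrightarrow> vsign G' i = (if d' i = 1 then 1 else -1)"
  shows "inverse_pair G' L' d'"
  using assms(2-5,8) inverse_on_cong[OF inverse_pairD(4)[OF assms(1)] assms(6,7)]
  by (simp add: inverse_pair_def)

section \<open>Renaming vertices\<close>

definition permute_labeled :: "(nat \<Rightarrow> nat) \<Rightarrow> labeled_graph \<Rightarrow> labeled_graph" where
  "permute_labeled f G = \<lparr>nv = nv G, adj = (\<lambda>i j. adj G (f i) (f j)),
     framing = (\<lambda>i. framing G (f i)), vsign = (\<lambda>i. vsign G (f i))\<rparr>"

definition permute_looped :: "(nat \<Rightarrow> nat) \<Rightarrow> looped_graph \<Rightarrow> looped_graph" where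
  "permute_looped f L = \<lparr>nv = nv L, adj = (\<lambda>i j. adj L (f i) (f j)), loop = (\<lambda>i. loop L (f i))\<rparr>"

lemma permute_labeled_sel [simp]:
  "nv (permute_labeled f G) = nv G" "adj (permute_labeled f G) i j = adj G (f i) (f j)"
  "framing (permute_labeled f G) i = framing G (f i)" "vsign (permute_labeled f G) i = vsign G (f i)"
  by (simp_all add: permute_labeled_def)

lemma permute_looped_sel [simp]:
  "nv (permute_looped f L) = nv L" "adj (permute_looped f L) i j = adj L (f i) (f j)"
  "loop (permute_looped f L) i = loop L (f i)"
  by (simp_all add: permute_looped_def)

lemma
  assumes f: "bij_betw f {..<nv G} {..<nv G}"
  shows is_labeled_permute: "is_labeled_graph G \<Longrightarrow> is_labeled_graph (permute_labeled f G)"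
    and labeled_iso_permute: "labeled_iso (permute_labeled f G) G"
proof -
  have f': "f i < nv G" if "i < nv G" for i using bij_betwE[OF f] that by auto
  show "is_labeled_graph G \<Longrightarrow> is_labeled_graph (permute_labeled f G)"
    using f' by (auto simp: is_labeled_graph_def simple_graph_def)
  show "labeled_iso (permute_labeled f G) G"
    unfolding labeled_iso_def graph_iso_via_def using f by (intro exI[of _ f]) auto
qed

lemma
  assumes f: "bij_betw f {..<nv L} {..<nv L}"
  shows is_looped_permute: "is_looped_graph L \<Longrightarrow> is_looped_graph (permute_looped f L)"
    and looped_iso_permute: "looped_iso (permute_looped f L) L"
proof -
  have f': "f i < nv L" if "i < nv L" for i using bij_betwE[OF f] that by auto
  show "is_looped_graph L \<Longrightarrow> is_looped_graph (permute_looped f L)"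
    using f' by (auto simp: is_looped_graph_def simple_graph_def)
  show "looped_iso (permute_looped f L) L"
    unfolding looped_iso_def graph_iso_via_def using f by (intro exI[of _ f]) auto
qed

lemma inverse_on_permute:
  assumes "inverse_on n M N" and f: "bij_betw f {..<n} {..<n}"
  shows "inverse_on n (\<lambda>i j. M (f i) (f j)) (\<lambda>i j. N (f i) (f j))"
  unfolding inverse_on_def
proof (intro allI impI)
  fix i j assume ij: "i < n" "j < n"
  have f': "f i < n" if "i < n" for i using bij_betwE[OF f] that by auto
  have "(\<Sum>k<n. N (f i) (f k) * M (f k) (f j)) = (\<Sum>k<n. N (f i) k * M k (f j))"
    by (rule sum.reindex_bij_betw[OF f])
  also have "\<dots> = of_bool (f i = f j)" using assms(1) f' ij by (simp add: inverse_on_def)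
  also have "f i = f j \<longleftrightarrow> i = j"
    using bij_betw_imp_inj_on[OF f] ij by (auto simp: inj_on_def)
  finally show "(\<Sum>k<n. N (f i) (f k) * M (f k) (f j)) = of_bool (i = j)" .
qed

lemma inverse_pair_permute:
  assumes p: "inverse_pair G L d" and f: "bij_betw f {..<nv G} {..<nv G}"
  shows "inverse_pair (permute_labeled f G) (permute_looped f L) (\<lambda>i. d (f i))"
proof -
  note 1 = inverse_pairD[OF p]
  have f': "f i < nv G" if "i < nv G" for i using bij_betwE[OF f] that by auto
  have inj: "f i = f j \<longleftrightarrow> i = j" if "i < nv G" "j < nv G" for i j
    using bij_betw_imp_inj_on[OF f] that by (auto simp: inj_on_def)
  have "inverse_on (nv G) (shifted_adj (permute_labeled f G)) (diag_adj (permute_looped f L) (\<lambda>i. d (f i)))"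
    by (rule inverse_on_cong[OF inverse_on_permute[OF 1(4) f]]) (auto simp: shifted_adj_def
      diag_adj_def with_diag_def inj)
  then show ?thesis
    using 1 f f' is_labeled_permute[OF f] is_looped_permute[of f L]
    by (simp add: inverse_pair_def)
qed

text \<open>The inverse of the given matrix supplies adjacencies and framings, with
  \<open>M i i + 1\<close> because \<open>E\<close> was added to A(G); the signs are then read off
  from the loops and \<open>d\<close>.\<close>

lemma inverse_pair_of_diag:
  assumes L: "is_looped_graph L" and d: "nonsingular_on {..<nv L} (diag_adj L d)"
  shows "\<exists>G. inverse_pair G L d"
proof -
  define n where "n = nv L"
  obtain M where M: "symmetric_on {..<n} M" "inverse_on n M (diag_adj L d)"
    using nonsingular_on_imp_inverse_on[OF d symmetric_on_diag_adj[OF L]] by (auto simp: n_def)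
  define G :: labeled_graph where
    "G = \<lparr>nv = n, adj = (\<lambda>i j. i \<noteq> j \<and> M i j = 1), framing = (\<lambda>i. M i i + 1),
      vsign = (\<lambda>i. if loop L i \<longleftrightarrow> d i = 1 then 1 else -1)\<rparr>"
  have "shifted_adj G i j = M i j" for i j by (auto simp: shifted_adj_def G_def of_bool_eq_1_bit)
  then have "inverse_on n (shifted_adj G) (diag_adj L d)" using inverse_on_cong[OF M(2)] by blast
  moreover have "is_labeled_graph G"
    using M(1) by (auto simp: is_labeled_graph_def simple_graph_def G_def symmetric_on_def)
  ultimately have "inverse_pair G L d"
    using L by (auto simp: inverse_pair_def n_def G_def)
  then show ?thesis by blast
qed

lemma ex_inverse_pair:
  assumes L: "is_looped_graph L"
  shows "\<exists>G d. inverse_pair G L d"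
proof -
  have "symmetric_on {..<nv L} (\<lambda>i j. of_bool (adj L i j))"
    using is_looped_graphD(2)[OF L] by (simp add: symmetric_on_def)
  then obtain d where "nonsingular_on {..<nv L} (diag_adj L d)"
    unfolding diag_adj_def using ex_nonsingular_on_diag[of "{..<nv L}"] by blast
  then show ?thesis using inverse_pair_of_diag[OF L] by blast
qed

section \<open>Diagonal changes of the inverse and the fourth moves\<close>

lemma inverse_on_update1:
  assumes NM: "inverse_on n M N" and v: "v < n" "M v v = 0"
  shows "inverse_on n (\<lambda>i j. M i j + M i v * M v j) (\<lambda>i j. N i j + of_bool (i = v \<and> j = v))"
  unfolding inverse_on_def
proof (intro allI impI)
  fix i j assume ij: "i < n" "j < n"
  have "(\<Sum>k<n. (N i k + of_bool (i = v \<and> k = v)) * (M k j + M k v * M v j))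
      = (\<Sum>k<n. N i k * M k j) + (\<Sum>k<n. N i k * M k v) * M v j
        + of_bool (i = v) * (\<Sum>k<n. of_bool (k = v) * (M k j + M k v * M v j))"
    by (simp add: of_bool_conj algebra_simps sum.distrib sum_distrib_left)
  also have "\<dots> = of_bool (i = j) + of_bool (i = v) * M v j + of_bool (i = v) * (M v j + M v v * M v j)"
    using NM ij v by (simp add: inverse_on_def)
  also have "\<dots> = of_bool (i = j)" using v by simp
  finally show "(\<Sum>k<n. (N i k + of_bool (i = v \<and> k = v)) * (M k j + M k v * M v j)) = of_bool (i = j)" .
qed

text \<open>Woodbury formula: adding to \<open>N\<close> the identity on P = {u, v} changes
  \<open>M\<close> by the columns and rows of P, coupled by the inverse of E + M_PP. With all
  entries of M_PP equal to 1 this is the exchange matrix, whence the crossed terms. In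
  \<open>inverse_on_update1\<close>, P is one index and the factor is 1 / (1 + M v v) = 1.\<close>

lemma inverse_on_update2:
  assumes NM: "inverse_on n M N" and uv: "u < n" "v < n" "u \<noteq> v"
    and M: "M u u = 1" "M v v = 1" "M u v = 1" "M v u = 1"
  shows "inverse_on n (\<lambda>i j. M i j + M i u * M v j + M i v * M u j)
    (\<lambda>i j. N i j + of_bool (i = j \<and> (i = u \<or> i = v)))"
  unfolding inverse_on_def
proof (intro allI impI)
  fix i j assume ij: "i < n" "j < n"
  let ?M = "\<lambda>k j. M k j + M k u * M v j + M k v * M u j"
  define c :: bit where "c = of_bool (i = u \<or> i = v)"
  have *: "(\<Sum>k<n. of_bool (i = k \<and> (i = u \<or> i = v)) * ?M k j) = c * ?M i j"
    using ij by (cases "i = u \<or> i = v") (auto simp: c_def)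
  have "(\<Sum>k<n. (N i k + of_bool (i = k \<and> (i = u \<or> i = v))) * ?M k j)
      = (\<Sum>k<n. N i k * ?M k j) + (\<Sum>k<n. of_bool (i = k \<and> (i = u \<or> i = v)) * ?M k j)"
    by (simp only: distrib_right sum.distrib)
  also have "(\<Sum>k<n. N i k * ?M k j)
      = (\<Sum>k<n. N i k * M k j) + (\<Sum>k<n. N i k * M k u) * M v j + (\<Sum>k<n. N i k * M k v) * M u j"
    by (simp add: algebra_simps sum.distrib sum_distrib_left)
  also have "\<dots> = of_bool (i = j) + of_bool (i = u) * M v j + of_bool (i = v) * M u j"
    using NM ij uv by (simp add: inverse_on_def)
  also have "\<dots> + (\<Sum>k<n. of_bool (i = k \<and> (i = u \<or> i = v)) * ?M k j) = of_bool (i = j)"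
    unfolding * using M uv by (auto simp: c_def)
  finally show "(\<Sum>k<n. (N i k + of_bool (i = k \<and> (i = u \<or> i = v))) * ?M k j) = of_bool (i = j)" .
qed

lemma toggle_sel [simp]:
  "nv (toggle P G) = nv G" "adj (toggle P G) x y \<longleftrightarrow> adj G x y \<noteq> ({x, y} \<in> P)"
  by (simp_all add: toggle_def)

lemma toggle_labeled_sel [simp]:
  "framing (toggle P G) = framing G" "vsign (toggle P G) = vsign G"
  by (simp_all add: toggle_def)

lemma toggle_looped_sel [simp]: "loop (toggle P L) = loop L"
  by (simp add: toggle_def)

text \<open>Adding the product of column and row \<open>v\<close> to A(G) + E toggles the pairs of
  neighbours off the diagonal and their framings on it, which is exactly this move. Both
  \<open>d v\<close> and the sign of \<open>v\<close> flip, so the loop at \<open>v\<close>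
  stays.\<close>

lemma Omega_g4'_pair:
  assumes p: "inverse_pair G L d" and v: "v < nv G" "framing G v = 1"
    and G': "G' = LC v G \<lparr>vsign := (vsign G)(v := - vsign G v),
                  framing := (\<lambda>x. if x \<in> nbhd G v then framing G x + 1 else framing G x)\<rparr>"
  shows "inverse_pair G' L (d(v := d v + 1))"
proof -
  note 1 = inverse_pairD[OF p]
  note G = is_labeled_graphD[OF 1(1)]
  have adj: "adj G' i j \<longleftrightarrow> adj G i j \<noteq> (i \<in> nbhd G v \<and> j \<in> nbhd G v \<and> i \<noteq> j)" for i j
    unfolding G' by (auto simp: LC_def doubleton_eq_iff)
  have sel: "nv G' = nv G" "vsign G' = (vsign G)(v := - vsign G v)"
    "framing G' x = (if x \<in> nbhd G v then framing G x + 1 else framing G x)" for x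
    by (simp_all add: G' LC_def)
  have G'l: "is_labeled_graph G'"
    by (rule is_labeled_graphI) (use G v(1) in \<open>auto simp: adj sel\<close>)
  have gmv: "shifted_adj G i v = of_bool (i \<in> nbhd G v)"
    "shifted_adj G v i = of_bool (i \<in> nbhd G v)" if "i < nv G" for i
    using G v that by (auto simp: shifted_adj_def nbhd_def)
  have shifted_adj': "shifted_adj G' i j = shifted_adj G i j + shifted_adj G i v * shifted_adj G v
    j" if "i < nv G" "j < nv G" for i j
    using that by (simp add: gmv) (auto simp: shifted_adj_def adj sel)
  have gm0: "shifted_adj G v v = 0" using v by (simp add: shifted_adj_def)
  have diag_adj': "diag_adj L (d(v := d v + 1)) i j = diag_adj L d i j + of_bool (i = v \<and> j = v)" for i j
    by (auto simp: diag_adj_def with_diag_def)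
  have inverse_on: "inverse_on (nv G) (shifted_adj G') (diag_adj L (d(v := d v + 1)))"
    by (rule inverse_on_cong[OF inverse_on_update1[where v = v and N = "diag_adj L d" and M =
      "shifted_adj G" and n = "nv G"]])
      (use 1 v shifted_adj' diag_adj' gm0 in auto)
  show ?thesis unfolding inverse_pair_def
  proof (intro conjI allI impI)
    fix i assume i: "i < nv G'"
    then show "loop L i \<longleftrightarrow> vsign G' i = (if (d(v := d v + 1)) i = 1 then 1 else -1)"
      using 1(6)[of i] G(3)[of i] by (cases "d v") (auto simp: sel)
  qed (use 1 G'l inverse_on sel in auto)
qed

lemma bij_betw_transpose: "u < n \<Longrightarrow> v < n \<Longrightarrow> bij_betw (Transposition.transpose u v) {..<n} {..<n}" for n :: nat
  by (rule bij_betwI[where g = "Transposition.transpose u v"]) (auto simp: Transposition.transpose_def)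

text \<open>The rank-two update exchanges rows \<open>u\<close> and \<open>v\<close>, whereas
  \<open>piv\<close> leaves them in place; hence the transposition. It also explains the crossed
  signs of the move: after the exchange each of \<open>u\<close> and \<open>v\<close> has its own
  sign negated, matching the change of \<open>d\<close>.\<close>

lemma Omega_g4_pair:
  assumes p: "inverse_pair G L d" and uv: "u < nv G" "v < nv G" "u \<noteq> v" "adj G u v"
    "framing G u = 0" "framing G v = 0"
    and G': "G' = piv u v G \<lparr>vsign := (vsign G)(u := - vsign G v, v := - vsign G u)\<rparr>"
  shows "is_labeled_graph G'" 
    "inverse_pair (permute_labeled (Transposition.transpose u v) G') L (d(u := d u + 1, v := d v + 1))"
proof -
  note 1 = inverse_pairD[OF p]
  note G = is_labeled_graphD[OF 1(1)]
  let ?Nu = "nbhd G u" and ?Nv = "nbhd G v"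
  have adj: "adj G' i j \<longleftrightarrow> adj G i j \<noteq> (i \<noteq> u \<and> i \<noteq> v \<and> j \<noteq> u \<and> j \<noteq> v \<and>
      (i \<in> ?Nu \<and> j \<in> ?Nv) \<noteq> (i \<in> ?Nv \<and> j \<in> ?Nu))" for i j
    unfolding G' by (auto simp: piv_def doubleton_eq_iff)
  have sel: "nv G' = nv G" "vsign G' = (vsign G)(u := - vsign G v, v := - vsign G u)"
    "framing G' = framing G"
    by (simp_all add: G' piv_def)
  show G'l: "is_labeled_graph G'"
    by (rule is_labeled_graphI) (use G uv in \<open>auto simp: adj sel\<close>)
  let ?t = "Transposition.transpose u v"
  let ?G = "permute_labeled ?t G'"
  let ?d = "d(u := d u + 1, v := d v + 1)"
  have t: "bij_betw ?t {..<nv G'} {..<nv G'}"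
    using uv by (simp add: sel bij_betw_transpose)
  have gmu: "shifted_adj G i u = of_bool (i = u \<or> i \<in> ?Nu)"
    "shifted_adj G u i = of_bool (i = u \<or> i \<in> ?Nu)" if "i < nv G" for i
    using G uv that by (auto simp: shifted_adj_def nbhd_def)
  have gmv: "shifted_adj G i v = of_bool (i = v \<or> i \<in> ?Nv)"
    "shifted_adj G v i = of_bool (i = v \<or> i \<in> ?Nv)" if "i < nv G" for i
    using G uv that by (auto simp: shifted_adj_def nbhd_def)
  have N: "u \<in> ?Nv" "v \<in> ?Nu" "u \<notin> ?Nu" "v \<notin> ?Nv" using G uv by (auto simp: nbhd_def)
  have gmuv: "shifted_adj G u u = 1" "shifted_adj G v v = 1" "shifted_adj G u v = 1" "shifted_adj G v u = 1"
    using uv N by (simp_all add: gmu gmv)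
  have shifted_adj': "shifted_adj ?G i j = shifted_adj G i j + shifted_adj G i u * shifted_adj G v j
    + shifted_adj G i v * shifted_adj G u j"
    if ij: "i < nv G" "j < nv G" for i j
  proof -
    consider "i = u" | "i = v" | "i \<noteq> u" "i \<noteq> v" by blast
    then show ?thesis
    proof cases
      case 1
      have "shifted_adj ?G u j = shifted_adj G v j"
      proof -
        consider "j = u" | "j = v" | "j \<noteq> u" "j \<noteq> v" by blast
        then show ?thesis using uv G N by cases (auto simp: shifted_adj_def adj sel
          Transposition.transpose_def)
      qed
      then show ?thesis using gmuv 1 by simp
    next
      case 2
      have "shifted_adj ?G v j = shifted_adj G u j"
      proof -
        consider "j = u" | "j = v" | "j \<noteq> u" "j \<noteq> v" by blast
        then show ?thesis using uv G N by cases (auto simp: shifted_adj_def adj sel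
          Transposition.transpose_def)
      qed
      then show ?thesis using gmuv 2 by simp
    next
      case 3
      consider "j = u" | "j = v" | "j \<noteq> u" "j \<noteq> v" by blast
      then show ?thesis
      proof cases
        case 1
        have "shifted_adj ?G i u = shifted_adj G i v"
          using 1 3 uv G N ij by (auto simp: shifted_adj_def adj sel Transposition.transpose_def)
        then show ?thesis using gmuv 1 by (simp add: add.commute)
      next
        case 2
        have "shifted_adj ?G i v = shifted_adj G i u"
          using 2 3 uv G N ij by (auto simp: shifted_adj_def adj sel Transposition.transpose_def)
        then show ?thesis using gmuv 2 by (simp add: add.commute)
      next
        case j: 3
        have "shifted_adj ?G i j = shifted_adj G i j + of_bool (i \<in> ?Nu) * of_bool (j \<in> ?Nv) +
          of_bool (i \<in> ?Nv) * of_bool (j \<in> ?Nu)"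
          using 3 j uv by (auto simp: shifted_adj_def adj sel Transposition.transpose_def)
        then show ?thesis using 3 j ij by (simp add: gmu gmv)
      qed
    qed
  qed
  have diag_adj': "diag_adj L ?d i j = diag_adj L d i j + of_bool (i = j \<and> (i = u \<or> i = v))" for i j
    by (auto simp: diag_adj_def with_diag_def)
  have inverse_on: "inverse_on (nv G) (shifted_adj ?G) (diag_adj L ?d)"
    by (rule inverse_on_cong[OF inverse_on_update2[where u = u and v = v and N =
      "diag_adj L d" and M = "shifted_adj G" and n = "nv G"]])
      (use 1 uv shifted_adj' diag_adj' gmuv in auto)
  show "inverse_pair ?G L ?d" unfolding inverse_pair_def
  proof (intro conjI allI impI)
    fix i assume i: "i < nv ?G"
    then show "loop L i \<longleftrightarrow> vsign ?G i = (if ?d i = 1 then 1 else -1)"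
      using 1(6)[of i] G(3)[of i] uv
      by (cases "d v"; cases "d u") (auto simp: sel Transposition.transpose_def)
  qed (use 1 G'l inverse_on sel is_labeled_permute[OF t] in auto)
qed

lemma equivclp_move:
  "R x y \<Longrightarrow> equivclp R y z \<Longrightarrow> equivclp R x z"
  using equivclp_trans[OF r_into_equivclp] .

lemma graph_move_iso: "is_labeled_graph G \<Longrightarrow> is_labeled_graph G' \<Longrightarrow> labeled_iso G G' \<Longrightarrow> graph_move G G'"
  by (simp add: graph_move_def)

text \<open>Changing \<open>d\<close> at \<open>v\<close> is \<open>\<Omega>\<^sub>g4'\<close> at \<open>v\<close>; changing \<open>d\<close> at adjacent \<open>u\<close> and \<open>v\<close> is \<open>\<Omega>\<^sub>g4\<close> up to
  renaming. If \<open>S\<close> is the set of indices where \<open>d\<close> and \<open>d'\<close> differ, nonsingularity of both matrices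
  forces a nonzero entry of \<open>A(G)\<close> in every row of the block \<open>S\<close>, hence one of these moves reduces \<open>S\<close>.\<close>

lemma inverse_pair_diag_equiv:
  assumes "inverse_pair G L d" "inverse_pair G' L d'"
  shows "equivclp graph_move G G'"
  using assms
proof (induction "card {i. i < nv G \<and> d i \<noteq> d' i}" arbitrary: G d rule: less_induct)
  case less
  note 1 = inverse_pairD[OF less.prems(1)] and 2 = inverse_pairD[OF less.prems(2)]
  note G = is_labeled_graphD[OF 1(1)] and G' = is_labeled_graphD[OF 2(1)]
  have nv: "nv G' = nv G" using 1(3) 2(3) by simp
  define S where "S = {i. i < nv G \<and> d i \<noteq> d' i}"
  have finS: "finite S" by (simp add: S_def)
  show ?case
  proof (cases "S = {}")
    case True
    have diag_adj: "diag_adj L d' i j = diag_adj L d i j" if "i < nv G" "j < nv G" for i j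
      using True that by (auto simp: diag_adj_def with_diag_def S_def)
    have "inverse_on (nv G) (shifted_adj G') (diag_adj L d)"
      by (rule inverse_on_cong[OF 2(4)[unfolded nv]]) (auto simp: diag_adj)
    then have shifted_adj: "shifted_adj G' i j = shifted_adj G i j" if "i < nv G" "j < nv G" for i j
      using inverse_on_unique[OF 1(5) _ that] by blast
    have "graph_iso_via id G G'"
      using nv shifted_adj G(1) G'(1) unfolding graph_iso_via_def
      by (auto simp: adj_eq_shifted_adj) (metis adj_eq_shifted_adj shifted_adj)+
    moreover have "\<forall>i<nv G. framing G' (id i) = framing G i \<and> vsign G' (id i) = vsign G i"
    proof (intro allI impI conjI)
      fix i assume i: "i < nv G"
      show "framing G' (id i) = framing G i" using shifted_adj[OF i i] by (simp add: framing_eq_shifted_adj)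
      have "d' i = d i" using True i by (auto simp: S_def)
      then show "vsign G' (id i) = vsign G i"
        using 1(6)[OF i] 2(6)[of i] i nv G(3)[OF i] G'(3)[of i] by (auto split: if_splits)
    qed
    ultimately have "labeled_iso G G'" unfolding labeled_iso_def by blast
    then show ?thesis using graph_move_iso[OF 1(1) 2(1)] by blast
  next
    case False
    then obtain i where i: "i \<in> S" by blast
    then have i_n: "i < nv G" by (simp add: S_def)
    have "\<exists>j\<in>S. shifted_adj G i j \<noteq> of_bool (i = j)"
    proof (rule ccontr)
      assume "\<not> ?thesis"
      then have Srow: "shifted_adj G j i = of_bool (i = j)" if "j \<in> S" for j
        using that i symmetric_on_shifted_adj[OF 1(1)] by (auto simp: symmetric_on_def S_def)
      \<comment> \<open>Column \<open>i\<close> of A(G) + E would be in the kernel of the matrix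
        with diagonal \<open>d'\<close>: the matrix with diagonal \<open>d\<close> maps it to e_i,
        and the change on \<open>S\<close> contributes e_i once more. But its entry at
        \<open>i\<close> would be 1.\<close>
      have "(\<Sum>j<nv G. diag_adj L d' k j * shifted_adj G j i) = 0" if k: "k < nv G" for k
      proof -
        have "(\<Sum>j<nv G. diag_adj L d' k j * shifted_adj G j i)
            = (\<Sum>j<nv G. diag_adj L d k j * shifted_adj G j i + of_bool (k
              = j) * (of_bool (j \<in> S) * shifted_adj G j i))"
        proof (rule sum.cong)
          fix j assume "j \<in> {..<nv G}"
          moreover have "d j \<noteq> d' j \<Longrightarrow> d' j = d j + 1" by (simp add: bit_neq_iff)
          ultimately have "diag_adj L d' k j = diag_adj L d k j + of_bool (k = j) * of_bool (j \<in> S)"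
            by (auto simp: diag_adj_def with_diag_def S_def)
          then show "diag_adj L d' k j * shifted_adj G j i
            = diag_adj L d k j * shifted_adj G j i + of_bool (k
            = j) * (of_bool (j \<in> S) * shifted_adj G j i)"
            by (simp only: distrib_right mult.assoc)
        qed simp
        also have "\<dots> = of_bool (k = i) + of_bool (k \<in> S) * shifted_adj G k i"
          using 1(4) k i_n by (simp only: sum.distrib sum_delta_mult) (simp add: inverse_on_def)
        also have "\<dots> = 0" using Srow[of k] i by (cases "k \<in> S") auto
        finally show ?thesis .
      qed
      then have "shifted_adj G i i = 0"
        using nonsingular_onD[OF inverse_on_imp_nonsingular_on[OF 2(5)], of
          "\<lambda>j. shifted_adj G j i" i] i_n nv by auto
      with Srow[OF i] show False by simp
    qed
    then obtain j where j: "j \<in> S" and gij: "shifted_adj G i j \<noteq> of_bool (i = j)" by blast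
    then have j_n: "j < nv G" by (simp add: S_def)
    have smaller: "card {i. i < nv G \<and> e i \<noteq> d' i} < card S"
      if "\<And>i. i \<notin> S \<Longrightarrow> i < nv G \<Longrightarrow> e i = d i" "k \<in> S" "e k = d' k" for e k
    proof (rule psubset_card_mono[OF finS])
      show "{i. i < nv G \<and> e i \<noteq> d' i} \<subset> S"
        using that by (auto simp: S_def)
    qed
    have flip1: ?thesis if v: "v \<in> S" "framing G v = 1" for v
    proof -
      have vn: "v < nv G" using v by (simp add: S_def)
      define G1 where "G1 = LC v G \<lparr>vsign := (vsign G)(v := - vsign G v),
                  framing := (\<lambda>x. if x \<in> nbhd G v then framing G x + 1 else framing G x)\<rparr>"
      have p: "inverse_pair G1 L (d(v := d v + 1))" by (rule Omega_g4'_pair[OF less.prems(1) vn v(2) G1_def])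
      have "Omega_g4' G G1" unfolding Omega_g4'_def using vn v G1_def by blast
      then have "graph_move G G1" using 1(1) inverse_pairD(1)[OF p] by (simp add: graph_move_def)
      moreover have "nv G1 = nv G" using inverse_pairD(3)[OF p] 1(3) by simp
      moreover have "d' v = d v + 1" using v by (simp add: S_def bit_neq_iff)
      then have "card {i. i < nv G \<and> (d(v := d v + 1)) i \<noteq> d' i} < card S"
        using v by (intro smaller[of _ v]) auto
      ultimately show ?thesis
        using less.hyps[of G1 "d(v := d v + 1)", OF _ p less.prems(2)] equivclp_move by (metis S_def)
    qed
    show ?thesis
    proof (cases "framing G i = 1 \<or> framing G j = 1")
      case True
      then show ?thesis using flip1 i j by blast
    next
      case False
      then have fr: "framing G i = 0" "framing G j = 0" by auto
      \<comment> \<open>With both framings 0 the exceptional entry cannot be diagonal, so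
        \<open>i\<close> and \<open>j\<close> are adjacent and are flipped together.\<close>
      with gij have ij: "i \<noteq> j" "adj G i j" by (auto simp: shifted_adj_def split: if_splits)
      define G1 where "G1 = piv i j G \<lparr>vsign := (vsign G)(i := - vsign G j, j := - vsign G i)\<rparr>"
      define G2 where "G2 = permute_labeled (Transposition.transpose i j) G1"
      define e where "e = d(i := d i + 1, j := d j + 1)"
      have p: "is_labeled_graph G1" "inverse_pair G2 L e"
        unfolding G2_def e_def
        using Omega_g4_pair[OF less.prems(1) i_n j_n ij fr G1_def] by blast+
      have nvs: "nv G1 = nv G" "nv G2 = nv G"
        by (simp_all add: G2_def G1_def piv_def)
      have "Omega_g4 G G1" unfolding Omega_g4_def using i_n j_n ij fr G1_def by blast
      then have m1: "graph_move G G1" using 1(1) p(1) by (simp add: graph_move_def)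
      have "bij_betw (Transposition.transpose i j) {..<nv G1} {..<nv G1}"
        using i_n j_n nvs by (simp add: bij_betw_transpose)
      then have "labeled_iso G2 G1" unfolding G2_def by (rule labeled_iso_permute)
      then have m2: "graph_move G2 G1" using graph_move_iso inverse_pairD(1)[OF p(2)] p(1) by blast
      have "d' i = d i + 1" "d' j = d j + 1" using i j by (simp_all add: S_def bit_neq_iff)
      then have "card {k. k < nv G \<and> e k \<noteq> d' k} < card S"
        using i j by (intro smaller[of _ i]) (auto simp: e_def)
      then have "equivclp graph_move G2 G'"
        using less.hyps[of G2 e, OF _ p(2) less.prems(2)] nvs by (simp add: S_def)
      moreover have "equivclp graph_move G G2"
        using m1 m2 by (meson equivclp_move equivclp_sym r_into_equivclp)
      ultimately show ?thesis using equivclp_trans by metis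
    qed
  qed
qed

section \<open>Bordered matrices and the first two moves\<close>

lemma inverse_on_block1:
  assumes "inverse_on n M N"
    and "\<And>i j. i < n \<Longrightarrow> j < n \<Longrightarrow> M' i j = M i j \<and> N' i j = N i j"
    and "\<And>i. i < n \<Longrightarrow> M' i n = 0 \<and> M' n i = 0 \<and> N' i n = 0 \<and> N' n i = 0" "M' n n = 1" "N' n n = 1"
  shows "inverse_on (Suc n) M' N'"
  using assms by (auto simp: inverse_on_def less_Suc_eq cong: sum.cong_simp)

lemma Omega1_pair_step:
  assumes p: "inverse_pair G L d" and "is_labeled_graph G'" "is_looped_graph L'"
    and g1: "Omega_g1 G G'" and o1: "Omega1 L L'"
    and loop: "loop L' (nv G) \<longleftrightarrow> vsign G' (nv G) = 1"
  shows "inverse_pair G' L' (d(nv G := 1))"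
proof -
  note 1 = inverse_pairD[OF p]
  note G' = is_labeled_graphD[OF assms(2)] and L' = is_looped_graphD[OF assms(3)]
  have nv: "nv G' = Suc (nv G)" "nv L' = Suc (nv G)"
    using g1 o1 1(3) by (simp_all add: Omega_g1_def Omega1_def)
  have a: "\<not> adj G' (nv G) i" "\<not> adj G' i (nv G)" "\<not> adj L' (nv G) i" "\<not> adj L' i (nv G)" if "i < nv G" for i
    using g1 o1 that 1(3) G'(2)[of i "nv G"] L'(2)[of i "nv G"]
    by (auto simp: Omega_g1_def Omega1_def nbhd_def)
  have "inverse_on (Suc (nv G)) (shifted_adj G') (diag_adj L' (d(nv G := 1)))"
    by (rule inverse_on_block1[OF 1(4)])
      (use g1 o1 1(3) a in \<open>auto simp: Omega_g1_def Omega1_def labeled_extends_def looped_extends_def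
        shifted_adj_def diag_adj_def with_diag_def\<close>)
  then show ?thesis using assms 1 nv
    by (auto simp: inverse_pair_def less_Suc_eq Omega_g1_def Omega1_def labeled_extends_def
      looped_extends_def)
qed

lemma Omega_g1_pair:
  assumes p: "inverse_pair G L d" and "is_labeled_graph G'" and g1: "Omega_g1 G G'"
  shows "\<exists>L' d'. Omega1 L L' \<and> inverse_pair G' L' d'"
proof -
  note 1 = inverse_pairD[OF p]
  define L' where "L' = \<lparr>nv = nv L + 1, adj = (\<lambda>i j. i < nv L \<and> j < nv L \<and> adj L i j),
    loop = (\<lambda>i. if i < nv L then loop L i else vsign G' (nv L) = 1)\<rparr>"
  have "is_looped_graph L'"
    by (rule is_looped_graphI) (use is_looped_graphD[OF 1(2)] in \<open>auto simp: L'_def\<close>)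
  moreover have "Omega1 L L'" by (simp add: Omega1_def looped_extends_def L'_def nbhd_def)
  moreover have "loop L' (nv G) \<longleftrightarrow> vsign G' (nv G) = 1" using 1(3) by (simp add: L'_def)
  ultimately show ?thesis using Omega1_pair_step[OF p assms(2) _ g1] by blast
qed

lemma Omega1_pair:
  assumes p: "inverse_pair G L d" and "is_looped_graph L'" and o1: "Omega1 L L'"
  shows "\<exists>G' d'. Omega_g1 G G' \<and> inverse_pair G' L' d'"
proof -
  note 1 = inverse_pairD[OF p]
  define G' :: labeled_graph where "G' = \<lparr>nv = nv G + 1, adj = (\<lambda>i j. i < nv G \<and> j < nv G \<and> adj G i j),
    framing = (\<lambda>i. if i < nv G then framing G i else 0),
    vsign = (\<lambda>i. if i < nv G then vsign G i else if loop L' (nv G) then 1 else -1)\<rparr>"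
  have "is_labeled_graph G'"
    by (rule is_labeled_graphI) (use is_labeled_graphD[OF 1(1)] in \<open>auto simp: G'_def\<close>)
  moreover have "Omega_g1 G G'" by (simp add: Omega_g1_def labeled_extends_def G'_def nbhd_def)
  moreover have "loop L' (nv G) \<longleftrightarrow> vsign G' (nv G) = 1" by (simp add: G'_def)
  ultimately show ?thesis using Omega1_pair_step[OF p _ assms(2) _ o1] by blast
qed

text \<open>The two twins contribute \<open>y i * x j\<close> twice to the old block, so
  \<open>N\<close> survives there. As c + (c + 1) = 1, the border of the inverse is
  \<open>y = N x\<close>, and the corner forces \<open>e\<close> to be \<open>c\<close> plus the
  product of \<open>y\<close> and \<open>x\<close>. The two kinds of \<open>Omega_g2\<close> are the
  cases c = 1 and c = 0; likewise \<open>e\<close> decides whether the twins in \<open>L\<close> are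
  adjacent.\<close>

lemma inverse_on_block2:
  assumes inv: "inverse_on n M N"
    and y: "\<And>i. i < n \<Longrightarrow> y i = (\<Sum>k<n. N i k * x k)" "\<And>j. j < n \<Longrightarrow> (\<Sum>k<n. y k * M k j) = x j"
    and MN: "\<And>i j. i < n \<Longrightarrow> j < n \<Longrightarrow> M' i j = M i j \<and> N' i j = N i j"
    and xM: "\<And>i. i < n \<Longrightarrow> M' i n = x i \<and> M' i (Suc n) = x i \<and> M' n i = x i \<and> M' (Suc n) i = x i"
    and yN: "\<And>i. i < n \<Longrightarrow> N' i n = y i \<and> N' i (Suc n) = y i \<and> N' n i = y i \<and> N' (Suc n) i = y i"
    and c: "M' n n = c" "M' (Suc n) (Suc n) = c" "M' n (Suc n) = c + 1" "M' (Suc n) n = c + 1"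
    and e: "N' n n = e" "N' (Suc n) (Suc n) = e" "N' n (Suc n) = e + 1" "N' (Suc n) n = e + 1"
    and ec: "e = c + (\<Sum>k<n. y k * x k)"
  shows "inverse_on (Suc (Suc n)) M' N'"
  unfolding inverse_on_def
proof (intro allI impI)
  fix i j assume "i < Suc (Suc n)" "j < Suc (Suc n)"
  then consider "i < n" "j < n" | "i < n" "j = n \<or> j = Suc n" | "i = n \<or> i = Suc n" "j < n"
    | "i = n \<or> i = Suc n" "j = n \<or> j = Suc n" by linarith
  then show "(\<Sum>k<Suc (Suc n). N' i k * M' k j) = of_bool (i = j)"
  proof cases
    case 1
    have "(\<Sum>k<n. N' i k * M' k j) = of_bool (i = j)" using inv 1 MN by (simp add: inverse_on_def)
    then show ?thesis using 1 xM yN by (simp add: add.assoc)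
  next
    case 2
    have "(\<Sum>k<n. N' i k * M' k j) = y i" unfolding y(1)[OF 2(1)]
      using 2 MN xM by (intro sum.cong) auto
    moreover have "y i + y i * c + y i * (c + 1) = 0" by (cases "y i"; cases c) auto
    ultimately show ?thesis using 2 xM yN c by (auto simp: algebra_simps)
  next
    case 3
    have "(\<Sum>k<n. N' i k * M' k j) = x j" unfolding y(2)[OF 3(2), symmetric]
      using 3 MN yN by (intro sum.cong) auto
    moreover have "x j + e * x j + (e + 1) * x j = 0" by (cases "x j"; cases e) auto
    ultimately show ?thesis using 3 xM yN e by (auto simp: algebra_simps)
  next
    case 4
    have "(\<Sum>k<n. N' i k * M' k j) = (\<Sum>k<n. y k * x k)"
      using 4 xM yN by (intro sum.cong) auto
    also have "\<dots> = c + e" using ec by simp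
    finally have *: "(\<Sum>k<n. N' i k * M' k j) = c + e" .
    have "c + e + e * c + (e + 1) * (c + 1) = 1" "c + e + e * (c + 1) + (e + 1) * c = 0"
      by (cases c; cases e; simp)+
    then show ?thesis using 4 * c e by (auto simp: algebra_simps)
  qed
qed

text \<open>Stated for \<open>G'\<close> and \<open>L'\<close> together, so that the next two lemmas
  can prescribe either graph and solve for the other: \<open>y = N x\<close> one way,
  \<open>x = (A(G) + E) y\<close> the other way.\<close>

lemma Omega2_pair_step:
  assumes p: "inverse_pair G L d" and "is_labeled_graph G'" "is_looped_graph L'"
    and g2: "Omega_g2 G G'" and o2: "Omega2 L L'"
    and n: "n = nv G"
    and x: "\<And>k. k < n \<Longrightarrow> x k = of_bool (adj G' n k)"
    and y: "\<And>k. k < n \<Longrightarrow> y k = of_bool (adj L' n k)"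
    and xy: "\<And>i. i < n \<Longrightarrow> y i = (\<Sum>k<n. diag_adj L d i k * x k)"
    and e: "adj L' n (Suc n) \<longleftrightarrow> e = 0" "e = framing G' n + 1 + (\<Sum>k<n. y k * x k)"
    and loop: "loop L' n \<longleftrightarrow> vsign G' n = (if e = 1 then 1 else -1)"
  shows "inverse_pair G' L' (d(n := e, Suc n := e))"
proof -
  note 1 = inverse_pairD[OF p]
  note G' = is_labeled_graphD[OF assms(2)] and L' = is_looped_graphD[OF assms(3)]
  have nv: "nv G' = Suc (Suc n)" "nv L' = Suc (Suc n)" "nv L = n"
    using g2 o2 1(3) by (simp_all add: Omega_g2_def Omega2_def n)
  have ext: "adj G' i j \<longleftrightarrow> adj G i j" "adj L' i j \<longleftrightarrow> adj L i j" "framing G' i = framing G i"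
    "vsign G' i = vsign G i" "loop L' i \<longleftrightarrow> loop L i" if "i < n" "j < n" for i j
    using g2 o2 1(3) that by (auto simp: Omega_g2_def Omega2_def labeled_extends_def looped_extends_def n)
  have sym: "adj G' i n \<longleftrightarrow> adj G' n i" "adj G' i (Suc n) \<longleftrightarrow> adj G' n i" "adj G' (Suc n) i \<longleftrightarrow> adj G' n i"
    "adj L' i n \<longleftrightarrow> adj L' n i" "adj L' i (Suc n) \<longleftrightarrow> adj L' n i" "adj L' (Suc n) i \<longleftrightarrow> adj L' n i"
    if "i < n" for i
    using g2 o2 that nv G'(2) L'(2) 1(3)
    by (auto simp: Omega_g2_def Omega2_def Let_def n)
  have n2: "adj G' (Suc n) n \<longleftrightarrow> adj G' n (Suc n)" "adj L' (Suc n) n \<longleftrightarrow> adj L' n (Suc n)"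
    "vsign G' (Suc n) = - vsign G' n" "loop L' (Suc n) \<longleftrightarrow> \<not> loop L' n"
    "adj G' n (Suc n) \<longleftrightarrow> framing G' n = 1" "framing G' (Suc n) = framing G' n"
    using g2 o2 nv G'(2) L'(2) 1(3)
    by (auto simp: Omega_g2_def Omega2_def Let_def n)
  let ?d = "d(n := e, Suc n := e)"
  have yM: "(\<Sum>k<n. y k * shifted_adj G k j) = x j" if j: "j < n" for j
  proof -
    have "(\<Sum>k<n. y k * shifted_adj G k j) = (\<Sum>k<n. shifted_adj G j k * (\<Sum>l<n. diag_adj L d k l * x l))"
      using xy symmetric_on_shifted_adj[OF 1(1)] j
        by (intro sum.cong) (auto simp: symmetric_on_def n mult.commute)
    also have "\<dots> = x j" using inverse_on_apply[OF 1(5)] j n by simp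
    finally show ?thesis .
  qed
  have "inverse_on (Suc (Suc n)) (shifted_adj G') (diag_adj L' ?d)"
  proof (rule inverse_on_block2[where M = "shifted_adj G" and N =
    "diag_adj L d" and x = x and y = y and e = e and c = "framing G' n + 1"])
    show "inverse_on n (shifted_adj G) (diag_adj L d)" using 1 n by simp
    show "y i = (\<Sum>k<n. diag_adj L d i k * x k)" if "i < n" for i using xy[OF that] .
    show "(\<Sum>k<n. y k * shifted_adj G k j) = x j" if "j < n" for j using yM[OF that] .
    show "e = framing G' n + 1 + (\<Sum>k<n. y k * x k)" by (rule e(2))
  qed (use e(1) ext x y sym n2 in \<open>auto simp: shifted_adj_def diag_adj_def with_diag_def\<close>)
  moreover have "vsign G' n = 1 \<or> vsign G' n = -1" using G'(3)[of n] nv by simp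
  ultimately show ?thesis using assms(2,3) 1(6) nv n2 ext loop n
    by (auto simp: inverse_pair_def less_Suc_eq)
qed

lemma Omega_g2_pair:
  assumes p: "inverse_pair G L d" and "is_labeled_graph G'" and g2: "Omega_g2 G G'"
  shows "\<exists>L' d'. Omega2 L L' \<and> inverse_pair G' L' d'"
proof -
  note 1 = inverse_pairD[OF p]
  define n where "n = nv G"
  define x :: "nat \<Rightarrow> bit" where "x k = of_bool (adj G' n k)" for k
  define y where "y i = (\<Sum>k<n. diag_adj L d i k * x k)" for i
  define e where "e = framing G' n + 1 + (\<Sum>k<n. y k * x k)"
  define L' where "L' = \<lparr>nv = n + 2, adj = (\<lambda>i j. if i < n then if j < n then adj L i j else y i = 1
      else if j < n then y j = 1 else i \<noteq> j \<and> e = 0),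
    loop = (\<lambda>i. if i < n then loop L i else (i = n) = (vsign G' n = (if e = 1 then 1 else -1)))\<rparr>"
  have nv: "nv L = n" using 1(3) n_def by simp
  have L': "is_looped_graph L'"
    by (rule is_looped_graphI) (use is_looped_graphD[OF 1(2)] nv in \<open>auto simp: L'_def split: if_splits\<close>)
  have o2: "Omega2 L L'" by (auto simp: Omega2_def looped_extends_def L'_def Let_def nv)
  have "inverse_pair G' L' (d(n := e, Suc n := e))"
    by (rule Omega2_pair_step[OF p assms(2) L' g2 o2 n_def x_def _ y_def _ e_def])
      (auto simp: L'_def of_bool_eq_1_bit)
  then show ?thesis using o2 by blast
qed

lemma Omega2_pair:
  assumes p: "inverse_pair G L d" and "is_looped_graph L'" and o2: "Omega2 L L'"
  shows "\<exists>G' d'. Omega_g2 G G' \<and> inverse_pair G' L' d'"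
proof -
  note 1 = inverse_pairD[OF p]
  define n where "n = nv G"
  define y :: "nat \<Rightarrow> bit" where "y k = of_bool (adj L' n k)" for k
  define x where "x i = (\<Sum>k<n. shifted_adj G i k * y k)" for i
  define e :: bit where "e = of_bool (\<not> adj L' n (Suc n))"
  define c where "c = e + (\<Sum>k<n. y k * x k)"
  define s :: int where "s = (if loop L' n \<longleftrightarrow> e = 1 then 1 else -1)"
  define G' :: labeled_graph where
    "G' = \<lparr>nv = n + 2, adj = (\<lambda>i j. if i < n then if j < n then adj G i j else x i = 1
      else if j < n then x j = 1 else i \<noteq> j \<and> c = 0),
    framing = (\<lambda>i. if i < n then framing G i else c + 1),
    vsign = (\<lambda>i. if i < n then vsign G i else if i = n then s else - s)\<rparr>"
  have G': "is_labeled_graph G'"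
    by (rule is_labeled_graphI) (use is_labeled_graphD[OF 1(1)] n_def in \<open>auto simp: G'_def s_def
      split: if_splits\<close>)
  have g2: "Omega_g2 G G'" by (cases c) (auto simp: Omega_g2_def labeled_extends_def G'_def Let_def n_def)
  have xy: "y i = (\<Sum>k<n. diag_adj L d i k * x k)" if "i < n" for i
    unfolding x_def using inverse_on_apply[OF 1(4), of i y] that by (simp add: n_def)
  have "inverse_pair G' L' (d(n := e, Suc n := e))"
    by (rule Omega2_pair_step[OF p G' assms(2) g2 o2 n_def _ y_def xy])
      (auto simp: G'_def of_bool_eq_1_bit e_def c_def s_def)
  then show ?thesis using g2 by blast
qed

section \<open>The third move\<close>

definition toggle_triangle :: "nat \<Rightarrow> nat \<Rightarrow> nat \<Rightarrow> looped_graph \<Rightarrow> looped_graph" where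
  "toggle_triangle u v w L = toggle {{u, v}, {u, w}, {v, w}} L"

text \<open>The condition of \<open>Omega3\<close> as a parity: over Z_2 the columns of
  \<open>u\<close>, \<open>v\<close>, \<open>w\<close> sum to zero outside the triple, the form in
  which it enters linear algebra.\<close>

definition even_on_triangle :: "nat \<Rightarrow> nat \<Rightarrow> nat \<Rightarrow> looped_graph \<Rightarrow> bool" where
  "even_on_triangle u v w L \<longleftrightarrow> (\<forall>x<nv L. x \<notin> {u, v, w} \<longrightarrow> ((adj L x u \<noteq> adj L x v) \<longleftrightarrow> adj L x w))"

text \<open>The loops that occur in the looped graph of a labeled graph to which \<open>\<Omega>\<^sub>g3\<close> applies at \<open>u, v, w\<close>.\<close>

definition R3_type :: "nat \<Rightarrow> nat \<Rightarrow> nat \<Rightarrow> looped_graph \<Rightarrow> bool" where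
  "R3_type u v w L \<longleftrightarrow> (loop L u \<longleftrightarrow> adj L u v \<noteq> adj L u w) \<and> (loop L v \<longleftrightarrow> adj L u v = adj L v w) \<and>
     (loop L w \<longleftrightarrow> adj L u w = adj L v w)"

lemma toggle_triangle_sel [simp]:
  "nv (toggle_triangle u v w L) = nv L" "loop (toggle_triangle u v w L) = loop L"
  by (simp_all add: toggle_triangle_def)

lemma adj_toggle_triangle:
  assumes "distinct [u, v, w]"
  shows "adj (toggle_triangle u v w L) x y \<longleftrightarrow> adj L x y \<noteq> (x \<noteq> y \<and> x \<in> {u, v, w} \<and> y \<in> {u, v, w})"
  using assms by (auto simp: toggle_triangle_def doubleton_eq_iff)

lemma toggle_triangle_perm: "toggle_triangle u w v L = toggle_triangle u v w L"
  "toggle_triangle v u w L = toggle_triangle u v w L"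
  unfolding toggle_triangle_def by (simp_all add: insert_commute)

lemma toggle_toggle: "toggle P (toggle P G) = G"
proof -
  have "((a = (\<not> b)) = (\<not> b)) = a" for a b by blast
  then show ?thesis by (simp add: toggle_def)
qed

lemma toggle_triangle_toggle_triangle [simp]: "toggle_triangle u v w (toggle_triangle u v w L) = L"
  by (simp only: toggle_triangle_def toggle_toggle)

lemma is_looped_toggle_triangle:
  assumes "is_looped_graph L" "distinct [u, v, w]"
  shows "is_looped_graph (toggle_triangle u v w L)"
proof (rule is_looped_graphI)
  show "\<not> adj (toggle_triangle u v w L) i i" if "i < nv (toggle_triangle u v w L)" for i
    using is_looped_graphD(1)[OF assms(1)] that by (simp add: adj_toggle_triangle[OF assms(2)])
  show "adj (toggle_triangle u v w L) j i"
    if "i < nv (toggle_triangle u v w L)" "j < nv (toggle_triangle u v w L)"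
      "adj (toggle_triangle u v w L) i j" for i j
    using is_looped_graphD(2)[OF assms(1), of i j] that unfolding adj_toggle_triangle[OF assms(2)] by auto
qed

lemma even_on_triangle_toggle_triangle: "distinct [u, v, w]
  \<Longrightarrow> even_on_triangle u v w (toggle_triangle u v w L) \<longleftrightarrow> even_on_triangle u v w L"
  by (simp add: even_on_triangle_def adj_toggle_triangle)

lemma even_on_triangle_iff_card:
  assumes "is_looped_graph L" "distinct [u, v, w]" "{u, v, w} \<subseteq> {..<nv L}"
  shows "even_on_triangle u v w L \<longleftrightarrow>
    (\<forall>x<nv L. x \<notin> {u, v, w} \<longrightarrow> card (nbhd L x \<inter> {u, v, w}) \<in> {0, 2})"
proof -
  have "card (nbhd L x \<inter> {u, v, w}) = (of_bool (adj L x u) + of_bool (adj L x v) + of_bool (adj L x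
    w) :: nat)" for x
    using assms by (simp add: nbhd_def Int_insert_right)
  then show ?thesis by (auto simp: even_on_triangle_def of_bool_def)
qed

lemma sum_triple:
  fixes f :: "nat \<Rightarrow> bit"
  assumes "distinct [u, v, w]" "u < n" "v < n" "w < n"
  shows "(\<Sum>k<n. f k * of_bool (k \<in> {u, v, w})) = f u + f v + f w"
proof -
  have "(\<Sum>k<n. f k * of_bool (k \<in> {u, v, w}))
      = (\<Sum>k<n. f k * of_bool (k = u) + f k * of_bool (k = v) + f k * of_bool (k = w))"
    using assms(1) by (intro sum.cong) (auto simp: of_bool_def)
  also have "\<dots> = f u + f v + f w" using assms(2-4) by (simp only: sum.distrib sum_delta_mult)
  finally show ?thesis .
qed

text \<open>Let g be the indicator of {u, v, w}. Column \<open>u\<close> of \<open>M\<close> is g,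
  so N g = e_u and N r = e_v + e_w, while g is fixed from the left by the new matrix; the
  contributions then cancel. The change of \<open>N\<close> has ones on the whole block except at
  (u, u): it toggles the triangle and the diagonal at \<open>v\<close> and \<open>w\<close>.\<close>

lemma inverse_on_update3:
  assumes NM: "inverse_on n M N" and uvw: "distinct [u, v, w]" "u < n" "v < n" "w < n"
    and Mu: "\<And>i. i < n \<Longrightarrow> M i u = of_bool (i \<in> {u, v, w})" "\<And>i. i < n \<Longrightarrow> M u i = of_bool (i \<in> {u, v, w})"
    and Mvw: "M v v = 1" "M w w = 1" "M v w = 0" "M w v = 0"
    and r: "\<And>i. i < n \<Longrightarrow> r i = M i v + M i w" "\<And>i. i < n \<Longrightarrow> r i = M v i + M w i"
  shows "inverse_on n (\<lambda>i j. M i j + of_bool (i \<in> {u, v, w}) * r j + r i * of_bool (j \<in> {u, v, w}))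
    (\<lambda>i j. N i j + of_bool (i \<in> {u, v, w}) * of_bool (j \<in> {u, v, w}) + of_bool (i = u) * of_bool (j = u))"
  unfolding inverse_on_def
proof (intro allI impI)
  fix i j assume ij: "i < n" "j < n"
  define g :: "nat \<Rightarrow> bit" where "g k = of_bool (k \<in> {u, v, w})" for k
  define M' where "M' k j = M k j + g k * r j + r k * g j" for k j
  have rM: "r u = 0" "r v = 1" "r w = 1" using Mu Mvw uvw by (simp_all add: r(1))
  have g1: "g u = 1" "g v = 1" "g w = 1" by (simp_all add: g_def)
  have NMij: "(\<Sum>k<n. N i k * M k j) = of_bool (i = j)" if "j < n" for j
    using NM ij that by (simp add: inverse_on_def)
  have Ng: "(\<Sum>k<n. N i k * g k) = of_bool (i = u)"
    using NMij[OF uvw(2)] Mu(1) by (simp add: g_def)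
  have Nr: "(\<Sum>k<n. N i k * r k) = of_bool (i = v) + of_bool (i = w)"
  proof -
    have "(\<Sum>k<n. N i k * r k) = (\<Sum>k<n. N i k * M k v + N i k * M k w)"
      by (intro sum.cong) (auto simp: r(1) distrib_left)
    then show ?thesis using NMij uvw by (simp add: sum.distrib)
  qed
  have "(\<Sum>k<n. N i k * M' k j) = (\<Sum>k<n. N i k * M k j) + (\<Sum>k<n. N i k * g k) * r j + (\<Sum>k<n. N i k *
    r k) * g j"
    by (simp add: M'_def algebra_simps sum.distrib sum_distrib_left)
  then have 1: "(\<Sum>k<n. N i k * M' k j) = of_bool (i = j) + of_bool (i = u) * r j + (of_bool (i
    = v) + of_bool (i = w)) * g j"
    using NMij ij Ng Nr by simp
  have "(\<Sum>k<n. M' k j * of_bool (k \<in> {u, v, w})) = M' u j + M' v j + M' w j"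
    using uvw by (rule sum_triple)
  also have "\<dots> = g j"
    using r(2)[OF ij(2)] Mu(2)[OF ij(2)] rM g1 by (simp add: M'_def g_def[of j])
  finally have "(\<Sum>k<n. M' k j * g k) = g j" by (simp only: g_def)
  moreover have "(\<Sum>k<n. g i * g k * M' k j) = g i * (\<Sum>k<n. M' k j * g k)"
    by (simp only: sum_distrib_left ac_simps)
  ultimately have 2: "(\<Sum>k<n. g i * g k * M' k j) = g i * g j" by simp
  have 3: "(\<Sum>k<n. of_bool (i = u) * of_bool (k = u) * M' k j) = of_bool (i = u) * (g j + r j)"
    using uvw Mu(2)[OF ij(2)] rM g1
    by (simp add: mult.assoc sum_distrib_left[symmetric] M'_def g_def[of j])
  have "(\<Sum>k<n. (N i k + g i * g k + of_bool (i = u) * of_bool (k = u)) * M' k j)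
      = of_bool (i = j) + (of_bool (i = u) + of_bool (i = v) + of_bool (i = w) + g i) * g j"
    by (simp only: distrib_right sum.distrib 1 2 3) (simp add: algebra_simps)
  also have "of_bool (i = u) + of_bool (i = v) + of_bool (i = w) + g i = 0"
    using uvw(1) by (auto simp: g_def)
  finally show "(\<Sum>k<n. (N i k + of_bool (i \<in> {u, v, w}) * of_bool (k \<in> {u, v, w}) + of_bool (i
    = u) * of_bool (k = u)) *
      (M k j + of_bool (k \<in> {u, v, w}) * r j + r k * of_bool (j \<in> {u, v, w}))) = of_bool (i = j)"
    by (simp add: g_def M'_def)
qed

definition Omega_g3_result :: "nat \<Rightarrow> nat \<Rightarrow> nat \<Rightarrow> labeled_graph \<Rightarrow> labeled_graph" where
  "Omega_g3_result u v w G = toggle {{u, t} | t. t \<in> {v, w} \<union>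
       ((nbhd G v - nbhd G w) \<union> (nbhd G w - nbhd G v) - {u})} G \<lparr>vsign := (vsign G)(v := 1, w := 1)\<rparr>"

text \<open>Row \<open>u\<close> of A(G) + E is the indicator of {u, v, w}, so in the inverse these
  three columns sum to e_u. Outside the triple this is the parity condition; inside it determines
  \<open>d\<close> from the three adjacencies and, as all signs are negative, the loops. The updated
  matrix is that of \<open>G'\<close> with \<open>v\<close> and \<open>w\<close> exchanged.\<close>

lemma
  assumes p: "inverse_pair G L d" and uvw: "distinct [u, v, w]" "u < nv G" "v < nv G" "w < nv G"
    and lab: "\<And>x. x \<in> {u, v, w} \<Longrightarrow> framing G x = 0 \<and> vsign G x = -1"
    and N: "nbhd G u = {v, w}" "\<not> adj G v w"
  defines "G' \<equiv> Omega_g3_result u v w G"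
  shows Omega_g3_labeled: "is_labeled_graph G'"
    and Omega_g3_even: "even_on_triangle u v w L"
    and Omega_g3_type: "R3_type u v w L"
    and Omega_g3_pair: "inverse_pair (permute_labeled (Transposition.transpose v w) G')
      (toggle_triangle u v w L)
      (d(v := d v + 1, w := d w + 1))"
proof -
  note 1 = inverse_pairD[OF p]
  note G = is_labeled_graphD[OF 1(1)] and L = is_looped_graphD[OF 1(2)]
  define n where "n = nv G"
  have nv: "nv L = n" using 1(3) n_def by simp
  have lt: "u < n" "v < n" "w < n" using uvw n_def by auto
  have ne: "u \<noteq> v" "u \<noteq> w" "v \<noteq> w" "v \<noteq> u" "w \<noteq> u" "w \<noteq> v" using uvw(1) by auto
  have sel: "nv G' = n" "vsign G' = (vsign G)(v := 1, w := 1)" "framing G' = framing G"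
    by (simp_all add: G'_def Omega_g3_result_def n_def)
  have Nu: "adj G u t \<longleftrightarrow> t = v \<or> t = w" "adj G t u \<longleftrightarrow> t = v \<or> t = w" if "t < n" for t
  proof -
    show "adj G u t \<longleftrightarrow> t = v \<or> t = w" using N(1) that by (auto simp: nbhd_def n_def)
    then show "adj G t u \<longleftrightarrow> t = v \<or> t = w" using G(2) that uvw by (auto simp: n_def)
  qed
  have adj: "adj G' i j \<longleftrightarrow> adj G i j \<noteq>
      (i = u \<and> j \<noteq> u \<and> (j = v \<or> j = w \<or> adj G v j \<noteq> adj G w j) \<or>
       j = u \<and> i \<noteq> u \<and> (i = v \<or> i = w \<or> adj G v i \<noteq> adj G w i))" if "i < n" "j < n" for i j
    unfolding G'_def Omega_g3_result_def using that ne by (auto simp: doubleton_eq_iff nbhd_def n_def)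
  show G'l: "is_labeled_graph G'"
    by (rule is_labeled_graphI) (use G n_def in \<open>auto simp: adj sel\<close>)
  have Mu: "shifted_adj G i u = of_bool (i \<in> {u, v, w})"
    "shifted_adj G u i = of_bool (i \<in> {u, v, w})" if "i < n" for i
    using lab Nu that ne by (auto simp: shifted_adj_def)
  have avw: "\<not> adj G w v" using N(2) G(2) uvw by blast
  have Mvw: "shifted_adj G v v = 1" "shifted_adj G w w = 1" "shifted_adj G v w = 0" "shifted_adj G w v = 0"
    using lab N(2) ne avw by (simp_all add: shifted_adj_def)
  define r where "r i = shifted_adj G i v + shifted_adj G i w" for i
  have rsym: "r i = shifted_adj G v i + shifted_adj G w i" if "i < n" for i
    using symmetric_on_shifted_adj[OF 1(1)] that lt by (auto simp: r_def symmetric_on_def n_def)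
  have rval: "r i = (if i = u then 0 else if i = v \<or> i = w then 1 else of_bool (adj G v i \<noteq> adj G w i))"
    if "i < n" for i
  proof -
    have "shifted_adj G i v = of_bool (adj G v i)" "shifted_adj G i w = of_bool (adj G w i)" if
      "i \<noteq> v" "i \<noteq> w"
      using that \<open>i < n\<close> lt G(2) n_def by (simp_all add: shifted_adj_def)
    then show ?thesis using Mu(2) lt Mvw ne by (auto simp: r_def)
  qed
  let ?G = "permute_labeled (Transposition.transpose v w) G'"
  let ?d = "d(v := d v + 1, w := d w + 1)"
  have t: "bij_betw (Transposition.transpose v w) {..<nv G'} {..<nv G'}"
    using lt by (simp add: sel bij_betw_transpose)
  have shifted_adj': "shifted_adj ?G i j = shifted_adj G i j + of_bool (i \<in> {u, v, w}) * r j + r i *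
    of_bool (j \<in> {u, v, w})"
    if ij: "i < n" "j < n" for i j
  proof -
    have tr: "Transposition.transpose v w u = u" "Transposition.transpose v w v = w"
      "Transposition.transpose v w w = v" "\<And>x. x \<noteq> v \<Longrightarrow> x \<noteq> w \<Longrightarrow> Transposition.transpose v w x = x"
      using ne by auto
    have irr: "\<not> adj G u u" "\<not> adj G v v" "\<not> adj G w w" "framing G u = 0" "framing G v = 0" "framing G w = 0"
      using G(1) lt n_def lab by auto
    consider "j = u" | "j = v" | "j = w" | "j \<noteq> u" "j \<noteq> v" "j \<noteq> w" by blast
    note cj = this
    consider "i = u" | "i = v" | "i = w" | "i \<noteq> u" "i \<noteq> v" "i \<noteq> w" by blast
    then show ?thesis
    proof cases
      case 1
      from cj show ?thesis unfolding 1
        by cases (use ij lt ne Nu N(2) avw irr in \<open>simp_all add: shifted_adj_def adj tr sel rval of_bool_def\<close>)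
    next
      case 2
      from cj show ?thesis unfolding 2
        by cases (use ij lt ne Nu N(2) avw irr in \<open>simp_all add: shifted_adj_def adj tr sel rval of_bool_def\<close>)
    next
      case 3
      from cj show ?thesis unfolding 3
        by cases (use ij lt ne Nu N(2) avw irr in \<open>simp_all add: shifted_adj_def adj tr sel rval of_bool_def\<close>)
    next
      case 4
      have "adj G i v = adj G v i" "adj G i w = adj G w i" using G(2) ij lt n_def by auto
      with cj 4 show ?thesis
        by cases (use ij lt ne Nu N(2) avw irr in \<open>simp_all add: shifted_adj_def adj tr sel rval of_bool_def\<close>)
    qed
  qed
  have NMu: "(\<Sum>k<n. diag_adj L d i k * of_bool (k \<in> {u, v, w})) = of_bool (i = u)" if "i < n" for i
  proof -
    have "(\<Sum>k<n. diag_adj L d i k * of_bool (k \<in> {u, v, w})) = (\<Sum>k<n. diag_adj L d i k * shifted_adj G k u)"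
      using Mu(1) by (intro sum.cong) auto
    then show ?thesis using 1(4) that lt by (simp add: inverse_on_def n_def)
  qed
  then have sum3: "diag_adj L d i u + diag_adj L d i v + diag_adj L d i w = of_bool (i = u)" if "i < n" for i
    using sum_triple[OF uvw(1) lt, of "diag_adj L d i"] that by simp
  have Lsym: "adj L i j = adj L j i" if "i < n" "j < n" for i j
    using L(2) that nv by simp
  show "even_on_triangle u v w L" unfolding even_on_triangle_def
  proof (intro allI impI)
    fix x assume x: "x < nv L" "x \<notin> {u, v, w}"
    have "of_bool (adj L x u) + of_bool (adj L x v) + of_bool (adj L x w) = (0 :: bit)"
      using sum3[of x] x nv by (simp add: diag_adj_def with_diag_def)
    then show "(adj L x u \<noteq> adj L x v) = adj L x w" by (simp add: of_bool_def split: if_splits)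
  qed
  have du: "d u + of_bool (adj L u v) + of_bool (adj L u w) = 1"
    and dv: "of_bool (adj L u v) + d v + of_bool (adj L v w) = 0"
    and dw: "of_bool (adj L u w) + of_bool (adj L v w) + d w = 0"
    using sum3[OF lt(1)] sum3[OF lt(2)] sum3[OF lt(3)] ne Lsym[of v u] Lsym[of w u] Lsym[of w v] lt
    by (simp_all add: diag_adj_def with_diag_def)
  have loops: "loop L x \<longleftrightarrow> d x = 0" if "x \<in> {u, v, w}" for x
    using 1(6)[of x] lab[OF that] that lt n_def by (auto split: if_splits)
  show "R3_type u v w L"
    using du dv dw loops unfolding R3_type_def
    by (cases "d u"; cases "d v"; cases "d w"; auto simp: of_bool_def split: if_splits)
  have diag_adj': "diag_adj (toggle_triangle u v w L) ?d i j
    = diag_adj L d i j + of_bool (i \<in> {u, v, w}) * of_bool (j \<in> {u, v, w})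
      + of_bool (i = u) * of_bool (j = u)" for i j
    using ne by (cases "i = j"; auto simp: diag_adj_def with_diag_def adj_toggle_triangle[OF uvw(1)])
  have inverse_on: "inverse_on n (shifted_adj ?G) (diag_adj (toggle_triangle u v w L) ?d)"
    by (rule inverse_on_cong[OF inverse_on_update3[OF 1(4)[folded n_def] uvw(1) lt Mu Mvw r_def rsym]])
      (simp_all only: shifted_adj' diag_adj')
  show "inverse_pair ?G (toggle_triangle u v w L) ?d" unfolding inverse_pair_def
  proof (intro conjI allI impI)
    fix i assume i: "i < nv ?G"
    have "i \<in> {v, w} \<or> i \<notin> {v, w}" by blast
    then show "loop (toggle_triangle u v w L) i \<longleftrightarrow> vsign ?G i = (if ?d i = 1 then 1 else -1)"
    proof
      assume i: "i \<in> {v, w}"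
      then have "vsign ?G i = 1" using ne by (auto simp: sel)
      moreover have "?d i = d i + 1" using i ne by auto
      moreover have "loop L i \<longleftrightarrow> d i = 0" using loops i by auto
      ultimately show ?thesis by (cases "d i") auto
    next
      assume "i \<notin> {v, w}"
      then show ?thesis using 1(6)[of i] i by (simp add: sel n_def)
    qed
  next
    show "is_labeled_graph ?G" using is_labeled_permute[OF t G'l] .
    show "is_looped_graph (toggle_triangle u v w L)" using is_looped_toggle_triangle[OF 1(2) uvw(1)] .
    show "nv (toggle_triangle u v w L) = nv ?G" by (simp add: nv sel)
    show "inverse_on (nv ?G) (shifted_adj ?G) (diag_adj (toggle_triangle u v w L) ?d)"
      using inverse_on by (simp add: sel)
  qed
qed

text \<open>The variants of the third move are derived from each other by the same steps in two
  settings that run in opposite directions: for homotopy, \<open>Omega3\<close> is given and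
  \<open>R3_type\<close> is derived; for \<open>preimages_equiv\<close> it is the reverse.
  Transitivity asks for a looped graph in the middle, because \<open>preimages_equiv\<close> holds
  vacuously at anything without preimages.\<close>

locale looped_equivalence =
  fixes R :: "looped_graph \<Rightarrow> looped_graph \<Rightarrow> bool"
  assumes R_sym: "R L L' \<Longrightarrow> R L' L"
    and R_trans: "is_looped_graph L' \<Longrightarrow> R L L' \<Longrightarrow> R L' L'' \<Longrightarrow> R L L''"
    and R_iso: "is_looped_graph L \<Longrightarrow> is_looped_graph L' \<Longrightarrow> looped_iso L L' \<Longrightarrow> R L L'"
    and R_Omega2: "is_looped_graph L \<Longrightarrow> is_looped_graph L' \<Longrightarrow> Omega2 L L' \<Longrightarrow> R L L'"
begin

text \<open>The arguments are the adjacencies \<open>uv\<close>, \<open>uw\<close>, \<open>vw\<close>, followed by the loops at \<open>u\<close>, \<open>v\<close>, \<open>w\<close>.\<close>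

definition r3_ok :: "bool \<Rightarrow> bool \<Rightarrow> bool \<Rightarrow> bool \<Rightarrow> bool \<Rightarrow> bool \<Rightarrow> bool" where
  "r3_ok p q m a b c \<longleftrightarrow> (\<forall>L u v w. is_looped_graph L \<longrightarrow> distinct [u, v, w] \<longrightarrow> {u, v, w} \<subseteq> {..<nv L} \<longrightarrow>
     even_on_triangle u v w L \<longrightarrow> adj L u v = p \<longrightarrow> adj L u w = q \<longrightarrow> adj L v w = m \<longrightarrow>
     loop L u = a \<longrightarrow> loop L v = b \<longrightarrow> loop L w = c \<longrightarrow> R L (toggle_triangle u v w L))"

lemma r3_okI:
  assumes "\<And>L u v w. is_looped_graph L \<Longrightarrow> distinct [u, v, w] \<Longrightarrow> u < nv L \<Longrightarrow> v < nv L \<Longrightarrow> w < nv L \<Longrightarrow>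
     even_on_triangle u v w L \<Longrightarrow> adj L u v = p \<Longrightarrow> adj L u w = q \<Longrightarrow> adj L v w = m \<Longrightarrow>
     loop L u = a \<Longrightarrow> loop L v = b \<Longrightarrow> loop L w = c \<Longrightarrow> R L (toggle_triangle u v w L)"
  shows "r3_ok p q m a b c"
  unfolding r3_ok_def using assms by simp

lemma r3_okD:
  assumes "r3_ok (adj L u v) (adj L u w) (adj L v w) (loop L u) (loop L v) (loop L w)"
    "is_looped_graph L" "distinct [u, v, w]" "u < nv L" "v < nv L" "w < nv L" "even_on_triangle u v w L"
  shows "R L (toggle_triangle u v w L)"
  using assms unfolding r3_ok_def by simp

lemma r3_ok_swap_vw:
  assumes ok: "r3_ok q p m a c b"
  shows "r3_ok p q m a b c"
proof (rule r3_okI)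
  fix L u v w
  assume *: "is_looped_graph L" "distinct [u, v, w]" "u < nv L" "v < nv L" "w < nv L"
    "even_on_triangle u v w L" "adj L u v = p" "adj L u w = q" "adj L v w = m" "loop L u = a"
      "loop L v = b" "loop L w = c"
  have "adj L w v = adj L v w" using is_looped_graphD(2)[OF *(1)] * by blast
  moreover have "even_on_triangle u w v L" using *(6) by (auto simp: even_on_triangle_def)
  ultimately have "R L (toggle_triangle u w v L)" using ok * by (intro r3_okD) auto
  then show "R L (toggle_triangle u v w L)" by (simp only: toggle_triangle_perm)
qed

lemma r3_ok_swap_uv:
  assumes ok: "r3_ok p m q b a c"
  shows "r3_ok p q m a b c"
proof (rule r3_okI)
  fix L u v w
  assume *: "is_looped_graph L" "distinct [u, v, w]" "u < nv L" "v < nv L" "w < nv L"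
    "even_on_triangle u v w L" "adj L u v = p" "adj L u w = q" "adj L v w = m" "loop L u = a"
      "loop L v = b" "loop L w = c"
  have "adj L v u = adj L u v" using is_looped_graphD(2)[OF *(1)] * by blast
  moreover have "even_on_triangle v u w L" using *(6) by (auto simp: even_on_triangle_def)
  ultimately have "R L (toggle_triangle v u w L)" using ok * by (intro r3_okD) auto
  then show "R L (toggle_triangle u v w L)" by (simp only: toggle_triangle_perm)
qed

lemma r3_ok_inverse:
  assumes ok: "r3_ok (\<not> p) (\<not> q) (\<not> m) a b c"
  shows "r3_ok p q m a b c"
proof (rule r3_okI)
  fix L u v w
  assume *: "is_looped_graph L" "distinct [u, v, w]" "u < nv L" "v < nv L" "w < nv L"
    "even_on_triangle u v w L" "adj L u v = p" "adj L u w = q" "adj L v w = m" "loop L u = a"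
      "loop L v = b" "loop L w = c"
  have "R (toggle_triangle u v w L) (toggle_triangle u v w (toggle_triangle u v w L))"
    using ok * is_looped_toggle_triangle[OF *(1,2)]
      by (intro r3_okD) (auto simp: adj_toggle_triangle even_on_triangle_toggle_triangle)
  then show "R L (toggle_triangle u v w L)" using R_sym by simp
qed

text \<open>
  Insert twins \<open>n\<close> and \<open>n + 1\<close> which look like \<open>v\<close> except that their adjacencies to \<open>u\<close> and \<open>w\<close> are
  complemented, with \<open>n + 1\<close> looped like \<open>v\<close>. The third move on \<open>u, n, w\<close> turns \<open>v\<close> and \<open>n\<close> into twins;
  after their removal \<open>n + 1\<close> plays the role of \<open>v\<close> in the result of the third move on \<open>u, v, w\<close>.
\<close>

lemma r3_ok_switch:
  assumes ok: "r3_ok (\<not> p) q (\<not> m) a (\<not> b) c"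
  shows "r3_ok p q m a b c"
proof (rule r3_okI)
  fix L u v w
  assume L: "is_looped_graph L" and uvw: "distinct [u, v, w]" and lt: "u < nv L" "v < nv L" "w < nv L"
    and even: "even_on_triangle u v w L" and adj: "adj L u v = p" "adj L u w = q" "adj L v w = m"
    and loop: "loop L u = a" "loop L v = b" "loop L w = c"
  define n where "n = nv L"
  note Ls = is_looped_graphD[OF L]
  have ne: "u \<noteq> v" "u \<noteq> w" "v \<noteq> w" "v \<noteq> u" "w \<noteq> u" "w \<noteq> v" using uvw by auto
  have lt': "u < n" "v < n" "w < n" "u \<noteq> n" "v \<noteq> n" "w \<noteq> n" "u \<noteq> Suc n" "v \<noteq> Suc n" "w \<noteq> Suc n"
    using lt n_def by auto
  have sym: "adj L i j = adj L j i" if "i < n" "j < n" for i j using Ls(2) that n_def by auto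
  have adj': "adj L v u = p" "adj L w u = q" "adj L w v = m" using adj sym lt' by blast+
  \<comment> \<open>The adjacency of \<open>v\<close> with the twins, and of the twins with each
    other, is dictated by the parity condition for \<open>u, n, w\<close> at the vertices
    \<open>v\<close> and \<open>Suc n\<close>.\<close>
  define s where "s \<longleftrightarrow> p \<noteq> m"
  define t where "t x \<longleftrightarrow> (if x = u \<or> x = w then \<not> adj L v x else if x = v then s else adj L v x)" for x
  define L2 where "L2 = \<lparr>nv = n + 2, adj = (\<lambda>i j. if i < n then (if j < n then adj L i j else t i)
      else if j < n then t j else i \<noteq> j \<and> s),
    loop = (\<lambda>i. if i < n then loop L i else (i = n) \<noteq> b)\<rparr>"
  have nv2: "nv L2 = Suc (Suc n)" by (simp add: L2_def)
  have adj2: "i < n \<Longrightarrow> j < n \<Longrightarrow> adj L2 i j = adj L i j" "i < n \<Longrightarrow> adj L2 i n = t i"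
    "i < n \<Longrightarrow> adj L2 i (Suc n) = t i" "j < n \<Longrightarrow> adj L2 n j = t j" "j < n \<Longrightarrow> adj L2 (Suc n) j = t j"
    "adj L2 n (Suc n) = s" "adj L2 (Suc n) n = s" "\<not> adj L2 n n" "\<not> adj L2 (Suc n) (Suc n)" for i j
    by (simp_all add: L2_def)
  have loop2: "i < n \<Longrightarrow> loop L2 i = loop L i" "loop L2 n = (\<not> b)" "loop L2 (Suc n) = b" for i
    by (simp_all add: L2_def)
  have t: "t u = (\<not> p)" "t w = (\<not> m)" "t v = s" "\<And>x. x \<noteq> u \<Longrightarrow> x \<noteq> w \<Longrightarrow> x \<noteq> v \<Longrightarrow> t x = adj L v x"
    using ne adj adj' by (simp_all add: t_def)
  have L2: "is_looped_graph L2"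
    by (rule is_looped_graphI) (use Ls n_def in \<open>auto simp: L2_def split: if_splits\<close>)
  have R1: "R L L2"
    by (rule R_Omega2[OF L L2]) (auto simp: Omega2_def looped_extends_def L2_def n_def Let_def)
  have u'n: "distinct [u, n, w]" using ne lt' by simp
  have "even_on_triangle u n w L2" unfolding even_on_triangle_def
  proof (intro allI impI)
    fix x assume x: "x < nv L2" "x \<notin> {u, n, w}"
    then consider "x = v" | "x = Suc n" | "x < n" "x \<noteq> v" by (auto simp: nv2 less_Suc_eq)
    then show "(adj L2 x u \<noteq> adj L2 x n) = adj L2 x w"
    proof cases
      case 3
      then have "(adj L x u \<noteq> adj L x v) = adj L x w" using even x by (simp add: even_on_triangle_def n_def)
      moreover have "adj L v x = adj L x v" using sym lt' 3 by blast
      ultimately show ?thesis using 3 x lt' by (simp add: adj2 t)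
    qed (use lt' adj adj' in \<open>auto simp: adj2 t s_def\<close>)
  qed
  define L3 where "L3 = toggle_triangle u n w L2"
  have L3: "is_looped_graph L3" unfolding L3_def by (rule is_looped_toggle_triangle[OF L2 u'n])
  have R2: "R L2 L3" unfolding L3_def
    by (rule r3_okD[OF _ L2 u'n])
      (use ok \<open>even_on_triangle u n w L2\<close> lt' adj loop in \<open>simp_all add: adj2 loop2 t nv2\<close>)
  \<comment> \<open>\<open>v\<close> and \<open>n\<close> are now twins with opposite loops;
    exchanging \<open>v\<close> with \<open>Suc n\<close> moves them to the last two positions,
    where \<open>Omega2\<close> expects them.\<close>
  define L4 where "L4 = permute_looped (Transposition.transpose v (Suc n)) L3"
  have nv3: "nv L3 = Suc (Suc n)" by (simp add: L3_def nv2)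
  have bij: "bij_betw (Transposition.transpose v (Suc n)) {..<nv L3} {..<nv L3}"
    using lt' nv3 by (intro bij_betw_transpose) auto
  have L4: "is_looped_graph L4" unfolding L4_def by (rule is_looped_permute[OF bij L3])
  have R3: "R L4 L3" unfolding L4_def
    by (rule R_iso[OF L4[unfolded L4_def] L3 looped_iso_permute[OF bij]])
  have adj3: "adj L3 x y \<longleftrightarrow> adj L2 x y \<noteq> (x \<noteq> y \<and> x \<in> {u, n, w} \<and> y \<in> {u, n, w})" for x y
    unfolding L3_def by (rule adj_toggle_triangle[OF u'n])
  have loop3: "loop L3 = loop L2" by (simp add: L3_def)
  have tr: "Transposition.transpose v (Suc n) v = Suc n" "Transposition.transpose v (Suc n) (Suc n) = v"
    "\<And>x. x \<noteq> v \<Longrightarrow> x \<noteq> Suc n \<Longrightarrow> Transposition.transpose v (Suc n) x = x"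
    by auto
  have L': "is_looped_graph (toggle_triangle u v w L)" by (rule is_looped_toggle_triangle[OF L uvw])
  have adj4: "adj L4 i j = adj (toggle_triangle u v w L) i j" if "i < n" "j < n" for i j
  proof -
    have tv: "t x = adj (toggle_triangle u v w L) v x" if "x < n" "x \<noteq> v" for x
      using that ne adj adj' by (auto simp: t_def adj_toggle_triangle[OF uvw])
    have "adj (toggle_triangle u v w L) i v = adj (toggle_triangle u v w L) v i"
      using is_looped_graphD(2)[OF L'] \<open>i < n\<close> lt' n_def by simp
    moreover have "\<not> adj L v v" using Ls(1) lt by blast
    ultimately show ?thesis
      using that lt' ne by (cases "i = v"; cases
        "j = v") (simp_all add: L4_def tr adj3 adj2 tv adj_toggle_triangle[OF uvw])
  qed
  have "adj L4 n x = adj L4 (Suc n) x" if "x < n" for x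
  proof -
    consider "x = u" | "x = w" | "x = v" | "x \<noteq> u" "x \<noteq> v" "x \<noteq> w" by blast
    then show ?thesis
      using that lt' ne adj adj' by cases (simp_all add: L4_def tr adj3 adj2 t)
  qed
  moreover have "loop L4 i = loop L i" if "i < n" for i
    using that lt' loop by (cases "i = v") (simp_all add: L4_def tr loop3 loop2)
  moreover have "loop L4 n \<noteq> loop L4 (Suc n)"
    using lt' loop by (simp add: L4_def tr loop3 loop2)
  moreover have "nv L4 = Suc (Suc n)" by (simp add: L4_def nv3)
  ultimately have "Omega2 (toggle_triangle u v w L) L4"
    using adj4 by (simp add: Omega2_def looped_extends_def n_def[symmetric])
  then have R4: "R (toggle_triangle u v w L) L4" by (rule R_Omega2[OF L' L4])
  show "R L (toggle_triangle u v w L)"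
    using R_trans[OF L2 R1 R_trans[OF L3 R2 R_trans[OF L4 R_sym[OF R3] R_sym[OF R4]]]] .
qed

end

interpretation homotopy: looped_equivalence "equivclp looped_move"
proof
  show "equivclp looped_move L' L" if "equivclp looped_move L L'" for L L'
    using that by (rule equivclp_sym)
  show "equivclp looped_move L L''" if "equivclp looped_move L L'" "equivclp looped_move L' L''" for L L' L''
    using equivclp_trans[OF that] .
qed (auto intro!: r_into_equivclp simp: looped_move_def)

lemma homotopy_R3_Omega3: "homotopy.r3_ok False False True a True False"
proof (rule homotopy.r3_okI)
  fix L u v w
  assume *: "is_looped_graph L" "distinct [u, v, w]" "u < nv L" "v < nv L" "w < nv L"
    "even_on_triangle u v w L" "adj L u v = False" "adj L u w = False" "adj L v w = True"
      "loop L u = a" "loop L v = True" "loop L w = False"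
  have "Omega3 L (toggle_triangle u v w L)" unfolding Omega3_def
    using even_on_triangle_iff_card[OF *(1,2)] * toggle_triangle_def
    by (intro exI[of _ u] exI[of _ v] exI[of _ w]) simp
  then show "equivclp looped_move L (toggle_triangle u v w L)"
    using *(1) is_looped_toggle_triangle[OF *(1,2)] by (auto intro!: r_into_equivclp simp: looped_move_def)
qed

text \<open>Inversion leaves four adjacency patterns. Two of them are \<open>Omega3\<close> after a
  permutation of the triple. The unlooped and the edgeless pattern become \<open>Omega3\<close>, up
  to permutation and inversion, after one switch at \<open>v\<close>.\<close>

lemma homotopy_R3_type:
  assumes "is_looped_graph L" "distinct [u, v, w]" "u < nv L" "v < nv L" "w < nv L" "even_on_triangle u v w L"
    and type: "R3_type u v w L"
  shows "equivclp looped_move L (toggle_triangle u v w L)"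
proof -
  note inv = homotopy.r3_ok_inverse and vw = homotopy.r3_ok_swap_vw and uv = homotopy.r3_ok_swap_uv
    and switch = homotopy.r3_ok_switch and base = homotopy_R3_Omega3
  have 1: "homotopy.r3_ok False True False True True False"
    by (rule uv) (rule base)
  have 2: "homotopy.r3_ok True False False True False True"
    by (rule vw) (rule 1)
  have 3: "homotopy.r3_ok False False True False False False"
    by (rule switch, simp, rule uv, rule vw, rule uv) (rule base)
  have 4: "homotopy.r3_ok False False False False True True"
    by (rule switch, simp, rule inv, simp, rule vw, rule uv, rule vw, rule uv) (rule base)
  have "homotopy.r3_ok p q m (p \<noteq> q) (p = m) (q = m)" for p q m
    using 1 2 3 4 inv[of True True True] inv[of True True False] inv[of True False True] inv[of
      False True True]
    by (cases p; cases q; cases m) simp_all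
  then have "homotopy.r3_ok (adj L u v) (adj L u w) (adj L v w) (loop L u) (loop L v) (loop L w)"
    using type unfolding R3_type_def by simp
  then show ?thesis using assms by (intro homotopy.r3_okD)
qed

section \<open>Lifting the third move to labeled graphs\<close>

definition preimages_equiv :: "looped_graph \<Rightarrow> looped_graph \<Rightarrow> bool" where
  "preimages_equiv L L' \<longleftrightarrow> (\<forall>G d G' d'. inverse_pair G L d \<longrightarrow> inverse_pair G' L' d' \<longrightarrow> equivclp graph_move G G')"

text \<open>All preimages of one looped graph are connected by
  \<open>inverse_pair_diag_equiv\<close>, so a single connected pair settles the
  quantifiers.\<close>

lemma preimages_equivI:
  assumes "inverse_pair G L d" "inverse_pair G' L' d'" "equivclp graph_move G G'"
  shows "preimages_equiv L L'"
  unfolding preimages_equiv_def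
  using assms inverse_pair_diag_equiv by (meson equivclp_trans)

lemma preimages_equiv_iso:
  assumes L: "is_looped_graph L" "is_looped_graph L'" and iso: "looped_iso L L'"
  shows "preimages_equiv L L'"
proof -
  obtain f where f: "bij_betw f {..<nv L} {..<nv L'}"
    "\<And>i j. i < nv L \<Longrightarrow> j < nv L \<Longrightarrow> adj L' (f i) (f j) \<longleftrightarrow> adj L i j"
    "\<And>i. i < nv L \<Longrightarrow> loop L' (f i) \<longleftrightarrow> loop L i"
    using iso by (auto simp: looped_iso_def graph_iso_via_def)
  obtain G' d' where p: "inverse_pair G' L' d'" using ex_inverse_pair[OF L(2)] by blast
  note 1 = inverse_pairD[OF p]
  have nv: "nv L = nv L'" using bij_betw_same_card[OF f(1)] by simp
  have fG: "bij_betw f {..<nv G'} {..<nv G'}" using f(1) nv 1(3) by simp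
  have p': "inverse_pair (permute_labeled f G') L (\<lambda>i. d' (f i))"
    by (rule inverse_pair_cong[OF inverse_pair_permute[OF p fG]])
      (use L(1) nv 1(3) f is_labeled_permute[OF fG 1(1)] inverse_pairD(6)[OF inverse_pair_permute[OF p fG]]
        in \<open>auto simp: diag_adj_def with_diag_def\<close>)
  have "graph_move (permute_labeled f G') G'"
    using graph_move_iso[OF is_labeled_permute[OF fG 1(1)] 1(1) labeled_iso_permute[OF fG]] .
  then show ?thesis using preimages_equivI[OF p' p] by blast
qed

interpretation preimages: looped_equivalence preimages_equiv
proof
  show "preimages_equiv L' L" if "preimages_equiv L L'" for L L'
    using that unfolding preimages_equiv_def by (meson equivclp_sym)
  show "preimages_equiv L L''" if "is_looped_graph L'" "preimages_equiv L L'"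
    "preimages_equiv L' L''" for L L' L''
    using that ex_inverse_pair[OF that(1)] unfolding preimages_equiv_def by (meson equivclp_trans)
  show "preimages_equiv L L'" if "is_looped_graph L" "is_looped_graph L'" "looped_iso L L'" for L L'
    using preimages_equiv_iso that .
  show "preimages_equiv L L'" if L: "is_looped_graph L" "is_looped_graph L'" "Omega2 L L'" for L L'
  proof -
    obtain G d where p: "inverse_pair G L d" using ex_inverse_pair[OF L(1)] by blast
    obtain G' d' where p': "Omega_g2 G G'" "inverse_pair G' L' d'"
      using Omega2_pair[OF p L(2,3)] by blast
    then have "graph_move G G'" using inverse_pairD(1)[OF p] inverse_pairD(1)[OF p'(2)]
      by (simp add: graph_move_def)
    then show ?thesis using preimages_equivI[OF p p'(2)] by blast
  qed
qed

lemma bit_add_self_left: "a + (a + b) = b" for a b :: bit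
  by simp

lemma symmetric_on_quadratic:
  assumes "finite S" "symmetric_on S N"
  shows "(\<Sum>i\<in>S. x i * (\<Sum>j\<in>S. N i j * y j)) = (\<Sum>j\<in>S. y j * (\<Sum>i\<in>S. N j i * x i))"
proof -
  have "(\<Sum>i\<in>S. x i * (\<Sum>j\<in>S. N i j * y j)) = (\<Sum>j\<in>S. \<Sum>i\<in>S. x i * (N i j * y j))"
    unfolding sum_distrib_left by (rule sum.swap)
  also have "\<dots> = (\<Sum>j\<in>S. \<Sum>i\<in>S. y j * (N j i * x i))"
    using assms(2) by (intro sum.cong) (auto simp: symmetric_on_def ac_simps)
  finally show ?thesis by (simp only: sum_distrib_left)
qed

lemma sum_split3:
  fixes f :: "nat \<Rightarrow> bit"
  assumes "distinct [u, v, w]" "u < n" "v < n" "w < n"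
  shows "(\<Sum>k<n. f k) = f u + f v + f w + (\<Sum>k\<in>{..<n} - {u, v, w}. f k)"
proof -
  have "(\<Sum>k<n. f k) = (\<Sum>k\<in>{..<n} - {u, v, w}. f k) + (\<Sum>k\<in>{u, v, w}. f k)"
    using assms by (intro sum.subset_diff) auto
  then show ?thesis using assms(1) by (simp add: add.assoc add.commute)
qed

text \<open>For \<open>N = diag_adj L d\<close> restricted to the complement \<open>T\<close> of \<open>{u, v, w}\<close>, the vectors \<open>y\<close> and \<open>z\<close> are
  \<open>N\<^sup>-\<^sup>1\<close> applied to the columns of \<open>v\<close> and \<open>w\<close>. The components of \<open>schur3\<close> are the
  off-diagonal entries of the Schur complement of \<open>N\<close> with respect to \<open>T\<close>.\<close>

definition solves3 :: "looped_graph \<Rightarrow> nat \<Rightarrow> nat \<Rightarrow> nat \<Rightarrow> (nat \<Rightarrow> bit) \<Rightarrow> (nat \<Rightarrow> bit) \<Rightarrow> (nat \<Rightarrow> bit) \<Rightarrow> bool" where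
  "solves3 L u v w d y z \<longleftrightarrow> (let T = {..<nv L} - {u, v, w} in
     nonsingular_on T (diag_adj L d) \<and> (\<forall>i\<in>T. (\<Sum>j\<in>T. diag_adj L d i j * y j) = of_bool (adj L i v)) \<and>
       (\<forall>i\<in>T. (\<Sum>j\<in>T. diag_adj L d i j * z j) = of_bool (adj L i w)))"

definition schur3 :: "looped_graph \<Rightarrow> nat \<Rightarrow> nat \<Rightarrow> nat \<Rightarrow> (nat \<Rightarrow> bit) \<Rightarrow> (nat \<Rightarrow> bit) \<Rightarrow> bit \<times> bit \<times> bit" where
  "schur3 L u v w y z = (let T = {..<nv L} - {u, v, w};
       a = (\<Sum>j\<in>T. of_bool (adj L j v) * y j); b = (\<Sum>j\<in>T. of_bool (adj L j w) * z j);
       g = (\<Sum>j\<in>T. of_bool (adj L j v) * z j) in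
     (of_bool (adj L u v) + a + g, of_bool (adj L u w) + b + g, of_bool (adj L v w) + g))"

text \<open>The block of A(G) + E that \<open>Omega_g3\<close> needs has rows 111, 110, 101. Its
  inverse, the Schur complement, has rows 111, 101, 110: the off-diagonal ones are the hypothesis,
  and the diagonal 1, 0, 0 is arranged by \<open>d\<close>. The same \<open>d\<close> turns the
  loops of \<open>R3_type\<close> into the required negative signs.\<close>

lemma preimages_R3_schur1:
  assumes L: "is_looped_graph L" and uvw: "distinct [u, v, w]" "u < nv L" "v < nv L" "w < nv L"
    and even: "even_on_triangle u v w L" and type: "R3_type u v w L"
    and sol: "solves3 L u v w d0 y z" and schur: "schur3 L u v w y z = (1, 1, 1)"
  shows "preimages_equiv L (toggle_triangle u v w L)"
proof -
  define n where "n = nv L"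
  define T where "T = {..<n} - {u, v, w}"
  note Ls = is_looped_graphD[OF L]
  have ne: "u \<noteq> v" "u \<noteq> w" "v \<noteq> w" "v \<noteq> u" "w \<noteq> u" "w \<noteq> v" using uvw(1) by auto
  have lt: "u < n" "v < n" "w < n" using uvw n_def by auto
  have T: "i < n" "i \<noteq> u" "i \<noteq> v" "i \<noteq> w" if "i \<in> T" for i using that by (auto simp: T_def)
  have finT: "finite T" by (simp add: T_def)
  define cv cw :: "nat \<Rightarrow> bit" where "cv j = of_bool (adj L j v)" and "cw j = of_bool (adj L j w)" for j
  define p q m :: bit where "p = of_bool (adj L u v)" and "q = of_bool (adj L u w)" and
    "m = of_bool (adj L v w)"
  define a b g where "a = (\<Sum>j\<in>T. cv j * y j)" and "b = (\<Sum>j\<in>T. cw j * z j)" and "g = (\<Sum>j\<in>T. cv j * z j)"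
  have ns: "nonsingular_on T (diag_adj L d0)"
    and y: "\<And>i. i \<in> T \<Longrightarrow> (\<Sum>j\<in>T. diag_adj L d0 i j * y j) = cv i"
    and z: "\<And>i. i \<in> T \<Longrightarrow> (\<Sum>j\<in>T. diag_adj L d0 i j * z j) = cw i"
    using sol by (auto simp: solves3_def Let_def T_def n_def cv_def cw_def)
  have rel: "p + a + g = 1" "q + b + g = 1" "m + g = 1"
    using schur by (simp_all add: schur3_def Let_def p_def q_def m_def a_def b_def g_def T_def n_def
      cv_def cw_def)
  \<comment> \<open>By \<open>rel\<close>, these values satisfy d u + a + b = 1, d v + a = 0 and d w
    + b = 0, which is the wanted diagonal of the Schur complement.\<close>
  define d where "d = d0(u := 1 + p + q, v := p + m, w := q + m)"
  have lmT: "diag_adj L d i j = diag_adj L d0 i j" if "i \<in> T" "j \<in> T" for i j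
    using that by (auto simp: diag_adj_def with_diag_def d_def T_def)
  have g': "(\<Sum>j\<in>T. cw j * y j) = g"
  proof -
    have "(\<Sum>j\<in>T. cw j * y j) = (\<Sum>i\<in>T. y i * (\<Sum>j\<in>T. diag_adj L d0 i j * z j))"
      using z by (intro sum.cong) auto
    also have "\<dots> = (\<Sum>i\<in>T. z i * (\<Sum>j\<in>T. diag_adj L d0 i j * y j))"
      using symmetric_on_diag_adj[OF L, of d0]
        by (intro symmetric_on_quadratic[OF finT]) (auto simp: symmetric_on_def T_def n_def)
    also have "\<dots> = g" unfolding g_def using y by (intro sum.cong) auto
    finally show ?thesis .
  qed
  have sym: "adj L i j = adj L j i" if "i < n" "j < n" for i j using Ls(2) that n_def by simp
  have cu: "of_bool (adj L i u) = cv i + cw i" if "i \<in> T" for i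
  proof -
    have "(adj L i u \<noteq> adj L i v) = adj L i w"
      using even T[OF that] by (simp add: even_on_triangle_def n_def)
    then show ?thesis by (auto simp: cv_def cw_def of_bool_def)
  qed
  have rowT: "diag_adj L d i u = cv i + cw i" "diag_adj L d i v = cv i" "diag_adj L d i w = cw i" if
    "i \<in> T" for i
    using T[OF that] cu[OF that] by (simp_all add: diag_adj_def with_diag_def cv_def cw_def)
  have colT: "diag_adj L d u i = cv i + cw i" "diag_adj L d v i = cv i" "diag_adj L d w i = cw i" if
    "i \<in> T" for i
    using T[OF that] rowT[OF that] lt symmetric_on_diag_adj[OF L, of d] by (auto simp: symmetric_on_def n_def)
  have blk: "diag_adj L d u u = 1 + p + q" "diag_adj L d v v = p + m" "diag_adj L d w w = q + m"
    "diag_adj L d u v = p" "diag_adj L d v u = p"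
    "diag_adj L d u w = q" "diag_adj L d w u = q" "diag_adj L d v w = m" "diag_adj L d w v = m"
    using ne sym[of v u] sym[of w u] sym[of w v] lt
    by (simp_all add: diag_adj_def with_diag_def d_def p_def q_def m_def)
  have mul: "(\<Sum>k<n. diag_adj L d i k * x k) = diag_adj L d i u * x u + diag_adj L d i v * x v +
    diag_adj L d i w * x w + (\<Sum>k\<in>T. diag_adj L d i k * x k)" for i x
    unfolding T_def by (rule sum_split3[OF uvw(1) lt])
  \<comment> \<open>The intended columns \<open>u\<close>, \<open>v\<close>, \<open>w\<close> of
    A(G) + E. Outside the triple they solve for the columns of \<open>N\<close> combined as in the
    block: column \<open>v\<close> uses \<open>u\<close> plus \<open>v\<close>, which is
    \<open>w\<close> by parity and gives \<open>z\<close>; column \<open>w\<close> gives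
    \<open>y\<close>, and column \<open>u\<close> gives 0.\<close>
  define Xu Xv Xw :: "nat \<Rightarrow> bit"
    where "Xu k = of_bool (k \<in> {u, v, w})"
      and "Xv k = (if k = u \<or> k = v then 1 else if k = w then 0 else z k)"
      and "Xw k = (if k = u \<or> k = w then 1 else if k = v then 0 else y k)" for k
  have Xval: "Xu u = 1" "Xu v = 1" "Xu w = 1" "Xv u = 1" "Xv v = 1" "Xv w = 0" "Xw u = 1" "Xw v = 0"
    "Xw w = 1"
    using ne by (simp_all add: Xu_def Xv_def Xw_def)
  have sumT: "(\<Sum>k\<in>T. f k * Xu k) = 0" "(\<Sum>k\<in>T. f k * Xv k) = (\<Sum>k\<in>T. f k * z k)"
    "(\<Sum>k\<in>T. f k * Xw k) = (\<Sum>k\<in>T. f k * y k)" for f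
    using T by (auto simp: Xu_def Xv_def Xw_def intro!: sum.cong sum.neutral)
  have sums: "(\<Sum>k\<in>T. diag_adj L d u k * z k) = g + b" "(\<Sum>k\<in>T. diag_adj L d v k * z k) = g"
    "(\<Sum>k\<in>T. diag_adj L d w k * z k) = b"
    "(\<Sum>k\<in>T. diag_adj L d u k * y k) = a + g" "(\<Sum>k\<in>T. diag_adj L d v k * y k) = a"
      "(\<Sum>k\<in>T. diag_adj L d w k * y k) = g"
  proof -
    have *: "(\<Sum>k\<in>T. diag_adj L d i k * x k) = (\<Sum>k\<in>T. c k * x k)" if
      "\<And>k. k \<in> T \<Longrightarrow> diag_adj L d i k = c k" for i x c
      using that by (intro sum.cong) auto
    show "(\<Sum>k\<in>T. diag_adj L d u k * z k) = g + b" "(\<Sum>k\<in>T. diag_adj L d v k * z k) = g"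
      "(\<Sum>k\<in>T. diag_adj L d w k * z k) = b"
    "(\<Sum>k\<in>T. diag_adj L d u k * y k) = a + g" "(\<Sum>k\<in>T. diag_adj L d v k * y k) = a"
      "(\<Sum>k\<in>T. diag_adj L d w k * y k) = g"
      using *[OF colT(1)] *[OF colT(2)] *[OF colT(3)] g'
      by (simp_all add: a_def b_def g_def distrib_right sum.distrib)
  qed
  have rowsT: "(\<Sum>k\<in>T. diag_adj L d i k * z k) = cw i" "(\<Sum>k\<in>T. diag_adj L d i k * y k) = cv i" if "i \<in> T" for i
    using y[OF that] z[OF that] lmT[OF that] by (auto cong: sum.cong)
  have rel': "p + a = m" "q + b = m" "g = m + 1"
    using rel by (cases p; cases a; cases g; cases q; cases b; cases m; simp)+
  have cases4: "i = u \<or> i = v \<or> i = w \<or> i \<in> T" if "i < n" for i using that by (auto simp: T_def)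
  have NX: "(\<Sum>k<n. diag_adj L d i k * Xu k) = of_bool (i = u)"
    "(\<Sum>k<n. diag_adj L d i k * Xv k) = of_bool (i = v)"
    "(\<Sum>k<n. diag_adj L d i k * Xw k) = of_bool (i = w)" if "i < n" for i
  proof -
    have ab: "a = p + m" "b = q + m"
      by (simp only: rel'(1)[symmetric] bit_add_self_left) (simp only: rel'(2)[symmetric] bit_add_self_left)
    note simps = mul Xval sumT sums blk rowT rowsT ab rel'(3) add.assoc add.commute add.left_commute
    show "(\<Sum>k<n. diag_adj L d i k * Xu k) = of_bool (i = u)"
      using cases4[OF that] by (elim disjE) (use ne T in \<open>auto simp: simps\<close>)
    show "(\<Sum>k<n. diag_adj L d i k * Xv k) = of_bool (i = v)"
      using cases4[OF that] by (elim disjE) (use ne T in \<open>auto simp: simps\<close>)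
    show "(\<Sum>k<n. diag_adj L d i k * Xw k) = of_bool (i = w)"
      using cases4[OF that] by (elim disjE) (use ne T in \<open>auto simp: simps\<close>)
  qed
  \<comment> \<open>The kernel of a symmetric matrix is orthogonal to its image. As e_u, e_v, e_w
    are in the image, a kernel vector vanishes on the triple, and nonsingularity on \<open>T\<close>
    finishes.\<close>
  have ortho: "x i = 0" if X: "\<And>k. k < n \<Longrightarrow> (\<Sum>l<n. diag_adj L d k l * X l) = of_bool (k = i)"
    and x: "\<And>k. k < n \<Longrightarrow> (\<Sum>l<n. diag_adj L d k l * x l) = 0" and i: "i < n" for X x i
  proof -
    have "x i = (\<Sum>k<n. x k * (\<Sum>l<n. diag_adj L d k l * X l))"
      using X i by simp
    also have "\<dots> = (\<Sum>l<n. X l * (\<Sum>k<n. diag_adj L d l k * x k))"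
      using symmetric_on_diag_adj[OF L, of d] by (intro symmetric_on_quadratic) (auto simp: n_def)
    also have "\<dots> = 0" using x by (intro sum.neutral) auto
    finally show ?thesis .
  qed
  have nonsingular_on: "nonsingular_on {..<n} (diag_adj L d)"
    unfolding nonsingular_on_def
  proof (intro allI impI ballI)
    fix x i assume x: "\<forall>i\<in>{..<n}. (\<Sum>j\<in>{..<n}. diag_adj L d i j * x j) = 0" and i: "i \<in> {..<n}"
    have x3: "x u = 0" "x v = 0" "x w = 0"
      using ortho[OF NX(1), of x] ortho[OF NX(2), of x] ortho[OF NX(3), of x] x lt by blast+
    have "(\<Sum>j\<in>T. diag_adj L d0 k j * x j) = 0" if "k \<in> T" for k
    proof -
      have "(\<Sum>j\<in>T. diag_adj L d0 k j * x j) = (\<Sum>j\<in>T. diag_adj L d k j * x j)"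
        using lmT[OF that] by (intro sum.cong) auto
      also have "\<dots> = (\<Sum>j<n. diag_adj L d k j * x j)" by (simp add: mul x3)
      finally show ?thesis using x T[OF that] by auto
    qed
    then have "x j = 0" if "j \<in> T" for j using nonsingular_onD[OF ns, of x] that by blast
    then show "x i = 0" using x3 cases4[of i] i by auto
  qed
  obtain G where p: "inverse_pair G L d" using inverse_pair_of_diag[OF L] nonsingular_on n_def by blast
  note 1 = inverse_pairD[OF p]
  have nG: "nv G = n" using 1(3) n_def by simp
  have shifted_adj: "shifted_adj G i k = X i" if
    "\<And>l. l < n \<Longrightarrow> (\<Sum>j<n. diag_adj L d l j * X j) = of_bool (l = k)" "i < n" "k < n" for i k X
  proof -
    have "X i = (\<Sum>l<n. shifted_adj G i l * (\<Sum>j<n. diag_adj L d l j * X j))"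
      using inverse_on_apply[OF 1(5), of i X] that(2) nG by simp
    also have "\<dots> = (\<Sum>l<n. shifted_adj G i l * of_bool (l = k))"
      using that(1) by (intro sum.cong) auto
    finally show ?thesis using that(3) by simp
  qed
  have gu: "shifted_adj G i u = Xu i" and gv: "shifted_adj G i v = Xv i" and gw:
    "shifted_adj G i w = Xw i" if "i < n" for i
    using shifted_adj[OF NX(1)] shifted_adj[OF NX(2)] shifted_adj[OF NX(3)] that lt by blast+
  have framing: "framing G x = 0" if "x \<in> {u, v, w}" for x
    using that gu[OF lt(1)] gv[OF lt(2)] gw[OF lt(3)] Xval by (auto simp: framing_eq_shifted_adj)
  have "vsign G x = -1" if "x \<in> {u, v, w}" for x
  proof -
    have "loop L x \<longleftrightarrow> d x = 0"
      using that type ne sym lt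
      by (auto simp: R3_type_def d_def p_def q_def m_def of_bool_def)
    then show ?thesis using that 1(6)[of x] is_labeled_graphD(3)[OF 1(1), of x] lt nG
      by (auto split: if_splits)
  qed
  with framing have lab: "framing G x = 0 \<and> vsign G x = -1" if "x \<in> {u, v, w}" for x using that by blast
  have "adj G u t \<longleftrightarrow> t = v \<or> t = w" if "t < n" for t
  proof -
    have "adj G u t = adj G t u" using is_labeled_graphD(2)[OF 1(1)] that lt nG by simp
    then show ?thesis
      using gu[OF that] is_labeled_graphD(1)[OF 1(1), of u] lt nG ne
      by (cases "t = u") (auto simp: shifted_adj_def Xu_def)
  qed
  then have N: "nbhd G u = {v, w}" using lt nG by (auto simp: nbhd_def)
  have avw: "\<not> adj G v w" using gw[OF lt(2)] Xval ne by (simp add: shifted_adj_def)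
  have lt'': "u < nv G" "v < nv G" "w < nv G" using lt nG by auto
  define G' where "G' = Omega_g3_result u v w G"
  have g3: "is_labeled_graph G'"
    "inverse_pair (permute_labeled (Transposition.transpose v w) G') (toggle_triangle u v w L) (d(v
      := d v + 1, w := d w + 1))"
    unfolding G'_def
    by (rule Omega_g3_labeled[OF p uvw(1) lt'' _ N avw] Omega_g3_pair[OF p uvw(1) lt'' _ N avw],
      rule lab, assumption)+
  have "Omega_g3 G G'" unfolding Omega_g3_def
    using lt'' uvw(1) lab N avw
    by (intro exI[of _ u] exI[of _ v] exI[of _ w]) (simp add: G'_def Omega_g3_result_def)
  then have m1: "graph_move G G'" using 1(1) g3(1) by (simp add: graph_move_def)
  have "bij_betw (Transposition.transpose v w) {..<nv G'} {..<nv G'}"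
    using lt'' by (intro bij_betw_transpose) (simp_all add: G'_def Omega_g3_result_def)
  then have m2: "graph_move (permute_labeled (Transposition.transpose v w) G') G'"
    using graph_move_iso[OF inverse_pairD(1)[OF g3(2)] g3(1) labeled_iso_permute] by blast
  have "equivclp graph_move G (permute_labeled (Transposition.transpose v w) G')"
    using equivclp_move[of graph_move, OF m1 equivclp_sym[OF r_into_equivclp[of graph_move, OF m2]]] .
  then show ?thesis by (rule preimages_equivI[OF p g3(2)])
qed

text \<open>Toggling the triangle adds 1 to each off-diagonal entry of the Schur complement and does
  not touch the part outside. For c = 0 the toggled graph is thus in the situation c = 1, and the
  equivalence is symmetric.\<close>

lemma preimages_R3_schur:
  assumes L: "is_looped_graph L" and uvw: "distinct [u, v, w]" "u < nv L" "v < nv L" "w < nv L"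
    and even: "even_on_triangle u v w L" and type: "R3_type u v w L"
    and sol: "solves3 L u v w d y z" and schur: "schur3 L u v w y z = (c, c, c)"
  shows "preimages_equiv L (toggle_triangle u v w L)"
proof (cases "c = 1")
  case True
  then show ?thesis using preimages_R3_schur1[OF assms(1-7) sol] schur by simp
next
  case False
  then have 0: "c = 0" by simp
  let ?L = "toggle_triangle u v w L"
  have diag_adj: "diag_adj ?L d i j = diag_adj L d i j" if "i \<notin> {u, v, w}" for i j
    using that by (simp add: diag_adj_def with_diag_def adj_toggle_triangle[OF uvw(1)])
  have aT: "adj ?L i j = adj L i j" if "i \<notin> {u, v, w}" for i j
    using that by (simp add: adj_toggle_triangle[OF uvw(1)])
  have sol': "solves3 ?L u v w d y z"
    using sol unfolding solves3_def by (auto simp: Let_def diag_adj aT elim!: nonsingular_on_cong[rotated])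
  have schur': "schur3 ?L u v w y z = (1, 1, 1)"
  proof -
    let ?T = "{..<nv L} - {u, v, w}"
    have S: "(\<Sum>j\<in>?T. of_bool (adj ?L j x) * t j) = (\<Sum>j\<in>?T. of_bool (adj L j x) * t j)"
      for x and t :: "nat \<Rightarrow> bit"
      using aT by (intro sum.cong) auto
    have "of_bool (adj ?L u v) = (of_bool (adj L u v) + 1 :: bit)"
      "of_bool (adj ?L u w) = (of_bool (adj L u w) + 1 :: bit)"
      "of_bool (adj ?L v w) = (of_bool (adj L v w) + 1 :: bit)"
      using uvw(1) by (simp_all add: adj_toggle_triangle of_bool_def)
    moreover have "x + a + g = 0 \<Longrightarrow> x + 1 + a + g = 1" "x + g = 0 \<Longrightarrow> x + 1 + g = 1" for x a g :: bit
      by (simp_all add: add.assoc add.left_commute[of x 1])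
    ultimately show ?thesis
      using schur 0 unfolding schur3_def Let_def toggle_triangle_sel(1) S by simp
  qed
  have "R3_type u v w ?L" using type uvw(1) by (auto simp: R3_type_def adj_toggle_triangle)
  then have "preimages_equiv ?L (toggle_triangle u v w ?L)"
    using preimages_R3_schur1[OF is_looped_toggle_triangle[OF L uvw(1)] uvw(1) _ _ _ _ _ sol' schur'] even uvw
    by (simp add: even_on_triangle_toggle_triangle)
  then show ?thesis using preimages.R_sym by simp
qed

section \<open>Adjusting the Schur complement\<close>

text \<open>If \<open>W\<close> consists of two of \<open>u, v, w\<close>, adding the pair changes exactly one entry of the Schur complement.\<close>

definition add_pair :: "looped_graph \<Rightarrow> nat set \<Rightarrow> looped_graph" where
  "add_pair L W = \<lparr>nv = nv L + 2, adj = (\<lambda>i j. if i < nv L then if j < nv L then adj L i j else i \<in> W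
      else if j < nv L then j \<in> W else i \<noteq> j),
    loop = (\<lambda>i. if i < nv L then loop L i else i = nv L)\<rparr>"

lemma add_pair:
  assumes "is_looped_graph L"
  shows is_looped_add_pair: "is_looped_graph (add_pair L W)" and Omega2_add_pair: "Omega2 L (add_pair L W)"
proof -
  show "is_looped_graph (add_pair L W)"
    by (rule is_looped_graphI) (use is_looped_graphD[OF assms] in \<open>auto simp: add_pair_def split: if_splits\<close>)
  show "Omega2 L (add_pair L W)" by (auto simp: Omega2_def looped_extends_def add_pair_def Let_def)
qed

lemma toggle_triangle_add_pair:
  assumes "distinct [u, v, w]" "u < nv L" "v < nv L" "w < nv L"
  shows "toggle_triangle u v w (add_pair L W) = add_pair (toggle_triangle u v w L) W"
proof -
  have "adj (toggle_triangle u v w (add_pair L W)) = adj (add_pair (toggle_triangle u v w L) W)"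
    by (intro ext) (use assms(2-) in \<open>auto simp: adj_toggle_triangle[OF assms(1)] add_pair_def\<close>)
  then show ?thesis by (simp add: add_pair_def toggle_triangle_def toggle_def)
qed

text \<open>With diagonal 1, 0 the pair has the block with rows 11, 10, whose inverse maps (r, r) to
  (r, 0); this gives the extended solutions. The Schur complement changes by the products r_i r_j of
  the indicator of \<open>W\<close>, where r_u = r_v + r_w for \<open>W\<close> of even
  size.\<close>

lemma solves3_add_pair:
  assumes uvw: "distinct [u, v, w]" "u < nv L" "v < nv L" "w < nv L"
    and W: "W \<subseteq> {u, v, w}" and n: "n = nv L"
    and sol: "solves3 L u v w d y z" and schur: "schur3 L u v w y z = (\<alpha>, \<beta>, \<gamma>)"
    and r: "rv = of_bool (v \<in> W)" "rw = of_bool (w \<in> W)"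
  shows "solves3 (add_pair L W) u v w (d(n := 1, Suc n := 0)) (y(n := rv, Suc n := 0)) (z(n := rw,
    Suc n := 0))"
    and "schur3 (add_pair L W) u v w (y(n := rv, Suc n := 0)) (z(n := rw, Suc n := 0))
      = (\<alpha> + rv + rv * rw, \<beta> + rw + rv * rw, \<gamma> + rv * rw)"
proof -
  let ?L = "add_pair L W" and ?d = "d(n := 1, Suc n := 0)"
  define T where "T = {..<n} - {u, v, w}"
  have lt: "u < n" "v < n" "w < n" using uvw n by auto
  have nv: "nv ?L = Suc (Suc n)" by (simp add: add_pair_def n)
  have T2: "{..<nv ?L} - {u, v, w} = insert n (insert (Suc n) T)"
    using lt by (auto simp: nv T_def)
  have fin: "finite T" "n \<notin> T" "Suc n \<notin> T" by (simp_all add: T_def)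
  have Ti: "i < n" "i \<notin> W" "i \<noteq> n" "i \<noteq> Suc n" if "i \<in> T" for i using that W by (auto simp: T_def)
  have S2: "(\<Sum>j\<in>insert n (insert (Suc n) T). f j) = f n + (f (Suc n) + (\<Sum>j\<in>T. f j))" for f :: "nat \<Rightarrow> bit"
    using fin by simp
  have diag_adj: "diag_adj ?L ?d i j = diag_adj L d i j" "diag_adj ?L ?d i n = 0"
    "diag_adj ?L ?d i (Suc n) = 0" "diag_adj ?L ?d n i = 0" "diag_adj ?L ?d (Suc n) i = 0"
    if "i \<in> T" "j \<in> T" for i j
    using Ti[OF that(1)] Ti[OF that(2)] by (simp_all add: diag_adj_def with_diag_def add_pair_def
      n[symmetric])
  have lmn: "diag_adj ?L ?d n n = 1" "diag_adj ?L ?d n (Suc n) = 1" "diag_adj ?L ?d (Suc n) n = 1"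
    "diag_adj ?L ?d (Suc n) (Suc n) = 0"
    by (simp_all add: diag_adj_def with_diag_def add_pair_def n[symmetric])
  have adj: "adj ?L i x \<longleftrightarrow> adj L i x" if "i \<in> T" "x < n" for i x
    using Ti[OF that(1)] that(2) by (simp add: add_pair_def n)
  have adjn: "adj ?L n v \<longleftrightarrow> v \<in> W" "adj ?L n w \<longleftrightarrow> w \<in> W" "adj ?L (Suc n) v \<longleftrightarrow> v \<in> W" "adj ?L (Suc n) w \<longleftrightarrow> w \<in> W"
    using lt by (simp_all add: add_pair_def n)
  have adj3: "adj ?L u v = adj L u v" "adj ?L u w = adj L u w" "adj ?L v w = adj L v w"
    using lt by (simp_all add: add_pair_def n)
  have ns: "nonsingular_on T (diag_adj L d)"
    and y: "\<And>i. i \<in> T \<Longrightarrow> (\<Sum>j\<in>T. diag_adj L d i j * y j) = of_bool (adj L i v)"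
    and z: "\<And>i. i \<in> T \<Longrightarrow> (\<Sum>j\<in>T. diag_adj L d i j * z j) = of_bool (adj L i w)"
    using sol by (auto simp: solves3_def Let_def T_def n)
  have ST: "(\<Sum>j\<in>T. diag_adj ?L ?d i j * x j) = (\<Sum>j\<in>T. diag_adj L d i j * x j)" if "i \<in> T" for i x
    using diag_adj(1)[OF that] by (intro sum.cong) auto
  have Sn: "(\<Sum>j\<in>T. diag_adj ?L ?d n j * x j) = 0" "(\<Sum>j\<in>T. diag_adj ?L ?d (Suc n) j * x j) = 0" for x
    using diag_adj(4,5) by (auto intro!: sum.neutral)
  have Supd: "(\<Sum>j\<in>T. f j * (x(n := a, Suc n := b)) j) = (\<Sum>j\<in>T. f j * x j)" for f x :: "nat \<Rightarrow> bit" and a b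
    using Ti by (intro sum.cong) auto
  have "nonsingular_on (insert n (insert (Suc n) T)) (diag_adj ?L ?d)"
    unfolding nonsingular_on_def
  proof (intro allI impI)
    fix x assume x: "\<forall>i\<in>insert n (insert (Suc n) T). (\<Sum>j\<in>insert n (insert (Suc n) T). diag_adj ?L ?d
      i j * x j) = 0"
    have "x n + x (Suc n) = 0" "x n = 0"
      using bspec[OF x, of n] bspec[OF x, of "Suc n"] by (simp_all add: S2 lmn Sn)
    then have x2: "x n = 0" "x (Suc n) = 0" by simp_all
    have "(\<Sum>j\<in>T. diag_adj L d i j * x j) = 0" if "i \<in> T" for i
      using bspec[OF x, of i] that by (simp add: S2 x2 ST)
    then show "\<forall>i\<in>insert n (insert (Suc n) T). x i = 0"
      using x2 nonsingular_onD[OF ns, of x] by blast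
  qed
  moreover have "(\<Sum>j\<in>insert n (insert (Suc n) T). diag_adj ?L ?d i j * (t(n := r', Suc n := 0)) j)
      = (if i \<in> T then \<Sum>j\<in>T. diag_adj L d i j * t j else r')" if "i \<in> insert n (insert (Suc n) T)" for i t r'
    using that fin unfolding S2 Supd by (auto simp: lmn Sn ST diag_adj)
  ultimately show "solves3 ?L u v w ?d (y(n := rv, Suc n := 0)) (z(n := rw, Suc n := 0))"
    unfolding solves3_def T2 Let_def using y z adjn r adj lt fin by auto
  have SA: "(\<Sum>j\<in>T. of_bool (adj ?L j x) * t j) = (\<Sum>j\<in>T. of_bool (adj L j x) * t j)" if "x < n"
    for x and t :: "nat \<Rightarrow> bit"
    using adj[OF _ that] by (intro sum.cong) auto
  show "schur3 ?L u v w (y(n := rv, Suc n := 0)) (z(n := rw, Suc n := 0))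
      = (\<alpha> + rv + rv * rw, \<beta> + rw + rv * rw, \<gamma> + rv * rw)"
    using schur unfolding schur3_def T2 Let_def S2 Supd adj3 SA[OF lt(2)] SA[OF lt(3)]
      T_def[symmetric] n[symmetric]
    by (auto simp: adjn r of_bool_def)
qed

lemma preimages_R3_type:
  assumes L: "is_looped_graph L" and uvw: "distinct [u, v, w]" "u < nv L" "v < nv L" "w < nv L"
    and even: "even_on_triangle u v w L" and type: "R3_type u v w L"
  shows "preimages_equiv L (toggle_triangle u v w L)"
proof -
  define T where "T = {..<nv L} - {u, v, w}"
  have fin: "finite T" by (simp add: T_def)
  have "symmetric_on T (\<lambda>i j. of_bool (adj L i j))"
    using is_looped_graphD(2)[OF L] by (simp add: symmetric_on_def T_def)
  then obtain d where d: "nonsingular_on T (diag_adj L d)"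
    unfolding diag_adj_def using ex_nonsingular_on_diag[OF fin] by blast
  obtain y where y: "\<forall>i\<in>T. (\<Sum>j\<in>T. diag_adj L d i j * y j) = of_bool (adj L i v)"
    using nonsingular_on_surj[OF fin d, of "\<lambda>i. of_bool (adj L i v)"] by blast
  obtain z where z: "\<forall>i\<in>T. (\<Sum>j\<in>T. diag_adj L d i j * z j) = of_bool (adj L i w)"
    using nonsingular_on_surj[OF fin d, of "\<lambda>i. of_bool (adj L i w)"] by blast
  have sol: "solves3 L u v w d y z" using d y z by (simp add: solves3_def T_def)
  obtain \<alpha> \<beta> \<gamma> where schur: "schur3 L u v w y z = (\<alpha>, \<beta>, \<gamma>)" by (metis surj_pair)
  show ?thesis
  proof (cases "\<alpha> = \<beta> \<and> \<beta> = \<gamma>")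
    case True
    then show ?thesis using preimages_R3_schur[OF assms sol] schur by blast
  next
    case False
    \<comment> \<open>\<open>W\<close> is the pair of vertices whose entry differs from the other
      two: {u, v} for \<alpha>, {u, w} for \<beta>, {v, w} for \<gamma>.\<close>
    define A B where "A \<longleftrightarrow> \<beta> \<noteq> \<gamma> \<longrightarrow> \<alpha> = \<beta>" and "B \<longleftrightarrow> \<beta> \<noteq> \<gamma>"
    define W where "W = {x. x = v \<and> A \<or> x = w \<and> B \<or> x = u \<and> A \<noteq> B}"
    define n where "n = nv L"
    let ?L = "add_pair L W"
    have ne: "u \<noteq> v" "u \<noteq> w" "v \<noteq> w" "v \<noteq> u" "w \<noteq> u" "w \<noteq> v" using uvw(1) by auto
    have W: "v \<in> W \<longleftrightarrow> A" "w \<in> W \<longleftrightarrow> B" "u \<in> W \<longleftrightarrow> A \<noteq> B" "W \<subseteq> {u, v, w}"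
      using ne by (auto simp: W_def)
    note sol' = solves3_add_pair[OF uvw W(4) n_def sol schur refl refl, unfolded W]
    have c: "(\<alpha> + of_bool A + of_bool A * of_bool B, \<beta> + of_bool B + of_bool A * of_bool B, \<gamma> +
      of_bool A * of_bool B)
        = (\<beta> + of_bool B + of_bool A * of_bool B, \<beta> + of_bool B + of_bool A * of_bool B, \<beta> + of_bool
          B + of_bool A * of_bool B)"
      using False unfolding A_def B_def by (cases \<alpha>; cases \<beta>; cases \<gamma>; simp)
    have even': "even_on_triangle u v w ?L" unfolding even_on_triangle_def
    proof (intro allI impI)
      fix x assume x: "x < nv ?L" "x \<notin> {u, v, w}"
      show "(adj ?L x u \<noteq> adj ?L x v) \<longleftrightarrow> adj ?L x w"
      proof (cases "x < nv L")
        case True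
        then show ?thesis using even x uvw by (simp add: even_on_triangle_def add_pair_def)
      next
        case False
        then show ?thesis using W uvw by (auto simp: add_pair_def)
      qed
    qed
    have type': "R3_type u v w ?L" using type uvw by (simp add: R3_type_def add_pair_def)
    note L2 = is_looped_add_pair[OF L, of W]
    have lt2: "u < nv ?L" "v < nv ?L" "w < nv ?L" using uvw by (simp_all add: add_pair_def)
    have R: "preimages_equiv ?L (toggle_triangle u v w ?L)"
      by (rule preimages_R3_schur[OF L2 uvw(1) lt2 even' type' sol'(1)])
        (use sol'(2) c in simp)
    note L3 = is_looped_toggle_triangle[OF L uvw(1)]
    have R1: "preimages_equiv L ?L" by (rule preimages.R_Omega2[OF L L2 Omega2_add_pair[OF L]])
    have R2: "preimages_equiv (toggle_triangle u v w L) (toggle_triangle u v w ?L)"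
      unfolding toggle_triangle_add_pair[OF uvw]
      by (rule preimages.R_Omega2[OF L3 is_looped_add_pair[OF L3] Omega2_add_pair[OF L3]])
    show ?thesis
      using preimages.R_trans[OF L2 R1 preimages.R_trans[OF is_looped_toggle_triangle[OF L2 uvw(1)]
        R preimages.R_sym[OF R2]]] .
  qed
qed

section \<open>Realisability\<close>

text \<open>Chord \<open>i\<close> belongs to vertex \<open>i\<close>, so no isomorphism remains,
  and the diagonal of \<open>a\<close> is ignored, so that a matrix may be inserted whatever its
  diagonal.\<close>

definition circle_graph :: "nat \<Rightarrow> (nat \<Rightarrow> nat \<Rightarrow> bool) \<Rightarrow> bool" where
  "circle_graph n a \<longleftrightarrow> (\<exists>c. is_chord_diagram \<lparr>nchords = n, chord = c\<rparr> \<and>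
     (\<forall>i<n. \<forall>j<n. i \<noteq> j \<longrightarrow> (a i j \<longleftrightarrow> linked (c i) (c j))))"

lemma circle_graph_cong:
  assumes "circle_graph n a" "\<And>i j. i < n \<Longrightarrow> j < n \<Longrightarrow> i \<noteq> j \<Longrightarrow> b i j = a i j"
  shows "circle_graph n b"
  using assms unfolding circle_graph_def by auto

lemma circle_graph_of_diagram:
  fixes D :: "'a chord_diagram_scheme" and H :: "'b graph_scheme" and G :: "'c graph_scheme"
  assumes D: "is_chord_diagram D" and H: "nv H = nchords D"
    "\<And>i j. adj H i j \<longleftrightarrow> i \<noteq> j \<and> linked (chord D i) (chord D j)"
    and f: "graph_iso_via f H G"
  shows "circle_graph (nv G) (adj G)"
proof -
  have bij: "bij_betw f {..<nchords D} {..<nv G}"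
    and adj: "\<And>i j. i < nchords D \<Longrightarrow> j < nchords D \<Longrightarrow> adj G (f i) (f j) \<longleftrightarrow> i \<noteq> j
      \<and> linked (chord D i) (chord D j)"
    using f H by (auto simp: graph_iso_via_def)
  define g where "g = inv_into {..<nchords D} f"
  have g: "g i < nchords D" "f (g i) = i" if "i < nv G" for i
    using that bij_betw_imp_surj_on[OF bij] inv_into_into[of i f
      "{..<nchords D}"] f_inv_into_f[of i f "{..<nchords D}"]
    by (auto simp: g_def)
  have inj: "g i \<noteq> g j" if "i < nv G" "j < nv G" "i \<noteq> j" for i j using g that by metis
  have "is_chord_diagram \<lparr>nchords = nv G, chord = (\<lambda>i. chord D (g i))\<rparr>"
    using D g inj unfolding is_chord_diagram_def by simp
  moreover have "adj G i j \<longleftrightarrow> linked (chord D (g i)) (chord D (g j))" if "i < nv G" "j < nv G" "i \<noteq> j" for i j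
    using adj[OF g(1) g(1)] g(2) inj that by metis
  ultimately show ?thesis unfolding circle_graph_def by blast
qed

lemma labeled_realisable_iff:
  assumes G: "is_labeled_graph G"
  shows "labeled_realisable G \<longleftrightarrow> circle_graph (nv G) (adj G)"
proof
  assume "labeled_realisable G"
  then obtain D f where D: "is_labeled_chord_diagram D" "graph_iso_via f (labeled_intersection_graph D) G"
    unfolding labeled_realisable_def labeled_iso_def by blast
  show "circle_graph (nv G) (adj G)"
    by (rule circle_graph_of_diagram[OF _ _ _ D(2)])
      (use D(1) in \<open>auto simp: is_labeled_chord_diagram_def labeled_intersection_graph_def\<close>)
next
  assume "circle_graph (nv G) (adj G)"
  then obtain c where c: "is_chord_diagram \<lparr>nchords = nv G, chord = c\<rparr>"
    "\<And>i j. i < nv G \<Longrightarrow> j < nv G \<Longrightarrow> i \<noteq> j \<Longrightarrow> adj G i j \<longleftrightarrow> linked (c i) (c j)"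
    unfolding circle_graph_def by blast
  define D where "D = \<lparr>nchords = nv G, chord = c, cframing = framing G, csign = vsign G\<rparr>"
  have "is_labeled_chord_diagram D"
    using c(1) G by (simp add: is_labeled_chord_diagram_def is_chord_diagram_def D_def is_labeled_graph_def)
  moreover have "labeled_iso (labeled_intersection_graph D) G"
    unfolding labeled_iso_def graph_iso_via_def
    using c(2) is_labeled_graphD(1)[OF G]
    by (intro exI[of _ id]) (auto simp: labeled_intersection_graph_def D_def)
  ultimately show "labeled_realisable G" unfolding labeled_realisable_def by blast
qed

lemma looped_realisable_iff:
  assumes L: "is_looped_graph L"
  shows "looped_realisable L \<longleftrightarrow> circle_graph (nv L) (adj L)"
proof
  assume "looped_realisable L"
  then obtain D :: chord_diagram and f where
    D: "is_chord_diagram D" "graph_iso_via f (intersection_graph D) (graph.truncate L)"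
    unfolding looped_realisable_def graph_iso_def by blast
  have "circle_graph (nv (graph.truncate L)) (adj (graph.truncate L))"
    by (rule circle_graph_of_diagram[OF D(1) _ _ D(2)]) (auto simp: intersection_graph_def)
  then show "circle_graph (nv L) (adj L)" by (simp add: graph.truncate_def)
next
  assume "circle_graph (nv L) (adj L)"
  then obtain c where c: "is_chord_diagram \<lparr>nchords = nv L, chord = c\<rparr>"
    "\<And>i j. i < nv L \<Longrightarrow> j < nv L \<Longrightarrow> i \<noteq> j \<Longrightarrow> adj L i j \<longleftrightarrow> linked (c i) (c j)"
    unfolding circle_graph_def by blast
  have "graph_iso (intersection_graph \<lparr>nchords = nv L, chord = c\<rparr>) (graph.truncate L)"
    unfolding graph_iso_def graph_iso_via_def
    using c(2) is_looped_graphD(1)[OF L]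
    by (intro exI[of _ id]) (auto simp: intersection_graph_def graph.truncate_def)
  with c(1) show "looped_realisable L" unfolding looped_realisable_def by blast
qed

section \<open>Reflection of an arc\<close>

definition inside :: "real \<times> real \<Rightarrow> real \<Rightarrow> bool" where
  "inside c t \<longleftrightarrow> min (fst c) (snd c) < t \<and> t < max (fst c) (snd c)"

lemma linked_inside:
  assumes "fst d \<noteq> snd d"
  shows "linked c d \<longleftrightarrow> inside c (fst d) \<noteq> inside c (snd d)"
  using assms by (auto simp: linked_def endpoints_def inside_def Int_insert_left)

lemma inside_iff:
  assumes "t \<notin> endpoints c"
  shows "inside c t \<longleftrightarrow> (fst c < t) \<noteq> (snd c < t)"
  using assms by (auto simp: inside_def endpoints_def min_def max_def)

text \<open>Linking becomes the parity of four order comparisons, which makes the effect of the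
  reflection a propositional computation.\<close>

lemma linked_iff:
  assumes "fst d \<noteq> snd d" "endpoints c \<inter> endpoints d = {}"
  shows "linked c d \<longleftrightarrow>
    ((fst c < fst d) \<noteq> (snd c < fst d)) \<noteq> ((fst c < snd d) \<noteq> (snd c < snd d))"
  using linked_inside[OF assms(1), of c] inside_iff[of "fst d" c] inside_iff[of "snd d" c] assms(2)
  by (auto simp: endpoints_def)

text \<open>The reflection of the open arc cut off by \<open>c\<close>. Since \<open>inside\<close>
  is strict, the end points of \<open>c\<close> stay in place.\<close>

definition flip_arc :: "real \<times> real \<Rightarrow> real \<Rightarrow> real" where
  "flip_arc c t = (if inside c t then fst c + snd c - t else t)"

lemma flip_arc_less:
  assumes "x \<notin> endpoints c" "y \<notin> endpoints c" "x \<noteq> y"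
  shows "flip_arc c x < flip_arc c y \<longleftrightarrow> (x < y) \<noteq> (inside c x \<and> inside c y)"
  using assms by (auto simp: flip_arc_def inside_def endpoints_def min_def max_def split: if_splits)

lemma inside_flip_arc: "inside c (flip_arc c t) \<longleftrightarrow> inside c t"
  by (auto simp: flip_arc_def inside_def min_def max_def)

lemma flip_arc_inj: "flip_arc c x = flip_arc c y \<longleftrightarrow> x = y"
  by (metis add_diff_cancel_left' flip_arc_def inside_flip_arc diff_diff_eq2)

lemma flip_arc_range:
  assumes "endpoints c \<subseteq> {0..<B}" "t \<in> {0..<B}"
  shows "flip_arc c t \<in> {0..<B}"
  using assms by (auto simp: flip_arc_def inside_def endpoints_def min_def max_def split: if_splits)

text \<open>Reflecting the arc of chord \<open>v\<close> reverses the order of two points exactly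
  when both lie on it. For chords \<open>i\<close> and \<open>j\<close> the number of reversed
  comparisons is the product of their numbers of end points on the arc, and this is odd iff both are
  linked with \<open>v\<close>.\<close>

lemma circle_graph_local_complement:
  assumes a: "circle_graph n a" and v: "v < n"
  shows "circle_graph n (\<lambda>i j. a i j \<noteq> (i \<noteq> v \<and> j \<noteq> v \<and> a v i \<and> a v j))"
proof -
  obtain c where D: "is_chord_diagram \<lparr>nchords = n, chord = c\<rparr>"
    and adj: "\<And>i j. i < n \<Longrightarrow> j < n \<Longrightarrow> i \<noteq> j \<Longrightarrow> a i j \<longleftrightarrow> linked (c i) (c j)"
    using a unfolding circle_graph_def by blast
  have ne: "fst (c i) \<noteq> snd (c i)" and rng: "endpoints (c i) \<subseteq> {0..<2 * pi}" if "i < n" for i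
    using D that by (auto simp: is_chord_diagram_def)
  have disj: "endpoints (c i) \<inter> endpoints (c j) = {}" if "i < n" "j < n" "i \<noteq> j" for i j
    using D that by (auto simp: is_chord_diagram_def)
  let ?\<phi> = "flip_arc (c v)"
  define c' where "c' i = (?\<phi> (fst (c i)), ?\<phi> (snd (c i)))" for i
  have ep: "endpoints (c' i) = ?\<phi> ` endpoints (c i)" for i by (simp add: c'_def endpoints_def)
  have ne': "fst (c' i) \<noteq> snd (c' i)" if "i < n" for i
    using ne[OF that] by (simp add: c'_def flip_arc_inj)
  have disj': "endpoints (c' i) \<inter> endpoints (c' j) = {}" if "i < n" "j < n" "i \<noteq> j" for i j
    using disj[OF that] by (auto simp: ep flip_arc_inj)
  have "endpoints (c' i) \<subseteq> {0..<2 * pi}" if "i < n" for i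
    using rng[OF that] flip_arc_range[OF rng[OF v]] unfolding ep by blast
  with ne' disj' have D': "is_chord_diagram \<lparr>nchords = n, chord = c'\<rparr>"
    by (simp add: is_chord_diagram_def)
  have c'v: "c' v = c v" by (auto simp: c'_def flip_arc_def inside_def prod_eq_iff)
  have av: "a v i \<longleftrightarrow> inside (c v) (fst (c i)) \<noteq> inside (c v) (snd (c i))" if "i < n" "i \<noteq> v" for i
    using adj[of v i] v that linked_inside[OF ne[OF that(1)]] by auto
  \<comment> \<open>\<open>linked\<close> is not symmetric by definition. The reflection is checked
    with \<open>v\<close> as the first chord; this transfers it to \<open>v\<close> as the
    second.\<close>
  have sym: "linked (e i) (e j) \<longleftrightarrow> linked (e j) (e i)"
    if "\<And>i. i < n \<Longrightarrow> fst (e i) \<noteq> snd (e i)" "\<And>i j. i < n \<Longrightarrow> j < n \<Longrightarrow> i \<noteq> j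
      \<Longrightarrow> endpoints (e i) \<inter> endpoints (e j) = {}"
      "i < n" "j < n" "i \<noteq> j" for i j and e :: "nat \<Rightarrow> real \<times> real"
  proof -
    have "fst (e i) \<noteq> fst (e j)" "fst (e i) \<noteq> snd (e j)" "snd (e i) \<noteq> fst (e j)" "snd (e i) \<noteq> snd (e j)"
      using that(2)[OF that(3-5)] by (auto simp: endpoints_def)
    then have "(fst (e j) < fst (e i)) = (\<not> fst (e i) < fst (e j))"
      "(snd (e j) < fst (e i)) = (\<not> fst (e i) < snd (e j))"
      "(fst (e j) < snd (e i)) = (\<not> snd (e i) < fst (e j))"
        "(snd (e j) < snd (e i)) = (\<not> snd (e i) < snd (e j))"
      by auto
    then show ?thesis
      using linked_iff[OF that(1)[OF that(4)] that(2)[OF that(3-5)]]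
        linked_iff[OF that(1)[OF that(3)] that(2)[OF that(4,3) that(5)[symmetric]]]
      by blast
  qed
  have linked_v: "linked (c' v) (c' i) \<longleftrightarrow> linked (c v) (c i)" if "i < n" for i
    using linked_inside[OF ne'[OF that], of "c v"] linked_inside[OF ne[OF that], of "c v"]
    by (simp add: c'v) (simp add: c'_def inside_flip_arc)
  have "linked (c' i) (c' j) \<longleftrightarrow> linked (c i) (c j) \<noteq> (a v i \<and> a v j)"
    if "i < n" "j < n" "i \<noteq> j" "i \<noteq> v" "j \<noteq> v" for i j
  proof -
    have out: "fst (c i) \<notin> endpoints (c v)" "snd (c i) \<notin> endpoints (c v)"
      "fst (c j) \<notin> endpoints (c v)" "snd (c j) \<notin> endpoints (c v)"
      using disj[OF that(1) v that(4)] disj[OF that(2) v that(5)] by (auto simp: endpoints_def)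
    have nes: "fst (c i) \<noteq> fst (c j)" "fst (c i) \<noteq> snd (c j)" "snd (c i) \<noteq> fst (c j)" "snd (c i) \<noteq> snd (c j)"
      using disj[OF that(1-3)] by (auto simp: endpoints_def)
    note fl = flip_arc_less[OF out(1,3) nes(1)] flip_arc_less[OF out(1,4) nes(2)]
      flip_arc_less[OF out(2,3) nes(3)] flip_arc_less[OF out(2,4) nes(4)]
    have "linked (c' i) (c' j) \<longleftrightarrow>
      ((?\<phi> (fst (c i)) < ?\<phi> (fst (c j))) \<noteq> (?\<phi> (snd (c i)) < ?\<phi> (fst (c j)))) \<noteq>
      ((?\<phi> (fst (c i)) < ?\<phi> (snd (c j))) \<noteq> (?\<phi> (snd (c i)) < ?\<phi> (snd (c j))))"
      using linked_iff[OF ne'[OF that(2)] disj'[OF that(1-3)]] by (simp add: c'_def)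
    then show ?thesis
      unfolding fl linked_iff[OF ne[OF that(2)] disj[OF that(1-3)]] av[OF that(1,4)] av[OF that(2,5)]
      by blast
  qed
  moreover have "linked (c' i) (c' v) \<longleftrightarrow> linked (c i) (c v)" if "i < n" "i \<noteq> v" for i
    using sym[of c i v] sym[of c' i v] ne ne' disj disj' linked_v that v by metis
  ultimately show ?thesis
    unfolding circle_graph_def
    by (intro exI[of _ c'] conjI D' allI impI) (metis adj linked_v)
qed

section \<open>Matrix inversion by principal pivots\<close>

text \<open>\<open>pivot_transform n X M M'\<close>: the matrix \<open>M'\<close> arises from \<open>M\<close> by exchanging the input and
  output coordinates in \<open>X\<close> (principal pivot transform). For \<open>X = {..<n}\<close> this is matrix inversion.\<close>

definition pivot_transform :: "nat \<Rightarrow> nat set \<Rightarrow> (nat \<Rightarrow> nat \<Rightarrow> bit) \<Rightarrow> (nat \<Rightarrow> nat \<Rightarrow> bit) \<Rightarrow> bool" where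
  "pivot_transform n X M M' \<longleftrightarrow> (\<forall>x y. (\<forall>i<n. y i = (\<Sum>j<n. M i j * x j)) \<longrightarrow>
     (\<forall>i<n. (if i \<in> X then x i else y i) = (\<Sum>j<n. M' i j * (if j \<in> X then y j else x j))))"

text \<open>Exchanging first \<open>Y\<close> and then \<open>X\<close> amounts to exchanging
  \<open>X - Y\<close>. The premise leads from \<open>M1\<close> back to \<open>M\<close>, so that
  solutions of the new system can be fed into the hypothesis on \<open>M\<close>.\<close>

lemma pivot_transform_step:
  assumes pt: "pivot_transform n X M M'" and Y: "Y \<subseteq> X"
    and step: "\<And>x1 y1. \<forall>i<n. y1 i = (\<Sum>j<n. M1 i j * x1 j) \<Longrightarrow>
      \<forall>i<n. (if i \<in> Y then x1 i else y1 i) = (\<Sum>j<n. M i j * (if j \<in> Y then y1 j else x1 j))"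
  shows "pivot_transform n (X - Y) M1 M'"
  unfolding pivot_transform_def
proof (intro allI impI)
  fix x1 y1 :: "nat \<Rightarrow> bit" and i assume y1: "\<forall>i<n. y1 i = (\<Sum>j<n. M1 i j * x1 j)" and i: "i < n"
  let ?x = "\<lambda>i. if i \<in> Y then y1 i else x1 i" and ?y = "\<lambda>i. if i \<in> Y then x1 i else y1 i"
  have "(if i \<in> X then ?x i else ?y i) = (\<Sum>j<n. M' i j * (if j \<in> X then ?y j else ?x j))"
    using pt[unfolded pivot_transform_def, rule_format, of ?y ?x i] step[OF y1] i by blast
  moreover have "(if j \<in> X then ?y j else ?x j) = (if j \<in> X - Y then y1 j else x1 j)"
    "(if j \<in> X then ?x j else ?y j) = (if j \<in> X - Y then x1 j else y1 j)" for j using Y by auto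
  ultimately show "(if i \<in> X - Y then x1 i else y1 i) = (\<Sum>j<n. M' i j * (if j \<in> X - Y then y1 j else x1 j))"
    by simp
qed

text \<open>A pivot on a diagonal 1 is one local complementation. If the diagonal vanishes on
  \<open>X\<close>, a pivot on an edge inside \<open>X\<close> amounts to three. The induction
  carries \<open>M'\<close> along, since its existence guarantees that such an edge is
  available.\<close>

lemma circle_graph_pivot_transform:
  assumes "pivot_transform n X M M'" "symmetric_on {..<n} M" "X \<subseteq> {..<n}" "circle_graph n (\<lambda>i j. M i j = 1)"
  shows "circle_graph n (\<lambda>i j. M' i j = 1)"
  using assms
proof (induction "card X" arbitrary: X M rule: less_induct)
  case less
  note pt = less.prems(1) and X = less.prems(3)
  have sym: "M i j = M j i" if "i < n" "j < n" for i j using less.prems(2) that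
    by (auto simp: symmetric_on_def)
  have finX: "finite X" using X finite_subset by auto
  consider "X = {}" | v where "v \<in> X" "M v v = 1" | v where "v \<in> X" "\<And>u. u \<in> X \<Longrightarrow> M u u = 0"
    by (metis bit_not_one_iff ex_in_conv)
  then show ?case
  proof cases
    case 1
    have "M' i j = M i j" if "i < n" "j < n" for i j
      using pt[unfolded pivot_transform_def 1, rule_format, of "\<lambda>i. \<Sum>k<n. M i k * of_bool (k = j)"
        "\<lambda>k. of_bool (k = j)" i] that
      by simp
    then show ?thesis using circle_graph_cong[OF less.prems(4)] by simp
  next
    case (2 v)
    then have v: "v < n" using X by auto
    \<comment> \<open>Over Z_2 the pivot on a diagonal 1 keeps row and column \<open>v\<close> and
      takes the Schur complement elsewhere.\<close>
    define M1 where "M1 i j = (if i = v \<or> j = v then M i j else M i j + M i v * M v j)" for i j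
    have "pivot_transform n (X - {v}) M1 M'"
    proof (rule pivot_transform_step[OF pt])
      show "{v} \<subseteq> X" using 2 by simp
      fix x1 y1 :: "nat \<Rightarrow> bit" assume y1: "\<forall>i<n. y1 i = (\<Sum>j<n. M1 i j * x1 j)"
      define s where "s i = (\<Sum>j\<in>{..<n} - {v}. M i j * x1 j)" for i
      have split: "(\<Sum>j<n. f j) = f v + (\<Sum>j\<in>{..<n} - {v}. f j)" for f :: "nat \<Rightarrow> bit"
        using v by (intro sum.remove) auto
      have y1v: "y1 v = x1 v + s v"
        using y1 v 2 by (simp add: split M1_def s_def)
      have y1i: "y1 i = M i v * x1 v + s i + M i v * s v" if "i < n" "i \<noteq> v" for i
      proof -
        have "(\<Sum>j\<in>{..<n} - {v}. M1 i j * x1 j) = (\<Sum>j\<in>{..<n} - {v}. M i j * x1 j + M i v * (M v j * x1 j))"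
          using that by (intro sum.cong) (auto simp: M1_def algebra_simps)
        then show ?thesis using y1 that by (simp add: split M1_def s_def sum.distrib sum_distrib_left)
      qed
      have s': "(\<Sum>j\<in>{..<n} - {v}. M i j * (if j \<in> {v} then y1 j else x1 j)) = s i" for i
        unfolding s_def by (intro sum.cong) auto
      show "\<forall>i<n. (if i \<in> {v} then x1 i else y1 i) = (\<Sum>j<n. M i j * (if j \<in> {v} then y1 j else x1 j))"
        unfolding split s' using y1v y1i 2 by (auto simp: algebra_simps)
    qed
    moreover have "symmetric_on {..<n} M1" using sym v by (auto simp: symmetric_on_def M1_def)
    moreover have "circle_graph n (\<lambda>i j. M1 i j = 1)"
    proof (rule circle_graph_cong[OF circle_graph_local_complement[OF less.prems(4) v]])
      fix i j assume "i < n" "j < n" "i \<noteq> j"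
      then show "(M1 i j = 1) = ((M i j = 1) \<noteq> (i \<noteq> v \<and> j \<noteq> v \<and> M v i = 1 \<and> M v j = 1))"
        using sym[of v i] v by (cases "M i j"; cases "M i v"; cases "M v j"; simp add: M1_def)
    qed
    moreover have "card (X - {v}) < card X" using 2 finX by (meson card_Diff1_less)
    ultimately show ?thesis using less.hyps[of "X - {v}" M1] X by blast
  next
    case (3 v)
    then have v: "v < n" using X by auto
    \<comment> \<open>Otherwise the input x = e_v would become zero after the exchange, although
      \<open>M'\<close> has to send it to a vector with entry 1 at \<open>v\<close>.\<close>
    have "\<exists>u\<in>X. M u v = 1"
    proof (rule ccontr)
      assume "\<not> ?thesis"
      then have 0: "M u v = 0" if "u \<in> X" for u using that by auto
      have "1 = (\<Sum>j<n. M' v j * (if j \<in> X then M j v else of_bool (j = v)))"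
        using pt[unfolded pivot_transform_def, rule_format, of "\<lambda>i. M i v"
          "\<lambda>k. of_bool (k = v)" v] v 3(1) by simp
      also have "\<dots> = 0" using 0 3(1) by (intro sum.neutral) auto
      finally show False by simp
    qed
    then obtain u where u: "u \<in> X" "M u v = 1" by blast
    then have un: "u < n" and uv: "u \<noteq> v" using X 3 by auto
    have Mb: "M u u = 0" "M v v = 0" "M u v = 1" "M v u = 1" using 3 u sym[OF un v] by auto
    \<comment> \<open>The pivot on the block with rows 01, 10, which is its own inverse: the rows
      and columns of \<open>u\<close> and \<open>v\<close> change places, and the Schur complement
      appears elsewhere.\<close>
    define M1 where "M1 i j = (if i = u then (if j = u then 0 else if j = v then 1 else M v j)
      else if i = v then (if j = u then 1 else if j = v then 0 else M u j)
      else if j = u then M i v else if j = v then M i u else M i j + M i u * M v j + M i v * M u j)" for i j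
    have "pivot_transform n (X - {u, v}) M1 M'"
    proof (rule pivot_transform_step[OF pt])
      show "{u, v} \<subseteq> X" using 3 u by simp
      fix x1 y1 :: "nat \<Rightarrow> bit" assume y1: "\<forall>i<n. y1 i = (\<Sum>j<n. M1 i j * x1 j)"
      define s where "s i = (\<Sum>j\<in>{..<n} - {u} - {v}. M i j * x1 j)" for i
      have split: "(\<Sum>j<n. f j) = f u + (f v + (\<Sum>j\<in>{..<n} - {u} - {v}. f j))" for f :: "nat \<Rightarrow> bit"
        using v un uv by (simp add: sum.remove[of "{..<n}" u] sum.remove[of "{..<n} - {u}" v])
      have M1s: "(\<Sum>j\<in>{..<n} - {u} - {v}. M1 u j * x1 j) = s v" "(\<Sum>j\<in>{..<n} - {u} - {v}. M1 v j * x1 j) = s u"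
        unfolding s_def using uv by (auto intro!: sum.cong simp: M1_def)
      have y1uv: "y1 u = x1 v + s v" "y1 v = x1 u + s u"
        using y1 v un uv by (simp_all add: split M1s) (simp_all add: M1_def)
      have y1i: "y1 i = M i v * x1 u + (M i u * x1 v + (s i + M i u * s v + M i v * s u))" if
        "i < n" "i \<noteq> u" "i \<noteq> v" for i
      proof -
        have "(\<Sum>j\<in>{..<n} - {u} - {v}. M1 i j * x1 j)
            = (\<Sum>j\<in>{..<n} - {u} - {v}. M i j * x1 j + M i u * (M v j * x1 j) + M i v * (M u j * x1 j))"
          using that by (intro sum.cong) (auto simp: M1_def algebra_simps)
        also have "\<dots> = s i + M i u * s v + M i v * s u"
          by (simp only: sum.distrib sum_distrib_left[symmetric] s_def)
        finally have "(\<Sum>j\<in>{..<n} - {u} - {v}. M1 i j * x1 j) = s i + M i u * s v + M i v * s u" .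
        then show ?thesis using y1 that uv by (simp add: split) (simp add: M1_def)
      qed
      have s': "(\<Sum>j\<in>{..<n} - {u} - {v}. M i j * (if j \<in> {u, v} then y1 j else x1 j)) = s i" for i
        unfolding s_def by (intro sum.cong) auto
      show "\<forall>i<n. (if i \<in> {u, v} then x1 i else y1 i) = (\<Sum>j<n. M i j * (if j \<in> {u, v} then y1 j else x1 j))"
        unfolding split s' using y1uv y1i Mb uv by (auto simp: algebra_simps)
    qed
    moreover have "symmetric_on {..<n} M1" using sym v un uv by (auto simp: symmetric_on_def M1_def)
    moreover have "circle_graph n (\<lambda>i j. M1 i j = 1)"
    proof -
      \<comment> \<open>Local complementation at \<open>u\<close>, \<open>v\<close>,
        \<open>u\<close> realises the edge pivot, including the exchange of \<open>u\<close> and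
        \<open>v\<close>.\<close>
      define b where "b i j \<longleftrightarrow> M i j = 1" for i j
      define b1 where "b1 i j \<longleftrightarrow> b i j \<noteq> (i \<noteq> u \<and> j \<noteq> u \<and> b u i \<and> b u j)" for i j
      define b2 where "b2 i j \<longleftrightarrow> b1 i j \<noteq> (i \<noteq> v \<and> j \<noteq> v \<and> b1 v i \<and> b1 v j)" for i j
      define b3 where "b3 i j \<longleftrightarrow> b2 i j \<noteq> (i \<noteq> u \<and> j \<noteq> u \<and> b2 u i \<and> b2 u j)" for i j
      have "circle_graph n b" using less.prems(4) by (simp only: b_def[abs_def])
      then have "circle_graph n b1"
        using circle_graph_local_complement[OF _ un] by (simp only: b1_def[abs_def])
      then have "circle_graph n b2"
        using circle_graph_local_complement[OF _ v] by (simp only: b2_def[abs_def])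
      then have "circle_graph n b3"
        using circle_graph_local_complement[OF _ un] by (simp only: b3_def[abs_def])
      then show ?thesis
      proof (rule circle_graph_cong)
        fix i j assume ij: "i < n" "j < n" "i \<noteq> j"
        have buv: "b u v" "b v u" "\<not> b u u" "\<not> b v v" using Mb by (simp_all add: b_def)
        have b1: "b1 u v" "b1 v u" "\<And>x. b1 u x = b u x" "\<And>x. b1 x u = b x u"
          "\<And>x. x \<noteq> u \<Longrightarrow> b1 v x = (b v x \<noteq> b u x)"
          "\<And>x. x \<noteq> u \<Longrightarrow> b1 x v = (b x v \<noteq> b u x)"
          using buv uv by (auto simp: b1_def)
        have b2: "b2 u v" "b2 v u" "\<And>x. x \<noteq> u \<Longrightarrow> x \<noteq> v \<Longrightarrow> b2 u x = b v x"
          "\<And>x. x \<noteq> u \<Longrightarrow> b2 v x = (b v x \<noteq> b u x)" "\<And>x. x \<noteq> u \<Longrightarrow> b2 x v = (b x v \<noteq> b u x)"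
          "\<And>x. x \<noteq> u \<Longrightarrow> x \<noteq> v \<Longrightarrow> b2 x u = (b x u \<noteq> (b v x \<noteq> b u x))"
          using b1 uv by (auto simp: b2_def)
        have s: "M i u = M u i" "M i v = M v i" "b i u = b u i" "b i v = b v i" using sym ij un v
          by (auto simp: b_def)
        have M1b: "M1 u v = 1" "M1 v u = 1" "\<And>x. x \<noteq> u \<Longrightarrow> x \<noteq> v \<Longrightarrow> M1 u x = M v x"
          "\<And>x. x \<noteq> u \<Longrightarrow> x \<noteq> v \<Longrightarrow> M1 v x = M u x" "\<And>x. x \<noteq> u \<Longrightarrow> x \<noteq> v \<Longrightarrow> M1 x u = M x v"
          "\<And>x. x \<noteq> u \<Longrightarrow> x \<noteq> v \<Longrightarrow> M1 x v = M x u"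
          using uv by (auto simp: M1_def)
        consider "i = u" "j = v" | "i = v" "j = u" | "i = u" "j \<noteq> u" "j \<noteq> v" | "i = v" "j \<noteq> u" "j \<noteq> v"
          | "j = u" "i \<noteq> u" "i \<noteq> v" | "j = v" "i \<noteq> u" "i \<noteq> v" | "i \<noteq> u" "i \<noteq> v" "j \<noteq> u" "j \<noteq> v"
          using ij by blast
        then show "(M1 i j = 1) = b3 i j"
        proof cases
          case 7
          have bit: "x + y = 1 \<longleftrightarrow> (x = 1) \<noteq> (y = 1)" "x * y = 1 \<longleftrightarrow> x = 1 \<and> y = 1" for x y :: bit
            by (cases x; cases y; simp)+
          have "(M1 i j = 1) = ((b i j \<noteq> (b u i \<and> b v j)) \<noteq> (b v i \<and> b u j))"
            using 7 s by (simp only: M1_def if_False bit b_def)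
          moreover have "b3 i j = (b2 i j \<noteq> (b v i \<and> b v j))"
            using 7 b2(3) by (simp only: b3_def) blast
          moreover have "b2 i j = (b1 i j \<noteq> ((b v i \<noteq> b u i) \<and> (b v j \<noteq> b u j)))"
            using 7 b1(5) by (simp only: b2_def) blast
          moreover have "b1 i j = (b i j \<noteq> (b u i \<and> b u j))"
            using 7 by (simp only: b1_def) blast
          ultimately show ?thesis by argo
        qed (use M1b b2 s uv in \<open>auto simp: b3_def b_def\<close>)
      qed
    qed
    moreover have "card (X - {u, v}) < card X" using 3 u finX by (intro psubset_card_mono) auto
    ultimately show ?thesis using less.hyps[of "X - {u, v}" M1] X by blast
  qed
qed

lemma circle_graph_inverse_on:
  assumes "inverse_on n M N" "symmetric_on {..<n} M" "circle_graph n (\<lambda>i j. M i j = 1)"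
  shows "circle_graph n (\<lambda>i j. N i j = 1)"
proof (rule circle_graph_pivot_transform[OF _ assms(2) subset_refl assms(3)])
  show "pivot_transform n {..<n} M N"
    unfolding pivot_transform_def
  proof (intro allI impI)
    fix x y :: "nat \<Rightarrow> bit" and i assume y: "\<forall>i<n. y i = (\<Sum>j<n. M i j * x j)" and i: "i < n"
    have "(\<Sum>j<n. N i j * (if j \<in> {..<n} then y j else x j)) = (\<Sum>j<n. N i j * (\<Sum>k<n. M j k * x k))"
      using y by (intro sum.cong) auto
    also have "\<dots> = x i" using inverse_on_apply[OF assms(1) i] .
    finally show "(if i \<in> {..<n} then x i else y i) = (\<Sum>j<n. N i j * (if j \<in> {..<n} then y j else x j))"
      using i by simp
  qed
qed

lemma inverse_pair_realisable:
  assumes p: "inverse_pair G L d"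
  shows "labeled_realisable G \<longleftrightarrow> looped_realisable L"
proof -
  note 1 = inverse_pairD[OF p]
  have G: "circle_graph (nv G) (adj G) \<longleftrightarrow> circle_graph (nv G) (\<lambda>i j. shifted_adj G i j = 1)"
    by (auto elim!: circle_graph_cong simp: shifted_adj_def)
  have L: "circle_graph (nv G) (adj L) \<longleftrightarrow> circle_graph (nv G) (\<lambda>i j. diag_adj L d i j = 1)"
    by (auto elim!: circle_graph_cong simp: diag_adj_def with_diag_def)
  have "circle_graph (nv G) (\<lambda>i j. shifted_adj G i j = 1) \<longleftrightarrow> circle_graph (nv G) (\<lambda>i j. diag_adj L d i j = 1)"
    using circle_graph_inverse_on[OF 1(4) symmetric_on_shifted_adj[OF 1(1)]]
      circle_graph_inverse_on[OF 1(5)] symmetric_on_diag_adj[OF 1(2), of d] 1(3)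
    by auto
  then show ?thesis
    using labeled_realisable_iff[OF 1(1)] looped_realisable_iff[OF 1(2)] G L 1(3) by simp
qed

section \<open>The correspondence of equivalence classes\<close>

lemma looped_iso_homotopy:
  assumes "is_looped_graph L" "is_looped_graph L'" "looped_iso L L'"
  shows "equivclp looped_move L L'"
  using assms by (intro r_into_equivclp) (simp add: looped_move_def)

lemma inverse_pair_iso:
  assumes G: "is_labeled_graph G" and iso: "labeled_iso G G'" and p: "inverse_pair G' L' d'"
  shows "\<exists>L d. inverse_pair G L d \<and> looped_iso L L'"
proof -
  note 1 = inverse_pairD[OF p]
  obtain f where f: "bij_betw f {..<nv G} {..<nv G'}"
    "\<And>i j. i < nv G \<Longrightarrow> j < nv G \<Longrightarrow> adj G' (f i) (f j) \<longleftrightarrow> adj G i j"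
    "\<And>i. i < nv G \<Longrightarrow> framing G' (f i) = framing G i \<and> vsign G' (f i) = vsign G i"
    using iso by (auto simp: labeled_iso_def graph_iso_via_def)
  have nv: "nv G = nv G'" using bij_betw_same_card[OF f(1)] by simp
  have fG: "bij_betw f {..<nv G'} {..<nv G'}" and fL: "bij_betw f {..<nv L'} {..<nv L'}"
    using f(1) nv 1(3) by simp_all
  note p' = inverse_pair_permute[OF p fG]
  have "inverse_pair G (permute_looped f L') (\<lambda>i. d' (f i))"
    by (rule inverse_pair_cong[OF p'])
      (use G nv 1(3) f inverse_pairD(2,6)[OF p'] in \<open>auto simp: shifted_adj_def\<close>)
  then show ?thesis using looped_iso_permute[OF fL] by blast
qed

text \<open>The effect of \<open>Omega_g3\<close> and \<open>Omega_g4\<close> is known for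
  \<open>G'\<close> with two vertices exchanged; here the exchange is undone on the looped
  side.\<close>

lemma graph_move_transpose_homotopy:
  assumes p: "inverse_pair (permute_labeled (Transposition.transpose u v) G') L1 d1"
    and uv: "u < nv G'" "v < nv G'" and p': "inverse_pair G' L' d'"
  shows "equivclp looped_move L1 L'"
proof -
  note 1 = inverse_pairD[OF p'] and 2 = inverse_pairD[OF p]
  let ?t = "Transposition.transpose u v"
  have bij: "bij_betw ?t {..<nv G'} {..<nv G'}" "bij_betw ?t {..<nv L'} {..<nv L'}"
    using bij_betw_transpose[OF uv] 1(3) by simp_all
  note q = inverse_pair_permute[OF p' bij(1)]
  note Lq = inverse_pairD(2)[OF q]
  have "equivclp looped_move L1 (permute_looped ?t L')"
    by (rule looped_iso_homotopy[OF 2(2) Lq inverse_pair_unique(1)[OF p q]])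
  moreover have "equivclp looped_move (permute_looped ?t L') L'"
    by (rule looped_iso_homotopy[OF Lq 1(2) looped_iso_permute[OF bij(2)]])
  ultimately show ?thesis by (rule equivclp_trans)
qed

lemma graph_move_homotopy:
  assumes m: "graph_move G G'" and p: "inverse_pair G L d" and p': "inverse_pair G' L' d'"
  shows "equivclp looped_move L L'"
proof -
  note 1 = inverse_pairD[OF p] and 2 = inverse_pairD[OF p']
  \<comment> \<open>\<open>G'\<close> determines its looped graph up to isomorphism, so it suffices
    to find one that is homotopic to \<open>L\<close>.\<close>
  have uniq: ?thesis if "inverse_pair G' L1 d1" "equivclp looped_move L L1" for L1 d1
    using equivclp_trans[OF that(2) looped_iso_homotopy[OF inverse_pairD(2)[OF that(1)] 2(2)
      inverse_pair_unique(1)[OF that(1) p']]] .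
  from m consider "labeled_iso G G'" | "Omega_g1 G G'" | "Omega_g2 G G'" | "Omega_g3 G G'"
    | "Omega_g4 G G'" | "Omega_g4' G G'" unfolding graph_move_def by blast
  then show ?thesis
  proof cases
    case 1
    obtain L1 d1 where q: "inverse_pair G L1 d1" "looped_iso L1 L'"
      using inverse_pair_iso[OF inverse_pairD(1)[OF p] 1 p'] by blast
    note Lq = inverse_pairD(2)[OF q(1)]
    have "equivclp looped_move L L1"
      by (rule looped_iso_homotopy[OF inverse_pairD(2)[OF p] Lq inverse_pair_unique(1)[OF p q(1)]])
    moreover have "equivclp looped_move L1 L'" by (rule looped_iso_homotopy[OF Lq 2(2) q(2)])
    ultimately show ?thesis by (rule equivclp_trans)
  next
    case g1: 2
    obtain L1 d1 where q: "Omega1 L L1" "inverse_pair G' L1 d1"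
      using Omega_g1_pair[OF p 2(1) g1] by blast
    have "looped_move L L1" using q inverse_pairD(2)[OF q(2)] 1(2) by (simp add: looped_move_def)
    then show ?thesis using uniq[OF q(2)] by blast
  next
    case g2: 3
    obtain L1 d1 where q: "Omega2 L L1" "inverse_pair G' L1 d1"
      using Omega_g2_pair[OF p 2(1) g2] by blast
    have "looped_move L L1" using q inverse_pairD(2)[OF q(2)] 1(2) by (simp add: looped_move_def)
    then show ?thesis using uniq[OF q(2)] by blast
  next
    case 4
    then obtain u v w where uvw': "{u, v, w} \<subseteq> {..<nv G}" "distinct [u, v, w]"
      and lab': "\<forall>x\<in>{u, v, w}. framing G x = 0 \<and> vsign G x = -1"
      and N: "nbhd G u = {v, w}" "\<not> adj G v w"
      and G': "G' = Omega_g3_result u v w G"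
      unfolding Omega_g3_def Omega_g3_result_def by blast
    have uvw: "u < nv G" "v < nv G" "w < nv G" "distinct [u, v, w]" using uvw' by auto
    have lab: "framing G x = 0 \<and> vsign G x = -1" if "x \<in> {u, v, w}" for x using lab' that by blast
    have even: "even_on_triangle u v w L" and type: "R3_type u v w L"
      and q: "inverse_pair (permute_labeled (Transposition.transpose v w) G') (toggle_triangle u v w L)
        (d(v := d v + 1, w := d w + 1))"
      unfolding G'
      by (rule Omega_g3_even[OF p uvw(4,1-3) _ N] Omega_g3_type[OF p uvw(4,1-3) _ N]
          Omega_g3_pair[OF p uvw(4,1-3) _ N], rule lab, assumption)+
    have "nv G' = nv G" by (simp add: G' Omega_g3_result_def)
    then have "equivclp looped_move (toggle_triangle u v w L) L'"
      using graph_move_transpose_homotopy[OF q _ _ p'] uvw by simp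
    moreover have "equivclp looped_move L (toggle_triangle u v w L)"
      by (rule homotopy_R3_type) (use 1(2,3) uvw even type in auto)
    ultimately show ?thesis using equivclp_trans by metis
  next
    case 5
    then obtain u v where uv: "u < nv G" "v < nv G" "u \<noteq> v" "adj G u v" "framing G u = 0" "framing G v = 0"
      and G': "G' = piv u v G \<lparr>vsign := (vsign G)(u := - vsign G v, v := - vsign G u)\<rparr>"
      unfolding Omega_g4_def by blast
    have "nv G' = nv G" by (simp add: G' piv_def)
    then show ?thesis
      using graph_move_transpose_homotopy[OF Omega_g4_pair(2)[OF p uv G'] _ _ p'] uv by simp
  next
    case 6
    then obtain v where v: "v < nv G" "framing G v = 1"
      and G': "G' = LC v G \<lparr>vsign := (vsign G)(v := - vsign G v),
                  framing := (\<lambda>x. if x \<in> nbhd G v then framing G x + 1 else framing G x)\<rparr>"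
      unfolding Omega_g4'_def by blast
    show ?thesis using uniq[OF Omega_g4'_pair[OF p v G']] by simp
  qed
qed

text \<open>A chain of moves passes through further labeled graphs, each of which needs a looped
  graph of its own; \<open>all\<close> supplies it, and in a graph-knot it holds because every
  member has corank zero.\<close>

lemma graph_equiv_homotopy:
  assumes eq: "equivclp graph_move G G'" and p: "inverse_pair G L d" and p': "inverse_pair G' L' d'"
    and all: "\<And>H. equivclp graph_move G H \<Longrightarrow> is_labeled_graph H \<Longrightarrow> \<exists>L d. inverse_pair H L d"
  shows "equivclp looped_move L L'"
proof -
  have "\<forall>L' d'. inverse_pair G' L' d' \<longrightarrow> equivclp looped_move L L'"
    using eq
  proof (induction rule: equivclp_induct)
    case base
    show ?case
      using looped_iso_homotopy inverse_pair_unique(1)[OF p] inverse_pairD(2) p by blast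
  next
    case (step H K)
    show ?case
    proof (intro allI impI)
      fix L' d' assume q: "inverse_pair K L' d'"
      have "is_labeled_graph H" using step(2) by (auto simp: graph_move_def)
      then obtain L1 d1 where r: "inverse_pair H L1 d1" using all step(1) by blast
      have "equivclp looped_move L1 L'"
        using step(2) graph_move_homotopy[OF _ r q] graph_move_homotopy[OF _ q r] equivclp_sym by metis
      then show "equivclp looped_move L L'" using step(3) r equivclp_trans by metis
    qed
  qed
  then show ?thesis using p' by blast
qed

text \<open>The counterpart of \<open>homotopy_R3_type\<close> in the other direction: with
  \<open>u\<close> looped the configuration is of type \<open>R3_type\<close> after a permutation;
  with \<open>u\<close> unlooped one switch at \<open>v\<close> leads to the type without
  loops.\<close>

lemma preimages_Omega3:
  assumes L: "is_looped_graph L" and o3: "Omega3 L L'"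
  shows "preimages_equiv L L'"
proof -
  have type: "preimages.r3_ok p q m (p \<noteq> q) (p = m) (q = m)" for p q m
    by (rule preimages.r3_okI) (auto intro!: preimages_R3_type simp: R3_type_def)
  have 1: "preimages.r3_ok False False True True True False"
    by (rule preimages.r3_ok_swap_uv) (use type[of False True False] in simp)
  have 2: "preimages.r3_ok False False True False True False"
    by (rule preimages.r3_ok_switch, simp, rule preimages.r3_ok_swap_vw, rule preimages.r3_ok_swap_uv)
      (use type[of False False True] in simp)
  obtain u v w where uvw: "{u, v, w} \<subseteq> {..<nv L}" "distinct [u, v, w]"
    and l: "loop L v" "\<not> loop L w" "adj L v w" "\<not> adj L u v" "\<not> adj L u w"
    and even: "\<forall>x<nv L. x \<notin> {u, v, w} \<longrightarrow> card (nbhd L x \<inter> {u, v, w}) \<in> {0, 2}"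
    and L': "L' = toggle {{u, v}, {u, w}, {v, w}} L"
    using o3 unfolding Omega3_def by blast
  have "even_on_triangle u v w L" using even_on_triangle_iff_card[OF L uvw(2,1)] even by blast
  then have "preimages_equiv L (toggle_triangle u v w L)"
    using 1 2 l uvw L by (cases "loop L u") (auto intro!: preimages.r3_okD)
  then show ?thesis by (simp add: L' toggle_triangle_def)
qed

lemma looped_move_preimages:
  assumes m: "looped_move L L'"
  shows "preimages_equiv L L'"
proof -
  have L: "is_looped_graph L" "is_looped_graph L'" using m by (simp_all add: looped_move_def)
  consider "looped_iso L L'" | "Omega1 L L'" | "Omega2 L L'" | "Omega3 L L'"
    using m unfolding looped_move_def by blast
  then show ?thesis
  proof cases
    case 2
    obtain G d where p: "inverse_pair G L d" using ex_inverse_pair[OF L(1)] by blast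
    obtain G' d' where p': "Omega_g1 G G'" "inverse_pair G' L' d'" using Omega1_pair[OF p L(2) 2] by blast
    then have "graph_move G G'" using inverse_pairD(1)[OF p] inverse_pairD(1)[OF p'(2)]
      by (simp add: graph_move_def)
    then show ?thesis using preimages_equivI[OF p p'(2)] by blast
  qed (use L preimages.R_iso preimages.R_Omega2 preimages_Omega3 in blast)+
qed

lemma homotopy_preimages:
  assumes "equivclp looped_move L L'" "is_looped_graph L"
  shows "preimages_equiv L L'"
  using assms(1)
proof (induction rule: equivclp_induct)
  case base
  show ?case using inverse_pair_diag_equiv by (auto simp: preimages_equiv_def)
next
  case (step K M)
  then have "is_looped_graph K" by (auto simp: looped_move_def)
  moreover have "preimages_equiv K M"
    using step(2) looped_move_preimages preimages.R_sym by blast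
  ultimately show ?case using step(3) preimages.R_trans by blast
qed

theorem corollary3p1:
  fixes F :: "labeled_graph set"
  assumes "graph_knot F"
  shows "nonrealisable_graph_link F \<longleftrightarrow> nonrealisable_homotopy_class (chi F)"
proof -
  have F: "F \<in> Collect is_labeled_graph // graph_link_rel"
    and cor: "\<And>G. G \<in> F \<Longrightarrow> corank (adj_matrix G + 1\<^sub>m (nv G)) = 0"
    using assms by (auto simp: graph_knot_def graph_link_def)
  obtain G1 where G1: "is_labeled_graph G1" "F = graph_link_rel `` {G1}"
    using F by (auto elim!: quotientE)
  define G0 where "G0 = (SOME G. G \<in> F)"
  have "G1 \<in> F" using G1 by (auto simp: graph_link_rel_def)
  then have "G0 \<in> F" unfolding G0_def by (rule someI)
  then have G0: "is_labeled_graph G0" "equivclp graph_move G1 G0" using G1(2)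
    by (auto simp: graph_link_rel_def)
  \<comment> \<open>The base point is moved to the representative that \<open>chi\<close>
    selects.\<close>
  have F_iff: "G \<in> F \<longleftrightarrow> is_labeled_graph G \<and> equivclp graph_move G0 G" for G
    using G1 G0 by (auto simp: graph_link_rel_def intro: equivclp_trans equivclp_sym)
  have pair: "\<exists>d. inverse_pair G (L_graph G) d" if "G \<in> F" for G
    using inverse_pair_L_graph[OF _ cor[OF that]] that F_iff by blast
  let ?L = "L_graph G0"
  obtain d0 where p0: "inverse_pair G0 ?L d0" using pair[OF \<open>G0 \<in> F\<close>] by blast
  note L0 = inverse_pairD(2)[OF p0]
  have chi: "L \<in> chi F \<longleftrightarrow> is_looped_graph L \<and> equivclp looped_move ?L L" for L
    using L0 by (simp add: chi_def homotopy_class_def homotopy_rel_def G0_def)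
  have "(\<exists>G\<in>F. labeled_realisable G) \<longleftrightarrow> (\<exists>L\<in>chi F. looped_realisable L)"
  proof
    assume "\<exists>G\<in>F. labeled_realisable G"
    then obtain G d where G: "G \<in> F" "labeled_realisable G" and p: "inverse_pair G (L_graph G) d"
      using pair by blast
    have "equivclp looped_move ?L (L_graph G)"
      by (rule graph_equiv_homotopy[OF _ p0 p]) (use G(1) F_iff pair in blast)+
    then have "L_graph G \<in> chi F" using inverse_pairD(2)[OF p] chi by blast
    moreover have "looped_realisable (L_graph G)" using inverse_pair_realisable[OF p] G(2) by blast
    ultimately show "\<exists>L\<in>chi F. looped_realisable L" by blast
  next
    assume "\<exists>L\<in>chi F. looped_realisable L"
    then obtain L where L: "is_looped_graph L" "equivclp looped_move ?L L" "looped_realisable L"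
      using chi by blast
    \<comment> \<open>\<open>L\<close> need not be the value of \<open>L_graph\<close> at a member
      of \<open>F\<close>; any \<open>G\<close> above it will do, since
      \<open>homotopy_preimages\<close> connects it to \<open>G0\<close>.\<close>
    obtain G d where p: "inverse_pair G L d" using ex_inverse_pair[OF L(1)] by blast
    have "equivclp graph_move G0 G"
      using homotopy_preimages[OF L(2) L0] p0 p unfolding preimages_equiv_def by blast
    then have "G \<in> F" using F_iff inverse_pairD(1)[OF p] by blast
    moreover have "labeled_realisable G" using inverse_pair_realisable[OF p] L(3) by blast
    ultimately show "\<exists>G\<in>F. labeled_realisable G" by blast
  qed
  then show ?thesis by (simp add: nonrealisable_graph_link_def nonrealisable_homotopy_class_def)
qed

end
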